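(* Let $(\mathcal M,\pi,N,\phi)$ be a Poisson quasi-Nijenhuis (PqN) manifold and let $\Omega$ be a closed $2$-form on $\mathcal M$. Put $$\widehat N=N+\pi^\sharp\,\Omega^\flat,\qquad \widehat\phi=\phi+\mathrm d_N\Omega+\tfrac12[\Omega,\Omega]_\pi .$$ Then $(\mathcal M,\pi,\widehat N,\widehat\phi)$ is a PqN manifold. In particular, if $\Omega$ is a solution of the equation $$\mathrm d_N\Omega+\tfrac12[\Omega,\Omega]_\pi=-\phi,$$ then $(\mathcal M,\pi,\widehat N)$ is a Poisson-Nijenhuis (PN) manifold.
   Context: All manifolds, bundles and sections are real and $C^\infty$. $\mathcal L$ is the Lie derivative, $\mathrm d$ the Cartan (de Rham) differential, $\langle\cdot,\cdot\rangle$ the pairing of 1-forms with vector fields. **Maps.** For a bivector field $\pi$, $\pi^\sharp:T^*\mathcal M\to T\mathcal M$ is defined by $\langle\beta,\pi^\sharp\alpha\rangle=\pi(\alpha,\beta)$. For a 2-form $\Omega$, $\Omega^\flat:T\mathcal M\to T^*\mathcal M$ is $\Omega^\flat(X)=i_X\Omega$. **Bracket $[\cdot,\cdot]_\pi$.** For a bivector field $\pi$ and 1-forms $\alpha,\beta$, $$[\alpha,\beta]_\pi=\mathcal L_{\pi^\sharp\alpha}\beta-\mathcal L_{\pi^\sharp\beta}\alpha-\mathrm d\langle\beta,\pi^\sharp\alpha\rangle .$$ If $\pi$ is Poisson, this is extended to the degree $-1$, $\mathbb R$-bilinear bracket on $\Gamma(\bigwedge^\bullet T^*\mathcal M)$ such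 that, for $\eta$ of degree $q$, $\eta'$ of degree $q'$ and any form $\eta''$: (K1) $[\eta,\eta']_\pi=-(-1)^{(q-1)(q'-1)}[\eta',\eta]_\pi$; (K2) $[\alpha,f]_\pi=\langle \mathrm df,\pi^\sharp\alpha\rangle$ for functions $f$ and 1-forms $\alpha$; (K3) $[\eta,\eta'\wedge\eta'']_\pi=[\eta,\eta']_\pi\wedge\eta''+(-1)^{(q-1)q'}\eta'\wedge[\eta,\eta'']_\pi$. **The operator $\mathrm d_N$.** For a $(1,1)$ tensor field $N:T\mathcal M\to T\mathcal M$ and a $p$-form $\alpha$ with $p\ge1$, $i_N\alpha(X_1,\dots,X_p)=\sum_{i=1}^p\alpha(X_1,\dots,NX_i,\dots,X_p)$, and $i_Nf=0$ for functions $f$. Then $\mathrm d_N=i_N\circ\mathrm d-\mathrm d\circ i_N$. **Compatibility.** A Poisson bivector $\pi$ and a $(1,1)$ tensor field $N$ are compatible if $N\pi^\sharp=\pi^\sharp N^*$ (where $N^*:T^*\mathcal M\to T^*\mathcal M$ is the transpose of $N$) and $[\alpha,\beta]_{\pi_N}=[N^*\alpha,\beta]_\pi+[\alpha,N^*\beta]_\pi-N^*[\alpha,\beta]_\pi$ for all 1-forms $\alpha,\beta$, where $\pi_N$ is the bivector field defined by $\pi_N^\sharp=N\pi^\sharp$. **Torsion.** $[X,Y]_N=[NX,Y]+[X,NY]-N[X,Y]$, and the Nijenhuis torsion of $N$ is $T_N(X,Y)=[NX,NY]-N[X,Y]_N$. **PqN and PN manifolds.** A Poisson quasi-Nijenhuis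 manifold is a quadruple $(\mathcal M,\pi,N,\phi)$ where $\pi$ is a Poisson bivector, $N$ a $(1,1)$ tensor field and $\phi$ a 3-form on $\mathcal M$ such that: (a) $\pi$ and $N$ are compatible; (b) the 3-forms $\phi$ and $i_N\phi$ are closed; (c) $T_N(X,Y)=\pi^\sharp(i_{X\wedge Y}\phi)$ for all vector fields $X,Y$, where $\langle i_{X\wedge Y}\phi,Z\rangle=\phi(X,Y,Z)$. A Poisson-Nijenhuis manifold $(\mathcal M,\pi,N)$ is a manifold with a Poisson bivector $\pi$ and a $(1,1)$ tensor field $N$ that are compatible and such that $T_N=0$. *)

theory Defs
  imports "HOL-Analysis.Analysis"
begin

section \<open>Smooth manifolds\<close>

primrec Ck_on :: "nat \<Rightarrow> 'a::real_normed_vector set \<Rightarrow> ('a \<Rightarrow> 'b::real_normed_vector) \<Rightarrow> bool" where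
  "Ck_on 0 S f \<longleftrightarrow> continuous_on S f"
| "Ck_on (Suc k) S f \<longleftrightarrow> (\<forall>x\<in>S. f differentiable at x) \<and>
     (\<forall>v. Ck_on k S (\<lambda>x. frechet_derivative f (at x) v))"

definition smooth_on :: "'a::real_normed_vector set \<Rightarrow> ('a \<Rightarrow> 'b::real_normed_vector) \<Rightarrow> bool" where
  "smooth_on S f \<longleftrightarrow> (\<forall>k. Ck_on k S f)"

text \<open>The manifold is the whole type \<open>'m\<close>, its smooth structure the one generated by an atlas
  (which need not be maximal); a chart is a pair of a domain and a map.\<close>

type_synonym ('m, 'e) atlas = "('m set \<times> ('m \<Rightarrow> 'e)) set"

definition smooth_atlas ::
    "('m::{t2_space,second_countable_topology}, 'e::euclidean_space) atlas \<Rightarrow> bool" where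
  "smooth_atlas A \<longleftrightarrow>
     (\<Union>(U, c)\<in>A. U) = UNIV \<and>
     (\<forall>(U, c)\<in>A. open U \<and> open (c ` U) \<and> (\<exists>c'. homeomorphism U (c ` U) c c')) \<and>
     (\<forall>(U, c)\<in>A. \<forall>(V, d)\<in>A. smooth_on (c ` (U \<inter> V)) (d \<circ> inv_into U c))"

definition smooth_fun :: "('m, 'e::euclidean_space) atlas \<Rightarrow> ('m \<Rightarrow> real) \<Rightarrow> bool" where
  "smooth_fun A f \<longleftrightarrow> (\<forall>(U, c)\<in>A. smooth_on (c ` U) (f \<circ> inv_into U c))"


section \<open>Tangent vectors, vector fields and forms\<close>

text \<open>Tangent vectors at \<open>p\<close> are derivations at \<open>p\<close> of the algebra of smooth functions. Since
  they are represented by total functions, they are extended by zero to non-smooth functions, so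
  that equality of tangent vectors is equality in HOL. For the same reason covectors, forms and
  endomorphisms below vanish on arguments that are not tangent vectors at the base point.\<close>

type_synonym 'm tvec = "('m \<Rightarrow> real) \<Rightarrow> real"
type_synonym 'm vfield = "'m \<Rightarrow> 'm tvec"
type_synonym 'm mform = "'m tvec list \<Rightarrow> real"
type_synonym 'm dform = "'m \<Rightarrow> 'm mform"
type_synonym 'm endo = "'m \<Rightarrow> 'm tvec \<Rightarrow> 'm tvec"
type_synonym 'm bivec = "'m \<Rightarrow> 'm mform \<Rightarrow> 'm mform \<Rightarrow> real"

definition tangent_space :: "('m, 'e::euclidean_space) atlas \<Rightarrow> 'm \<Rightarrow> 'm tvec set" where
  "tangent_space A p = {v.
     (\<forall>f g a b. smooth_fun A f \<longrightarrow> smooth_fun A g \<longrightarrow>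
        v (\<lambda>q. a * f q + b * g q) = a * v f + b * v g) \<and>
     (\<forall>f g. smooth_fun A f \<longrightarrow> smooth_fun A g \<longrightarrow>
        v (\<lambda>q. f q * g q) = f p * v g + g p * v f) \<and>
     (\<forall>f. \<not> smooth_fun A f \<longrightarrow> v f = 0)}"

definition vector_field :: "('m, 'e::euclidean_space) atlas \<Rightarrow> 'm vfield \<Rightarrow> bool" where
  "vector_field A X \<longleftrightarrow> (\<forall>p. X p \<in> tangent_space A p) \<and>
     (\<forall>f. smooth_fun A f \<longrightarrow> smooth_fun A (\<lambda>p. X p f))"

definition lie_bracket :: "'m vfield \<Rightarrow> 'm vfield \<Rightarrow> 'm vfield" where
  "lie_bracket X Y = (\<lambda>p f. X p (\<lambda>q. Y q f) - Y p (\<lambda>q. X q f))"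

definition alt_forms :: "('m, 'e::euclidean_space) atlas \<Rightarrow> 'm \<Rightarrow> nat \<Rightarrow> 'm mform set" where
  "alt_forms A p k = {\<omega>.
     (\<forall>vs. \<not> (length vs = k \<and> set vs \<subseteq> tangent_space A p) \<longrightarrow> \<omega> vs = 0) \<and>
     (\<forall>vs i u w a b. length vs = k \<longrightarrow> set vs \<subseteq> tangent_space A p \<longrightarrow> i < k \<longrightarrow>
        u \<in> tangent_space A p \<longrightarrow> w \<in> tangent_space A p \<longrightarrow>
        \<omega> (vs[i := (\<lambda>f. a * u f + b * w f)]) = a * \<omega> (vs[i := u]) + b * \<omega> (vs[i := w])) \<and>
     (\<forall>vs i j. length vs = k \<longrightarrow> set vs \<subseteq> tangent_space A p \<longrightarrow> i < j \<longrightarrow> j < k \<longrightarrow>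
        vs ! i = vs ! j \<longrightarrow> \<omega> vs = 0)}"

definition eval_form :: "'m dform \<Rightarrow> 'm vfield list \<Rightarrow> 'm \<Rightarrow> real" where
  "eval_form \<omega> Xs = (\<lambda>p. \<omega> p (map (\<lambda>X. X p) Xs))"

definition diff_form :: "('m, 'e::euclidean_space) atlas \<Rightarrow> nat \<Rightarrow> 'm dform \<Rightarrow> bool" where
  "diff_form A k \<omega> \<longleftrightarrow> (\<forall>p. \<omega> p \<in> alt_forms A p k) \<and>
     (\<forall>Xs. length Xs = k \<longrightarrow> (\<forall>X\<in>set Xs. vector_field A X) \<longrightarrow> smooth_fun A (eval_form \<omega> Xs))"

definition form0 :: "('m \<Rightarrow> real) \<Rightarrow> 'm dform" where
  "form0 f = (\<lambda>p vs. if vs = [] then f p else 0)"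

definition endo_field :: "('m, 'e::euclidean_space) atlas \<Rightarrow> 'm endo \<Rightarrow> bool" where
  "endo_field A N \<longleftrightarrow>
     (\<forall>p. \<forall>v\<in>tangent_space A p. N p v \<in> tangent_space A p) \<and>
     (\<forall>p a b. \<forall>v\<in>tangent_space A p. \<forall>w\<in>tangent_space A p.
        N p (\<lambda>f. a * v f + b * w f) = (\<lambda>f. a * N p v f + b * N p w f)) \<and>
     (\<forall>p v. v \<notin> tangent_space A p \<longrightarrow> N p v = (\<lambda>f. 0)) \<and>
     (\<forall>X. vector_field A X \<longrightarrow> vector_field A (\<lambda>p. N p (X p)))"

definition bivector_field :: "('m, 'e::euclidean_space) atlas \<Rightarrow> 'm bivec \<Rightarrow> bool" where
  "bivector_field A \<pi> \<longleftrightarrow>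
     (\<forall>p a b. \<forall>\<alpha>\<in>alt_forms A p 1. \<forall>\<beta>\<in>alt_forms A p 1. \<forall>\<gamma>\<in>alt_forms A p 1.
        \<pi> p (\<lambda>vs. a * \<alpha> vs + b * \<beta> vs) \<gamma> = a * \<pi> p \<alpha> \<gamma> + b * \<pi> p \<beta> \<gamma>) \<and>
     (\<forall>p. \<forall>\<alpha>\<in>alt_forms A p 1. \<forall>\<beta>\<in>alt_forms A p 1. \<pi> p \<alpha> \<beta> = - \<pi> p \<beta> \<alpha>) \<and>
     (\<forall>\<alpha> \<beta>. diff_form A 1 \<alpha> \<longrightarrow> diff_form A 1 \<beta> \<longrightarrow> smooth_fun A (\<lambda>p. \<pi> p (\<alpha> p) (\<beta> p)))"


section \<open>Differential calculus\<close>

text \<open>Conventions without factorials: \<open>(\<alpha> \<and> \<beta>)(X, Y) = \<alpha>(X) \<beta>(Y) - \<alpha>(Y) \<beta>(X)\<close> and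
  \<open>(d\<alpha>)(X, Y) = X(\<alpha>(Y)) - Y(\<alpha>(X)) - \<alpha>([X, Y])\<close> for 1-forms.\<close>

definition delete_nth :: "nat \<Rightarrow> 'a list \<Rightarrow> 'a list" where
  "delete_nth i xs = take i xs @ drop (Suc i) xs"

text \<open>The exterior derivative of a form of degree \<open>k\<close>, by the invariant formula; as tangent
  vectors extend to vector fields and the formula is tensorial, it determines a unique form.\<close>

definition ext_d :: "('m, 'e::euclidean_space) atlas \<Rightarrow> nat \<Rightarrow> 'm dform \<Rightarrow> 'm dform" where
  "ext_d A k \<omega> = (THE \<eta>. diff_form A (Suc k) \<eta> \<and>
     (\<forall>Xs. length Xs = Suc k \<longrightarrow> (\<forall>X\<in>set Xs. vector_field A X) \<longrightarrow>
        (\<forall>p. eval_form \<eta> Xs p =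
           (\<Sum>i\<le>k. (-1) ^ i * (Xs ! i) p (eval_form \<omega> (delete_nth i Xs))) +
           (\<Sum>j\<le>k. \<Sum>i<j. (-1) ^ (i + j) *
              eval_form \<omega> (lie_bracket (Xs ! i) (Xs ! j) # delete_nth i (delete_nth j Xs)) p))))"

definition closed_form :: "('m, 'e::euclidean_space) atlas \<Rightarrow> nat \<Rightarrow> 'm dform \<Rightarrow> bool" where
  "closed_form A k \<omega> \<longleftrightarrow> ext_d A k \<omega> = (\<lambda>p vs. 0)"

definition lie_deriv ::
    "('m, 'e::euclidean_space) atlas \<Rightarrow> nat \<Rightarrow> 'm vfield \<Rightarrow> 'm dform \<Rightarrow> 'm dform" where
  "lie_deriv A k X \<omega> = (THE \<eta>. diff_form A k \<eta> \<and>
     (\<forall>Ys. length Ys = k \<longrightarrow> (\<forall>Y\<in>set Ys. vector_field A Y) \<longrightarrow>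
        (\<forall>p. eval_form \<eta> Ys p =
           X p (eval_form \<omega> Ys) - (\<Sum>i<k. eval_form \<omega> (Ys[i := lie_bracket X (Ys ! i)]) p))))"

text \<open>Sum over all shuffles; degrees need not be specified, because a form of degree \<open>k\<close> vanishes
  on lists whose length differs from \<open>k\<close>.\<close>

definition wedge :: "'m dform \<Rightarrow> 'm dform \<Rightarrow> 'm dform" where
  "wedge \<omega> \<eta> = (\<lambda>p vs. \<Sum>I\<in>Pow {..<length vs}.
     (-1) ^ card {(i, j). i \<in> I \<and> j \<notin> I \<and> j < i} * \<omega> p (nths vs I) * \<eta> p (nths vs (- I)))"

definition ins_endo :: "'m endo \<Rightarrow> 'm dform \<Rightarrow> 'm dform" where
  "ins_endo N \<omega> = (\<lambda>p vs. \<Sum>i<length vs. \<omega> p (vs[i := N p (vs ! i)]))"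

definition d_endo ::
    "('m, 'e::euclidean_space) atlas \<Rightarrow> nat \<Rightarrow> 'm endo \<Rightarrow> 'm dform \<Rightarrow> 'm dform" where
  "d_endo A k N \<omega> = (\<lambda>p vs. ins_endo N (ext_d A k \<omega>) p vs - ext_d A k (ins_endo N \<omega>) p vs)"

definition transpose_endo :: "'m endo \<Rightarrow> 'm \<Rightarrow> 'm mform \<Rightarrow> 'm mform" where
  "transpose_endo N p \<alpha> = (\<lambda>vs. \<alpha> (map (N p) vs))"

definition transpose_form :: "'m endo \<Rightarrow> 'm dform \<Rightarrow> 'm dform" where
  "transpose_form N \<alpha> = (\<lambda>p. transpose_endo N p (\<alpha> p))"

definition flat :: "'m dform \<Rightarrow> 'm \<Rightarrow> 'm tvec \<Rightarrow> 'm mform" where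
  "flat \<Omega> p v = (\<lambda>ws. \<Omega> p (v # ws))"

definition sharp ::
    "('m, 'e::euclidean_space) atlas \<Rightarrow> 'm bivec \<Rightarrow> 'm \<Rightarrow> 'm mform \<Rightarrow> 'm tvec" where
  "sharp A \<pi> p \<alpha> = (THE v. v \<in> tangent_space A p \<and> (\<forall>\<beta>\<in>alt_forms A p 1. \<beta> [v] = \<pi> p \<alpha> \<beta>))"

definition sharp_field ::
    "('m, 'e::euclidean_space) atlas \<Rightarrow> 'm bivec \<Rightarrow> 'm dform \<Rightarrow> 'm vfield" where
  "sharp_field A \<pi> \<alpha> = (\<lambda>p. sharp A \<pi> p (\<alpha> p))"


section \<open>Poisson bivectors and the bracket on forms\<close>

definition poisson_bracket ::
    "('m, 'e::euclidean_space) atlas \<Rightarrow> 'm bivec \<Rightarrow> ('m \<Rightarrow> real) \<Rightarrow> ('m \<Rightarrow> real) \<Rightarrow> 'm \<Rightarrow> real" where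
  "poisson_bracket A \<pi> f g = (\<lambda>p. \<pi> p (ext_d A 0 (form0 f) p) (ext_d A 0 (form0 g) p))"

definition poisson_bivector :: "('m, 'e::euclidean_space) atlas \<Rightarrow> 'm bivec \<Rightarrow> bool" where
  "poisson_bivector A \<pi> \<longleftrightarrow> bivector_field A \<pi> \<and>
     (\<forall>f g h p. smooth_fun A f \<longrightarrow> smooth_fun A g \<longrightarrow> smooth_fun A h \<longrightarrow>
        poisson_bracket A \<pi> f (poisson_bracket A \<pi> g h) p +
        poisson_bracket A \<pi> g (poisson_bracket A \<pi> h f) p +
        poisson_bracket A \<pi> h (poisson_bracket A \<pi> f g) p = 0)"

definition bracket1 ::
    "('m, 'e::euclidean_space) atlas \<Rightarrow> 'm bivec \<Rightarrow> 'm dform \<Rightarrow> 'm dform \<Rightarrow> 'm dform" where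
  "bracket1 A \<pi> \<alpha> \<beta> = (\<lambda>p vs.
     lie_deriv A 1 (sharp_field A \<pi> \<alpha>) \<beta> p vs - lie_deriv A 1 (sharp_field A \<pi> \<beta>) \<alpha> p vs -
     ext_d A 0 (form0 (eval_form \<beta> [sharp_field A \<pi> \<alpha>])) p vs)"

text \<open>\<open>B\<close> is the extension of \<open>bracket1 A \<pi>\<close> to forms of all degrees, of degree \<open>-1\<close>. In
  particular the bracket of two functions is zero. The conditions determine \<open>B\<close> on homogeneous
  forms. The exponents are integers, so that \<open>q - 1\<close> is not truncated at \<open>q = 0\<close>.\<close>

definition koszul_bracket ::
    "('m, 'e::euclidean_space) atlas \<Rightarrow> 'm bivec \<Rightarrow> ('m dform \<Rightarrow> 'm dform \<Rightarrow> 'm dform) \<Rightarrow> bool" where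
  "koszul_bracket A \<pi> B \<longleftrightarrow>
     (\<forall>q q' \<eta> \<eta>'. diff_form A q \<eta> \<longrightarrow> diff_form A q' \<eta>' \<longrightarrow> q + q' > 0 \<longrightarrow>
        diff_form A (q + q' - 1) (B \<eta> \<eta>')) \<and>
     (\<forall>\<eta> \<eta>'. diff_form A 0 \<eta> \<longrightarrow> diff_form A 0 \<eta>' \<longrightarrow> B \<eta> \<eta>' = (\<lambda>p vs. 0)) \<and>
     (\<forall>q q' \<eta> \<zeta> \<eta>' a b. diff_form A q \<eta> \<longrightarrow> diff_form A q \<zeta> \<longrightarrow> diff_form A q' \<eta>' \<longrightarrow>
        B (\<lambda>p vs. a * \<eta> p vs + b * \<zeta> p vs) \<eta>' = (\<lambda>p vs. a * B \<eta> \<eta>' p vs + b * B \<zeta> \<eta>' p vs) \<and>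
        B \<eta>' (\<lambda>p vs. a * \<eta> p vs + b * \<zeta> p vs) = (\<lambda>p vs. a * B \<eta>' \<eta> p vs + b * B \<eta>' \<zeta> p vs)) \<and>
     (\<forall>\<alpha> \<beta>. diff_form A 1 \<alpha> \<longrightarrow> diff_form A 1 \<beta> \<longrightarrow> B \<alpha> \<beta> = bracket1 A \<pi> \<alpha> \<beta>) \<and>
     (\<forall>\<alpha> f. diff_form A 1 \<alpha> \<longrightarrow> smooth_fun A f \<longrightarrow>
        B \<alpha> (form0 f) = form0 (eval_form (ext_d A 0 (form0 f)) [sharp_field A \<pi> \<alpha>])) \<and>
     (\<forall>q q' \<eta> \<eta>'. diff_form A q \<eta> \<longrightarrow> diff_form A q' \<eta>' \<longrightarrow>
        B \<eta> \<eta>' = (\<lambda>p vs. - ((-1) powi ((int q - 1) * (int q' - 1))) * B \<eta>' \<eta> p vs)) \<and>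
     (\<forall>q q' q'' \<eta> \<eta>' \<eta>''. diff_form A q \<eta> \<longrightarrow> diff_form A q' \<eta>' \<longrightarrow> diff_form A q'' \<eta>'' \<longrightarrow>
        B \<eta> (wedge \<eta>' \<eta>'') = (\<lambda>p vs. wedge (B \<eta> \<eta>') \<eta>'' p vs +
          (-1) powi ((int q - 1) * int q') * wedge \<eta>' (B \<eta> \<eta>'') p vs))"


section \<open>Poisson quasi-Nijenhuis manifolds\<close>

text \<open>The bivector whose sharp map is \<open>N \<circ> sharp A \<pi> p\<close>.\<close>

definition bivec_endo ::
    "('m, 'e::euclidean_space) atlas \<Rightarrow> 'm bivec \<Rightarrow> 'm endo \<Rightarrow> 'm bivec" where
  "bivec_endo A \<pi> N = (\<lambda>p \<alpha> \<beta>. \<beta> [N p (sharp A \<pi> p \<alpha>)])"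

definition compatible :: "('m, 'e::euclidean_space) atlas \<Rightarrow> 'm bivec \<Rightarrow> 'm endo \<Rightarrow> bool" where
  "compatible A \<pi> N \<longleftrightarrow>
     (\<forall>p. \<forall>\<alpha>\<in>alt_forms A p 1. N p (sharp A \<pi> p \<alpha>) = sharp A \<pi> p (transpose_endo N p \<alpha>)) \<and>
     (\<forall>\<alpha> \<beta>. diff_form A 1 \<alpha> \<longrightarrow> diff_form A 1 \<beta> \<longrightarrow>
        bracket1 A (bivec_endo A \<pi> N) \<alpha> \<beta> =
        (\<lambda>p vs. bracket1 A \<pi> (transpose_form N \<alpha>) \<beta> p vs + bracket1 A \<pi> \<alpha> (transpose_form N \<beta>) p vs -
           transpose_form N (bracket1 A \<pi> \<alpha> \<beta>) p vs))"

definition apply_endo :: "'m endo \<Rightarrow> 'm vfield \<Rightarrow> 'm vfield" where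
  "apply_endo N X = (\<lambda>p. N p (X p))"

definition bracket_endo :: "'m endo \<Rightarrow> 'm vfield \<Rightarrow> 'm vfield \<Rightarrow> 'm vfield" where
  "bracket_endo N X Y = (\<lambda>p f. lie_bracket (apply_endo N X) Y p f +
     lie_bracket X (apply_endo N Y) p f - apply_endo N (lie_bracket X Y) p f)"

definition torsion :: "'m endo \<Rightarrow> 'm vfield \<Rightarrow> 'm vfield \<Rightarrow> 'm vfield" where
  "torsion N X Y = (\<lambda>p f. lie_bracket (apply_endo N X) (apply_endo N Y) p f -
     apply_endo N (bracket_endo N X Y) p f)"

definition PqN_manifold ::
    "('m::{t2_space,second_countable_topology}, 'e::euclidean_space) atlas \<Rightarrow>
      'm bivec \<Rightarrow> 'm endo \<Rightarrow> 'm dform \<Rightarrow> bool" where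
  "PqN_manifold A \<pi> N \<phi> \<longleftrightarrow>
     smooth_atlas A \<and> poisson_bivector A \<pi> \<and> endo_field A N \<and> diff_form A 3 \<phi> \<and>
     compatible A \<pi> N \<and>
     closed_form A 3 \<phi> \<and> closed_form A 3 (ins_endo N \<phi>) \<and>
     (\<forall>X Y. vector_field A X \<longrightarrow> vector_field A Y \<longrightarrow>
        torsion N X Y = sharp_field A \<pi> (\<lambda>p ws. \<phi> p (X p # Y p # ws)))"

definition PN_manifold ::
    "('m::{t2_space,second_countable_topology}, 'e::euclidean_space) atlas \<Rightarrow>
      'm bivec \<Rightarrow> 'm endo \<Rightarrow> bool" where
  "PN_manifold A \<pi> N \<longleftrightarrow>
     smooth_atlas A \<and> poisson_bivector A \<pi> \<and> endo_field A N \<and> compatible A \<pi> N \<and>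
     (\<forall>X Y. vector_field A X \<longrightarrow> vector_field A Y \<longrightarrow> torsion N X Y = (\<lambda>p f. 0))"

definition deformed_endo ::
    "('m, 'e::euclidean_space) atlas \<Rightarrow> 'm bivec \<Rightarrow> 'm endo \<Rightarrow> 'm dform \<Rightarrow> 'm endo" where
  "deformed_endo A \<pi> N \<Omega> = (\<lambda>p v f. N p v f + sharp A \<pi> p (flat \<Omega> p v) f)"

end

theory Submission
  imports Defs
begin

text \<open>Put \<open>P = \<pi>\<^sup>\<sharp> \<Omega>\<^sup>\<flat>\<close>, so that the deformed endomorphism is \<open>N + P\<close>. Since \<open>\<Omega>\<close> is closed, \<open>[\<Omega>, \<eta>]\<^sub>\<pi>\<close> and
  \<open>i\<^sub>P d\<eta> - d i\<^sub>P \<eta>\<close> agree for \<open>\<eta>\<close> a function or an exact 1-form, hence for every 2-form, because both are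
  derivations. With \<open>\<eta> = \<Omega>\<close> this gives \<open>[\<Omega>, \<Omega>]\<^sub>\<pi> = - d i\<^sub>P \<Omega>\<close>, and the deformed 3-form is
  \<open>\<phi> - d i\<^sub>N \<Omega> - 1/2 d i\<^sub>P \<Omega>\<close>, which is closed.

  Paired with a 1-form \<open>\<beta>\<close>, compatibility becomes the identity
  \<open>\<beta>([\<pi>\<^sup>\<sharp>\<alpha>, NX] - N[\<pi>\<^sup>\<sharp>\<alpha>, X]) = d(N\<^sup>*\<alpha>)(\<pi>\<^sup>\<sharp>\<beta>, X) - d\<alpha>(\<pi>\<^sup>\<sharp>\<beta>, NX)\<close>, which is additive in \<open>N\<close> and holds for \<open>P\<close>.
  Together with \<open>d\<Omega> = 0\<close> it also computes the mixed term of the torsion of \<open>N + P\<close>.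

  That \<open>i\<^bsub>N + P\<^esub>\<close> of the deformed 3-form is closed follows from the identity
  \<open>d i\<^sub>K d i\<^sub>K \<Omega> = d i\<^sub>T \<Omega>\<close>, where \<open>T\<close> is the torsion of \<open>K\<close>, applied to \<open>K = N\<close>, \<open>K = P\<close> and \<open>K = N + P\<close>.\<close>

section \<open>Smooth functions on open sets\<close>

text \<open>\<open>ext_d\<close>, \<open>lie_deriv\<close> and \<open>sharp\<close> are definite
  descriptions, so nothing can be computed with them before existence is proved. For the first two,
  existence is tensoriality of an expression in global vector fields. The obstacle is that tangent
  vectors are derivations of the algebra of global smooth functions: coordinates and coordinate
  fields of a chart are not directly available. Local objects are therefore cut off by bump
  functions. For every point there is a function \<open>\<theta>\<close>, nonzero there, such that
  \<open>\<theta>\<close> times any tangent vector is a combination of finitely many global fields;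
  \<open>\<theta>\<close> is cancelled at that point at the very end. Extension of vectors and
  covectors, tensoriality, existence of sharp and the reduction of identities to exact forms all
  rest on this one expansion. The bracket \<open>B\<close> is never constructed; only its axioms are
  available. Two derivations are compared through their difference, which is linear over functions
  although neither side is, and a functional on forms that is linear over functions vanishes once it
  vanishes on df or on df \<and> dg.\<close>

lemma frechet_derivative_cong_open:
  assumes "open S" "x \<in> S" "\<And>y. y \<in> S \<Longrightarrow> f y = g y"
  shows "frechet_derivative f (at x) = frechet_derivative g (at x)"
proof -
  have "(f has_derivative D) (at x) \<longleftrightarrow> (g has_derivative D) (at x)" for D
    using assms has_derivative_transform_within_open[of f D x UNIV S g]
      has_derivative_transform_within_open[of g D x UNIV S f] by auto
  then show ?thesis
    by (simp add: frechet_derivative_def)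
qed

lemma differentiable_cong_open:
  assumes "open S" "x \<in> S" "\<And>y. y \<in> S \<Longrightarrow> f y = g y" "f differentiable at x"
  shows "g differentiable at x"
  using assms has_derivative_transform_within_open[of f _ x UNIV S g]
  unfolding differentiable_def by blast

lemma Ck_on_cong:
  assumes "open S" "\<And>y. y \<in> S \<Longrightarrow> f y = g y" "Ck_on k S f"
  shows "Ck_on k S g"
  using assms(2,3)
proof (induction k arbitrary: f g)
  case 0
  then show ?case by (simp cong: continuous_on_cong)
next
  case (Suc k)
  have "frechet_derivative f (at x) = frechet_derivative g (at x)" if "x \<in> S" for x
    using frechet_derivative_cong_open[OF assms(1) that, of f g] Suc.prems by auto
  then have "Ck_on k S (\<lambda>x. frechet_derivative g (at x) v)" for v
    using Suc.IH[of "\<lambda>x. frechet_derivative f (at x) v" "\<lambda>x. frechet_derivative g (at x) v"]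
      Suc.prems by simp
  moreover have "\<forall>x\<in>S. g differentiable at x"
    using differentiable_cong_open[OF assms(1), of _ f g] Suc.prems by auto
  ultimately show ?case by simp
qed

lemma Ck_on_subset: "Ck_on k S f \<Longrightarrow> T \<subseteq> S \<Longrightarrow> Ck_on k T f"
  by (induction k arbitrary: f) (auto intro: continuous_on_subset)

lemma Ck_on_SucD: "Ck_on (Suc k) S f \<Longrightarrow> Ck_on k S f"
proof (induction k arbitrary: f)
  case 0
  then show ?case
    by (simp add: continuous_on_eq_continuous_within differentiable_at_withinI
        differentiable_imp_continuous_within)
qed auto

lemma Ck_on_imp_continuous_on: "Ck_on k S f \<Longrightarrow> continuous_on S f"
  by (induction k) (auto dest: Ck_on_SucD simp del: Ck_on.simps(2))

lemma Ck_on_local: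
  assumes "\<And>x. x \<in> S \<Longrightarrow> \<exists>T. open T \<and> x \<in> T \<and> Ck_on k T f"
  shows "Ck_on k S f"
  using assms
proof (induction k arbitrary: f)
  case 0
  show ?case
    unfolding Ck_on.simps continuous_on_eq_continuous_within
  proof
    fix x assume "x \<in> S"
    then obtain T where "open T" "x \<in> T" "continuous_on T f" using 0 by auto
    then show "continuous (at x within S) f"
      using continuous_on_eq_continuous_at continuous_at_imp_continuous_at_within by blast
  qed
next
  case (Suc k)
  then show ?case by fastforce
qed

lemma Ck_on_const [simp]: "Ck_on k S (\<lambda>x. c)"
  by (induction k arbitrary: c) auto

lemma Ck_on_bounded_linear: 
  assumes "bounded_linear L" shows "Ck_on k S L"
proof (cases k)
  case 0
  then show ?thesis using assms by (simp add: linear_continuous_on)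
next
  case (Suc n)
  have "frechet_derivative L (at x) = L" for x
    using assms by (metis bounded_linear_imp_has_derivative frechet_derivative_at)
  then show ?thesis
    using assms Suc by (simp add: bounded_linear_imp_differentiable)
qed

text \<open>Lets an induction step supply an explicit formula for the derivative in place of
  \<open>frechet_derivative\<close>, with which it agrees only on \<open>S\<close>; openness of
  \<open>S\<close> carries this agreement to the higher derivatives.\<close>

lemma Ck_on_SucI:
  assumes "open S" and der: "\<And>x. x \<in> S \<Longrightarrow> (f has_derivative D x) (at x)"
    and D: "\<And>v. Ck_on k S (\<lambda>x. D x v)"
  shows "Ck_on (Suc k) S f"
proof -
  have "D x v = frechet_derivative f (at x) v" if "x \<in> S" for x v
    using frechet_derivative_at[OF der[OF that]] by (rule fun_cong)
  then have "Ck_on k S (\<lambda>x. frechet_derivative f (at x) v)" for v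
    by (rule Ck_on_cong[OF assms(1) _ D])
  moreover have "\<forall>x\<in>S. f differentiable at x"
    unfolding differentiable_def using der by blast
  ultimately show ?thesis unfolding Ck_on.simps by (intro conjI allI)
qed

lemma Ck_on_Suc_has_derivative:
  "Ck_on (Suc k) S f \<Longrightarrow> x \<in> S \<Longrightarrow> (f has_derivative frechet_derivative f (at x)) (at x)"
  by (simp add: frechet_derivative_works[symmetric])

lemma Ck_on_Suc_frechet_derivative:
  "Ck_on (Suc k) S f \<Longrightarrow> Ck_on k S (\<lambda>x. frechet_derivative f (at x) v)"
  by simp

lemma Ck_on_bounded_linear_compose:
  assumes "bounded_linear L" "Ck_on k S f" "open S" shows "Ck_on k S (\<lambda>x. L (f x))"
  using assms(2)
proof (induction k arbitrary: f)
  case 0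
  then show ?case
    using assms(1) by (simp add: bounded_linear.continuous_on)
next
  case (Suc k)
  show ?case
    by (rule Ck_on_SucI[OF assms(3)
          bounded_linear.has_derivative[OF assms(1) Ck_on_Suc_has_derivative[OF Suc.prems]]
          Suc.IH[OF Ck_on_Suc_frechet_derivative[OF Suc.prems]]])
qed

lemma Ck_on_add:
  assumes "open S" "Ck_on k S f" "Ck_on k S g" shows "Ck_on k S (\<lambda>x. f x + g x)"
  using assms(2,3)
proof (induction k arbitrary: f g)
  case 0
  then show ?case by (simp add: continuous_on_add)
next
  case (Suc k)
  note d = Ck_on_Suc_has_derivative[OF Suc.prems(1)] Ck_on_Suc_has_derivative[OF Suc.prems(2)]
  note D = Ck_on_Suc_frechet_derivative[OF Suc.prems(1)] Ck_on_Suc_frechet_derivative[OF Suc.prems(2)]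
  show ?case
    by (rule Ck_on_SucI[OF assms(1) has_derivative_add[OF d] Suc.IH[OF D]])
qed

lemma Ck_on_mult:
  fixes f g :: "'a::real_normed_vector \<Rightarrow> real"
  assumes "open S" "Ck_on k S f" "Ck_on k S g" shows "Ck_on k S (\<lambda>x. f x * g x)"
  using assms(2,3)
proof (induction k arbitrary: f g)
  case 0
  then show ?case by (simp add: continuous_on_mult)
next
  case (Suc k)
  note d = Ck_on_Suc_has_derivative[OF Suc.prems(1)] Ck_on_Suc_has_derivative[OF Suc.prems(2)]
  note D = Ck_on_Suc_frechet_derivative[OF Suc.prems(1)] Ck_on_Suc_frechet_derivative[OF Suc.prems(2)]
  note fg = Ck_on_SucD[OF Suc.prems(1)] Ck_on_SucD[OF Suc.prems(2)]
  show ?case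
    by (rule Ck_on_SucI[OF assms(1) has_derivative_mult[OF d]
          Ck_on_add[OF assms(1) Suc.IH[OF fg(1) D(2)] Suc.IH[OF D(1) fg(2)]]])
qed

lemma Ck_on_sum:
  assumes "open S" "\<And>i. i \<in> I \<Longrightarrow> Ck_on k S (f i)"
  shows "Ck_on k S (\<lambda>x. \<Sum>i\<in>I. f i x)"
proof (cases "finite I")
  case True
  then show ?thesis using assms(2)
  proof (induction I rule: finite_induct)
    case (insert i I)
    then have "Ck_on k S (\<lambda>x. f i x + (\<Sum>i\<in>I. f i x))"
      by (intro Ck_on_add[OF assms(1)]) auto
    then show ?case using insert by simp
  qed simp
qed simp

lemma linear_eq_sum_Basis:
  fixes L :: "'a::euclidean_space \<Rightarrow> real"
  assumes "linear L" shows "L v = (\<Sum>b\<in>Basis. (v \<bullet> b) * L b)"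
proof -
  have "L v = L (\<Sum>b\<in>Basis. (v \<bullet> b) *\<^sub>R b)"
    by (simp add: euclidean_representation)
  also have "\<dots> = (\<Sum>b\<in>Basis. (v \<bullet> b) * L b)"
    by (simp only: linear_sum[OF assms] linear_scale[OF assms] real_scaleR_def)
  finally show ?thesis .
qed

text \<open>The chain rule applies a linear map depending on the point to a vector depending on the
  point. Expanding the vector in the basis turns this into a finite sum of products, and each factor
  is covered by the induction hypothesis or by smoothness of \<open>f\<close>.\<close>

lemma Ck_on_compose:
  fixes f :: "'a::real_normed_vector \<Rightarrow> 'b::euclidean_space" and g :: "'b \<Rightarrow> real"
  assumes "open S" "open T" "f ` S \<subseteq> T" "Ck_on k S f" "Ck_on k T g"
  shows "Ck_on k S (\<lambda>x. g (f x))"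
  using assms(4,5)
proof (induction k arbitrary: g)
  case 0
  then show ?case using assms(3) by (auto intro: continuous_on_compose2)
next
  case (Suc k)
  let ?D = "\<lambda>x v. \<Sum>b\<in>Basis. (frechet_derivative f (at x) v \<bullet> b) * frechet_derivative g (at (f x)) b"
  show ?case
  proof (rule Ck_on_SucI[OF assms(1)])
    fix x assume x: "x \<in> S"
    then have "f x \<in> T" using assms(3) by blast
    note f = Ck_on_Suc_has_derivative[OF Suc.prems(1) x]
      and g = Ck_on_Suc_has_derivative[OF Suc.prems(2) this]
    have "(\<lambda>v. frechet_derivative g (at (f x)) (frechet_derivative f (at x) v)) = ?D x"
      by (rule ext, rule linear_eq_sum_Basis[OF has_derivative_linear[OF g]])
    with has_derivative_compose[OF f g]
    show "((\<lambda>x. g (f x)) has_derivative ?D x) (at x)" by (simp only:)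
  next
    fix v
    show "Ck_on k S (\<lambda>x. ?D x v)"
    proof (rule Ck_on_sum[OF assms(1)], rule Ck_on_mult[OF assms(1)])
      fix b :: 'b
      show "Ck_on k S (\<lambda>x. frechet_derivative f (at x) v \<bullet> b)"
        by (rule Ck_on_bounded_linear_compose[OF bounded_linear_inner_left _ assms(1)])
          (rule Ck_on_Suc_frechet_derivative[OF Suc.prems(1)])
      show "Ck_on k S (\<lambda>x. frechet_derivative g (at (f x)) b)"
        by (rule Suc.IH[OF Ck_on_SucD[OF Suc.prems(1)] Ck_on_Suc_frechet_derivative[OF Suc.prems(2)]])
    qed
  qed
qed

lemma smooth_on_frechet_derivative:
  "smooth_on S f \<Longrightarrow> smooth_on S (\<lambda>x. frechet_derivative f (at x) v)"
  unfolding smooth_on_def by (metis Ck_on.simps(2))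

lemma smooth_on_differentiable: "smooth_on S f \<Longrightarrow> x \<in> S \<Longrightarrow> f differentiable at x"
  unfolding smooth_on_def by (metis Ck_on.simps(2))

lemma smooth_on_has_derivative:
  "smooth_on S f \<Longrightarrow> x \<in> S \<Longrightarrow> (f has_derivative frechet_derivative f (at x)) (at x)"
  by (simp add: frechet_derivative_works[THEN iffD1] smooth_on_differentiable)

lemma smooth_on_continuous_on: "smooth_on S f \<Longrightarrow> continuous_on S f"
  unfolding smooth_on_def using Ck_on_imp_continuous_on by blast

lemma smooth_on_subset: "smooth_on S f \<Longrightarrow> T \<subseteq> S \<Longrightarrow> smooth_on T f"
  unfolding smooth_on_def using Ck_on_subset by blast

lemma smooth_on_cong:
  "smooth_on S f \<Longrightarrow> open S \<Longrightarrow> (\<And>y. y \<in> S \<Longrightarrow> f y = g y) \<Longrightarrow> smooth_on S g"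
  unfolding smooth_on_def using Ck_on_cong by blast

lemma smooth_on_local:
  assumes "\<And>x. x \<in> S \<Longrightarrow> \<exists>T. open T \<and> x \<in> T \<and> smooth_on T f"
  shows "smooth_on S f"
  unfolding smooth_on_def
proof
  fix k show "Ck_on k S f"
    by (rule Ck_on_local) (use assms in \<open>unfold smooth_on_def, blast\<close>)
qed

lemma smooth_on_const: "smooth_on S (\<lambda>x. c)"
  by (simp add: smooth_on_def)

lemma smooth_on_bounded_linear: "bounded_linear L \<Longrightarrow> smooth_on S L"
  by (simp add: smooth_on_def Ck_on_bounded_linear)

lemma smooth_on_add:
  "open S \<Longrightarrow> smooth_on S f \<Longrightarrow> smooth_on S g \<Longrightarrow> smooth_on S (\<lambda>x. f x + g x)"
  by (simp add: smooth_on_def Ck_on_add)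

lemma smooth_on_mult:
  fixes f g :: "'a::real_normed_vector \<Rightarrow> real"
  shows "open S \<Longrightarrow> smooth_on S f \<Longrightarrow> smooth_on S g \<Longrightarrow> smooth_on S (\<lambda>x. f x * g x)"
  by (simp add: smooth_on_def Ck_on_mult)

lemma smooth_on_sum:
  "open S \<Longrightarrow> (\<And>i. i \<in> I \<Longrightarrow> smooth_on S (f i)) \<Longrightarrow> smooth_on S (\<lambda>x. \<Sum>i\<in>I. f i x)"
  by (simp add: smooth_on_def Ck_on_sum)

lemma smooth_on_compose:
  fixes f :: "'a::real_normed_vector \<Rightarrow> 'b::euclidean_space" and g :: "'b \<Rightarrow> real"
  assumes "open S" "open T" "f ` S \<subseteq> T" "smooth_on S f" "smooth_on T g"
  shows "smooth_on S (\<lambda>x. g (f x))"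
  using assms by (auto simp: smooth_on_def intro: Ck_on_compose)

section \<open>The flat function exp (- 1 / x)\<close>

definition flat_fun :: "nat \<Rightarrow> real \<Rightarrow> real" where
  "flat_fun n x = (if x > 0 then (1 / x) ^ n * exp (- (1 / x)) else 0)"

lemma flat_fun_tendsto_0: "(flat_fun n \<longlongrightarrow> 0) (at_right 0)"
proof -
  have "((\<lambda>x::real. inverse x ^ n / exp (inverse x)) \<longlongrightarrow> 0) (at_right 0)"
    by (rule filterlim_compose[OF tendsto_power_div_exp_0 filterlim_inverse_at_top_right])
  moreover have "\<forall>\<^sub>F x::real in at_right 0. inverse x ^ n / exp (inverse x) = flat_fun n x"
    using eventually_at_right_less
    by eventually_elim (simp add: flat_fun_def exp_minus field_simps inverse_eq_divide)
  ultimately show ?thesis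
    by (rule Lim_transform_eventually)
qed

text \<open>The family is closed under differentiation up to linear combinations. This is why the
  powers of 1 / x are carried along, although only the exponent 0 serves as a cutoff.\<close>

lemma flat_fun_has_field_derivative:
  "(flat_fun n has_field_derivative (flat_fun (n + 2) x - real n * flat_fun (n + 1) x)) (at x)"
proof (cases x "0::real" rule: linorder_cases)
  case less
  have "((\<lambda>x. 0) has_field_derivative 0) (at x)" by simp
  then have "(flat_fun n has_field_derivative 0) (at x)"
    by (rule has_field_derivative_transform_within_open[of _ _ _ "{..<0}"])
      (use less in \<open>auto simp: flat_fun_def\<close>)
  then show ?thesis using less by (simp add: flat_fun_def)
next
  case greater
  have "((\<lambda>x. inverse x ^ n * exp (- inverse x)) has_field_derivative
      (inverse x ^ n * (exp (- inverse x) * inverse x ^ 2) +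
       real n * inverse x ^ (n - 1) * - (inverse x ^ 2) * exp (- inverse x))) (at x)"
    using greater by (auto intro!: derivative_eq_intros simp: power2_eq_square)
  also have "inverse x ^ n * (exp (- inverse x) * inverse x ^ 2) +
       real n * inverse x ^ (n - 1) * - (inverse x ^ 2) * exp (- inverse x) =
       flat_fun (n + 2) x - real n * flat_fun (n + 1) x"
    using greater by (cases n) (auto simp: flat_fun_def inverse_eq_divide power2_eq_square)
  finally show ?thesis
    by (rule has_field_derivative_transform_within_open[of _ _ _ "{0<..}"])
      (use greater in \<open>auto simp: flat_fun_def inverse_eq_divide\<close>)
next
  case equal
  \<comment> \<open>Division by y raises the exponent by one, so the difference quotient at 0 is,
    from the right, the next member of the family, which tends to 0; from the left it is
    zero.\<close>
  have "((\<lambda>y. (flat_fun n y - flat_fun n 0) / (y - 0)) \<longlongrightarrow> 0) (at 0)"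
  proof (rule filterlim_split_at)
    have "\<forall>\<^sub>F y in at_left (0::real). 0 = (flat_fun n y - flat_fun n 0) / (y - 0)"
      unfolding eventually_at_filter by (rule always_eventually) (auto simp: flat_fun_def)
    then show "((\<lambda>y. (flat_fun n y - flat_fun n 0) / (y - 0)) \<longlongrightarrow> 0) (at_left 0)"
      by (rule Lim_transform_eventually[OF tendsto_const])
    have "\<forall>\<^sub>F y in at_right (0::real). flat_fun (Suc n) y = (flat_fun n y - flat_fun n 0) / (y - 0)"
      using eventually_at_right_less by eventually_elim (simp add: flat_fun_def)
    then show "((\<lambda>y. (flat_fun n y - flat_fun n 0) / (y - 0)) \<longlongrightarrow> 0) (at_right 0)"
      by (rule Lim_transform_eventually[OF flat_fun_tendsto_0])
  qed
  then show ?thesis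
    using equal by (simp add: has_field_derivative_iff flat_fun_def)
qed

lemma smooth_on_flat_fun: "smooth_on UNIV (flat_fun n)"
proof -
  have "Ck_on k UNIV (flat_fun n)" for k
  proof (induction k arbitrary: n)
    case 0
    then show ?case
      by (auto intro!: DERIV_continuous_on flat_fun_has_field_derivative)
  next
    case (Suc k)
    show ?case
    proof (rule Ck_on_SucI)
      show "(flat_fun n has_derivative
          (*) (flat_fun (n + 2) x + (- real n) * flat_fun (n + 1) x)) (at x)" for x
        using flat_fun_has_field_derivative[of n x] by (simp add: has_field_derivative_def)
      show "Ck_on k UNIV (\<lambda>x. (flat_fun (n + 2) x + (- real n) * flat_fun (n + 1) x) * v)" for v
        by (intro Ck_on_add Ck_on_mult Suc.IH Ck_on_const open_UNIV)
    qed simp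
  qed
  then show ?thesis by (simp add: smooth_on_def)
qed

section \<open>Integrals along segments and Hadamard's lemma\<close>

lemma segment_in_convex:
  assumes "convex S" "a \<in> S" "x \<in> S" "0 \<le> t" "t \<le> 1"
  shows "a + t *\<^sub>R (x - a) \<in> S"
  using convexD_alt[OF assms(1-5)] by (simp add: algebra_simps)

text \<open>Differentiation under the integral sign. The chain rule contributes one more factor t,
  so the weights t^m make the family of these integrals closed under directional derivatives, and
  smoothness follows by induction.\<close>

lemma has_derivative_segment_integral:
  fixes F :: "'e::euclidean_space \<Rightarrow> real"
  assumes S: "open S" "convex S" "a \<in> S" and F: "smooth_on S F" and x: "x \<in> S"
  shows "((\<lambda>x. integral {0..1} (\<lambda>t. t ^ m * F (a + t *\<^sub>R (x - a)))) has_derivative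
    (\<lambda>v. integral {0..1} (\<lambda>t. t ^ Suc m * frechet_derivative F (at (a + t *\<^sub>R (x - a))) v))) (at x)"
proof -
  let ?s = "\<lambda>x t. a + t *\<^sub>R (x - a)"
  \<comment> \<open>\<open>leibniz_rule\<close> asks for a derivative that is continuous as a map
    into bounded linear functions; in finite dimension this is checked on basis vectors.\<close>
  let ?D = "\<lambda>x t. Blinfun (\<lambda>v. t ^ Suc m * frechet_derivative F (at (?s x t)) v)"
  have s: "?s x t \<in> S" if "x \<in> S" "t \<in> {0..1}" for x and t :: real
    using segment_in_convex[OF S(2,3)] that by auto
  have der: "((\<lambda>x. t ^ m * F (?s x t)) has_derivative
      (\<lambda>v. t ^ Suc m * frechet_derivative F (at (?s x t)) v)) (at x)"
    if "x \<in> S" "t \<in> {0..1}" for x t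
  proof -
    note F' = smooth_on_has_derivative[OF F s[OF that]]
    have "((\<lambda>x. ?s x t) has_derivative (\<lambda>v. t *\<^sub>R v)) (at x)"
      by (auto intro!: derivative_eq_intros)
    from has_derivative_mult_right[OF has_derivative_compose[OF this F'], of "t ^ m"]
    show ?thesis
      by (simp add: linear_scale[OF has_derivative_linear[OF F']] mult.assoc mult.left_commute)
  qed
  then have bl: "bounded_linear (\<lambda>v. t ^ Suc m * frechet_derivative F (at (?s x t)) v)"
    if "x \<in> S" "t \<in> {0..1}" for x t
    using that has_derivative_bounded_linear by blast
  have cs: "continuous_on (S \<times> cbox 0 1) (\<lambda>(x, t). ?s x t)"
    by (auto intro!: continuous_intros simp: split_beta)
  have comp: "continuous_on (S \<times> cbox 0 1) (\<lambda>(x, t). G (?s x t))" if "continuous_on S G"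
    for G :: "'e \<Rightarrow> real"
    using continuous_on_compose2[OF that cs] s by (force simp: split_beta)
  have cont: "continuous_on (S \<times> cbox 0 1) (\<lambda>(x, t). ?D x t)"
  proof (rule continuous_on_blinfun_componentwise)
    fix i :: 'e
    have "continuous_on (S \<times> cbox 0 1)
        (\<lambda>(x, t). (\<lambda>y. t ^ Suc m) x * frechet_derivative F (at (?s x t)) i)"
      using comp[OF smooth_on_continuous_on[OF smooth_on_frechet_derivative[OF F, of i]]]
      by (auto intro!: continuous_intros simp: split_beta)
    then show "continuous_on (S \<times> cbox 0 1)
        (\<lambda>z. blinfun_apply (case z of (x, t) \<Rightarrow> ?D x t) i)"
      by (rule continuous_on_eq) (auto simp: bounded_linear_Blinfun_apply[OF bl] simp del: power_Suc)
  qed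
  have cF: "continuous_on (cbox 0 1) (\<lambda>t. t ^ m * F (?s x t))" if "x \<in> S" for x
    by (intro continuous_intros continuous_on_compose2[OF smooth_on_continuous_on[OF F]])
      (use s that in auto)
  have "((\<lambda>x. integral (cbox 0 1) (\<lambda>t. t ^ m * F (?s x t))) has_derivative
      integral (cbox 0 1) (?D x)) (at x within S)"
  proof (rule leibniz_rule[OF _ _ cont x S(2)])
    show "((\<lambda>x. t ^ m * F (?s x t)) has_derivative blinfun_apply (?D x t)) (at x within S)"
      if "x \<in> S" "t \<in> cbox 0 1" for x t
      using that der[of x t] bl[of x t]
      by (simp add: bounded_linear_Blinfun_apply has_derivative_at_withinI)
    show "(\<lambda>t. t ^ m * F (?s x t)) integrable_on cbox 0 1" if "x \<in> S" for x
      using cF[OF that] by (rule integrable_continuous)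
  qed
  moreover have "blinfun_apply (integral (cbox 0 1) (?D x)) =
      (\<lambda>v. integral {0..1} (\<lambda>t. t ^ Suc m * frechet_derivative F (at (?s x t)) v))"
  proof
    fix v
    have "continuous_on (cbox 0 1) ((\<lambda>(x, t). ?D x t) \<circ> Pair x)"
      by (rule continuous_on_compose)
        (use x in \<open>auto intro!: continuous_intros continuous_on_subset[OF cont] simp del: power_Suc\<close>)
    then have "continuous_on (cbox 0 1) (?D x)" by (simp only: o_def prod.case)
    then have "?D x integrable_on cbox 0 1" by (rule integrable_continuous)
    from integral_linear[OF this blinfun.bounded_linear_left[of v]]
    have "blinfun_apply (integral (cbox 0 1) (?D x)) v =
        integral (cbox 0 1) (\<lambda>t. blinfun_apply (?D x t) v)" by (simp add: o_def)
    also have "\<dots> = integral (cbox 0 1)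
        (\<lambda>t. t ^ Suc m * frechet_derivative F (at (?s x t)) v)"
      by (rule integral_cong) (use x in \<open>simp add: bounded_linear_Blinfun_apply[OF bl] del: power_Suc\<close>)
    finally show "blinfun_apply (integral (cbox 0 1) (?D x)) v =
      integral {0..1} (\<lambda>t. t ^ Suc m * frechet_derivative F (at (?s x t)) v)" by simp
  qed
  ultimately show ?thesis
    by (simp only: at_within_open[OF x S(1)] box_real)
qed

lemma smooth_on_segment_integral:
  fixes F :: "'e::euclidean_space \<Rightarrow> real"
  assumes S: "open S" "convex S" "a \<in> S" and F: "smooth_on S F"
  shows "smooth_on S (\<lambda>x. integral {0..1} (\<lambda>t. t ^ m * F (a + t *\<^sub>R (x - a))))"
proof -
  have "Ck_on k S (\<lambda>x. integral {0..1} (\<lambda>t. t ^ m * F (a + t *\<^sub>R (x - a))))" for k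
    using F
  proof (induction k arbitrary: F m)
    case 0
    then show ?case
      using has_derivative_continuous[OF has_derivative_segment_integral[OF S]]
      by (auto simp: continuous_on_eq_continuous_at[OF S(1)])
  next
    case (Suc k)
    show ?case
      by (rule Ck_on_SucI[OF S(1) has_derivative_segment_integral[OF S Suc.prems]
            Suc.IH[OF smooth_on_frechet_derivative[OF Suc.prems]]])
  qed
  then show ?thesis by (simp add: smooth_on_def)
qed

text \<open>F x - F a is the integral of the derivative along the segment from a to x, and splitting
  x - a into basis vectors leaves smooth coefficients. Their values at a are recorded because a
  derivation at a sees nothing else of them.\<close>

lemma hadamard:
  fixes F :: "'e::euclidean_space \<Rightarrow> real"
  assumes S: "open S" "convex S" "a \<in> S" and F: "smooth_on S F"
  obtains g where "\<And>b. smooth_on S (g b)"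
    and "\<And>x. x \<in> S \<Longrightarrow> F x = F a + (\<Sum>b\<in>Basis. ((x - a) \<bullet> b) * g b x)"
    and "\<And>b. g b a = frechet_derivative F (at a) b"
proof
  let ?g = "\<lambda>b x. integral {0..1} (\<lambda>t. t ^ 0 * frechet_derivative F (at (a + t *\<^sub>R (x - a))) b)"
  show "smooth_on S (?g b)" for b
    by (rule smooth_on_segment_integral[OF S smooth_on_frechet_derivative[OF F]])
  show "?g b a = frechet_derivative F (at a) b" for b
    by simp
  fix x assume x: "x \<in> S"
  let ?s = "\<lambda>t. a + t *\<^sub>R (x - a)"
  have s: "?s t \<in> S" if "t \<in> {0..1}" for t :: real
    using segment_in_convex[OF S(2,3) x] that by auto
  have "((\<lambda>t. F (?s t)) has_vector_derivative frechet_derivative F (at (?s t)) (x - a))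
      (at t within {0..1})" if "t \<in> {0..1}" for t
  proof -
    note F' = smooth_on_has_derivative[OF F s[OF that]]
    have "(?s has_derivative (\<lambda>h. h *\<^sub>R (x - a))) (at t within {0..1})"
      by (auto intro!: derivative_eq_intros)
    from has_derivative_compose[OF this F']
    show ?thesis
      by (simp add: has_vector_derivative_def linear_scale[OF has_derivative_linear[OF F']])
  qed
  then have "((\<lambda>t. frechet_derivative F (at (?s t)) (x - a)) has_integral (F (?s 1) - F (?s 0))) {0..1}"
    by (intro fundamental_theorem_of_calculus) auto
  then have "F x - F a = integral {0..1} (\<lambda>t. frechet_derivative F (at (?s t)) (x - a))"
    by (simp add: integral_unique)
  also have "\<dots> = integral {0..1} (\<lambda>t. \<Sum>b\<in>Basis. ((x - a) \<bullet> b) * frechet_derivative F (at (?s t)) b)"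
    by (rule integral_cong, rule linear_eq_sum_Basis)
      (rule has_derivative_linear[OF smooth_on_has_derivative[OF F s]])
  also have "\<dots> = (\<Sum>b\<in>Basis. integral {0..1} (\<lambda>t. ((x - a) \<bullet> b) * frechet_derivative F (at (?s t)) b))"
  proof (rule integral_sum)
    fix b :: 'e
    have "continuous_on (cbox 0 1) (\<lambda>t. ((x - a) \<bullet> b) * frechet_derivative F (at (?s t)) b)"
      by (intro continuous_intros continuous_on_compose2[OF
            smooth_on_continuous_on[OF smooth_on_frechet_derivative[OF F]]]) (use s in auto)
    then show "(\<lambda>t. ((x - a) \<bullet> b) * frechet_derivative F (at (?s t)) b) integrable_on {0..1}"
      using integrable_continuous by fastforce
  qed simp
  also have "\<dots> = (\<Sum>b\<in>Basis. ((x - a) \<bullet> b) * ?g b x)"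
    by simp
  finally show "F x = F a + (\<Sum>b\<in>Basis. ((x - a) \<bullet> b) * ?g b x)"
    by simp
qed

section \<open>Vector fields and weighted frames\<close>

text \<open>The squared distance keeps the argument of \<open>flat_fun\<close> polynomial, hence
  smooth also at the centre.\<close>

definition bump :: "'e::euclidean_space \<Rightarrow> real \<Rightarrow> 'e \<Rightarrow> real" where
  "bump a r x = flat_fun 0 (r\<^sup>2 - (x - a) \<bullet> (x - a))"

lemma bump_eq_0_iff: "r > 0 \<Longrightarrow> bump a r x = 0 \<longleftrightarrow> x \<notin> ball a r"
proof -
  assume "r > 0"
  have "(norm (x - a))\<^sup>2 < r\<^sup>2 \<longleftrightarrow> norm (x - a) < r"
    using power2_less_imp_less[of "norm (x - a)" r] power_strict_mono[of "norm (x - a)" r 2] \<open>r > 0\<close>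
    by auto
  then show ?thesis
    by (simp add: bump_def flat_fun_def dist_norm norm_minus_commute flip: power2_norm_eq_inner)
qed

lemma smooth_on_inner_left: "smooth_on S (\<lambda>x. x \<bullet> e)"
  by (intro smooth_on_bounded_linear bounded_linear_inner_left)

lemma smooth_on_inner_diff: "open S \<Longrightarrow> smooth_on S (\<lambda>x. (x - a) \<bullet> e)"
  using smooth_on_add[OF _ smooth_on_inner_left smooth_on_const, of S e "- (a \<bullet> e)"]
  by (simp add: inner_diff_left)

lemma smooth_on_bump:
  assumes "open S" shows "smooth_on S (bump a r)"
proof -
  have "smooth_on S (\<lambda>x. r\<^sup>2 + (\<Sum>b\<in>Basis. (-1) * (((x - a) \<bullet> b) * ((x - a) \<bullet> b))))"
    by (intro smooth_on_add smooth_on_const smooth_on_sum smooth_on_mult smooth_on_inner_diff assms)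
  moreover have "r\<^sup>2 + (\<Sum>b\<in>Basis. (-1) * (((x - a) \<bullet> b) * ((x - a) \<bullet> b))) =
      r\<^sup>2 - (x - a) \<bullet> (x - a)" for x
    by (simp add: euclidean_inner[of "x - a" "x - a"] sum_negf)
  ultimately have "smooth_on S (\<lambda>x. r\<^sup>2 - (x - a) \<bullet> (x - a))" by simp
  from smooth_on_compose[OF assms open_UNIV subset_UNIV this smooth_on_flat_fun]
  show ?thesis by (simp add: bump_def[abs_def])
qed

text \<open>The set \<open>W\<close> is a parameter because \<open>g\<close> may be smooth on only a
  part of the chart image, as the coefficients from \<open>hadamard\<close> are.\<close>

definition bump_ext ::
    "'m set \<Rightarrow> ('m \<Rightarrow> 'e::euclidean_space) \<Rightarrow> 'e set \<Rightarrow> 'e \<Rightarrow> real \<Rightarrow> ('e \<Rightarrow> real) \<Rightarrow> 'm \<Rightarrow> real" where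
  "bump_ext U c W a r g = (\<lambda>q. if q \<in> U \<and> c q \<in> W then bump a r (c q) * g (c q) else 0)"

section \<open>Charts and globally defined smooth functions\<close>

locale smooth_manifold =
  fixes A :: "('m::{t2_space,second_countable_topology}, 'e::euclidean_space) atlas"
  assumes smooth_atlas: "smooth_atlas A"
begin

abbreviation "smooth \<equiv> smooth_fun A"
abbreviation "tangent \<equiv> tangent_space A"
abbreviation "vfield \<equiv> vector_field A"
abbreviation "form \<equiv> diff_form A"

lemma chart_cover: obtains U c where "(U, c) \<in> A" "p \<in> U"
proof -
  have "p \<in> (\<Union>(U, c)\<in>A. U)" using smooth_atlas by (simp add: smooth_atlas_def)
  then show thesis using that by auto
qed

lemma chart:
  assumes "(U, c) \<in> A"
  shows "open U" "open (c ` U)" "inj_on c U" "continuous_on U c" "continuous_on (c ` U) (inv_into U c)"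
proof -
  have "open U \<and> open (c ` U) \<and> (\<exists>c'. homeomorphism U (c ` U) c c')"
    using smooth_atlas assms unfolding smooth_atlas_def by blast
  then obtain c' where "open U" "open (c ` U)" and h: "homeomorphism U (c ` U) c c'" by blast
  then show "open U" "open (c ` U)" by auto
  show "inj_on c U" "continuous_on U c"
    using h by (auto simp: homeomorphism_def intro: inj_on_inverseI)
  have "inv_into U c y = c' y" if "y \<in> c ` U" for y
    using h that \<open>inj_on c U\<close> unfolding homeomorphism_def by (metis image_eqI inv_into_f_eq)
  then show "continuous_on (c ` U) (inv_into U c)"
    using h by (simp add: homeomorphism_def cong: continuous_on_cong)
qed

lemma transition_smooth:
  "(U, c) \<in> A \<Longrightarrow> (V, d) \<in> A \<Longrightarrow> smooth_on (c ` (U \<inter> V)) (d \<circ> inv_into U c)"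
  using smooth_atlas unfolding smooth_atlas_def by blast

lemma open_chart_image:
  assumes "(U, c) \<in> A" "open S" "S \<subseteq> U" shows "open (c ` S)"
proof -
  note c = chart[OF assms(1)]
  have "c ` S = c ` U \<inter> inv_into U c -` S"
    using assms(3) c(3) by (auto simp: inv_into_f_f subset_iff)
  then show ?thesis
    using continuous_on_open_vimage[OF c(2)] c(5) assms(2) by (metis Int_commute)
qed

lemma open_chart_preimage:
  assumes "(U, c) \<in> A" "open W" shows "open {q \<in> U. c q \<in> W}"
proof -
  note c = chart[OF assms(1)]
  have "{q \<in> U. c q \<in> W} = c -` W \<inter> U" by auto
  then show ?thesis
    using continuous_on_open_vimage[OF c(1)] c(4) assms(2) by metis
qed

lemma smooth_fun_chart: "smooth f \<Longrightarrow> (U, c) \<in> A \<Longrightarrow> smooth_on (c ` U) (f \<circ> inv_into U c)"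
  unfolding smooth_fun_def by blast

lemma smooth_fun_const [simp]: "smooth (\<lambda>q. k)"
  by (auto simp: smooth_fun_def o_def smooth_on_const)

lemma smooth_fun_add [simp]:
  "smooth f \<Longrightarrow> smooth g \<Longrightarrow> smooth (\<lambda>q. f q + g q)"
  unfolding smooth_fun_def o_def using smooth_on_add[OF chart(2)] by blast

lemma smooth_fun_mult [simp]:
  "smooth f \<Longrightarrow> smooth g \<Longrightarrow> smooth (\<lambda>q. f q * g q)"
  unfolding smooth_fun_def o_def using smooth_on_mult[OF chart(2)] by blast

lemma smooth_fun_minus [simp]: "smooth f \<Longrightarrow> smooth (\<lambda>q. - f q)"
  using smooth_fun_mult[OF smooth_fun_const[of "-1"], of f] by simp

lemma smooth_fun_diff [simp]:
  "smooth f \<Longrightarrow> smooth g \<Longrightarrow> smooth (\<lambda>q. f q - g q)"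
  using smooth_fun_add[OF _ smooth_fun_minus, of f g] by simp

lemma smooth_fun_sum [simp]:
  "(\<And>i. i \<in> I \<Longrightarrow> smooth (f i)) \<Longrightarrow> smooth (\<lambda>q. \<Sum>i\<in>I. f i q)"
proof (induction I rule: infinite_finite_induct)
  case (insert i I)
  then have "smooth (\<lambda>q. f i q + (\<Sum>i\<in>I. f i q))"
    by (intro smooth_fun_add) auto
  then show ?case using insert by simp
qed simp_all

text \<open>The preimage of the closed ball is compact, hence closed in a Hausdorff space. Two open
  sets then cover the manifold: the preimage of \<open>W\<close>, where the function has a smooth
  formula, and the complement of this compact set, where it is zero.\<close>

lemma smooth_fun_bump_ext:
  assumes c: "(U, c) \<in> A" and r: "r > 0" and W: "open W" "cball a r \<subseteq> W" "W \<subseteq> c ` U"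
    and g: "smooth_on W g"
  shows "smooth (bump_ext U c W a r g)"
  unfolding smooth_fun_def
proof safe
  fix V d assume d: "(V, d) \<in> A"
  note cc = chart[OF c] and cd = chart[OF d]
  let ?f = "bump_ext U c W a r g"
  define K where "K = inv_into U c ` cball a r"
  have aU: "cball a r \<subseteq> c ` U" using W by blast
  have KU: "q \<in> K \<longleftrightarrow> q \<in> U \<and> c q \<in> cball a r" for q
  proof
    assume "q \<in> K"
    then obtain y where y: "y \<in> cball a r" "q = inv_into U c y" unfolding K_def by blast
    then have "y \<in> c ` U" using aU by blast
    with y show "q \<in> U \<and> c q \<in> cball a r"
      by (simp only: f_inv_into_f inv_into_into simp_thms)
  next
    assume q: "q \<in> U \<and> c q \<in> cball a r"
    then have "q = inv_into U c (c q)" using cc(3) by simp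
    then show "q \<in> K" using q unfolding K_def by (rule_tac image_eqI) auto
  qed
  have "compact K" unfolding K_def
    by (rule compact_continuous_image[OF continuous_on_subset[OF cc(5) aU] compact_cball])
  then have "closed K" by (rule compact_imp_closed)
  show "smooth_on (d ` V) (?f \<circ> inv_into V d)"
  proof (rule smooth_on_local)
    fix y assume "y \<in> d ` V"
    then obtain q where q: "q \<in> V" "y = d q" by auto
    show "\<exists>T. open T \<and> y \<in> T \<and> smooth_on T (?f \<circ> inv_into V d)"
    proof (cases "q \<in> K")
      case True
      define S where "S = V \<inter> {q \<in> U. c q \<in> W}"
      let ?T = "d ` S"
      have T: "open ?T" unfolding S_def
        using open_chart_preimage[OF c W(1)] cd(1) by (intro open_chart_image[OF d]) auto
      have "smooth_on ?T (c \<circ> inv_into V d)"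
        by (rule smooth_on_subset[OF transition_smooth[OF d c]]) (auto simp: S_def)
      then have "smooth_on ?T (\<lambda>z. bump a r ((c \<circ> inv_into V d) z) * g ((c \<circ> inv_into V d) z))"
        using cd(3) by (intro smooth_on_compose[OF T W(1) _ _ smooth_on_mult[OF W(1) smooth_on_bump[OF W(1)] g]])
          (auto simp: S_def o_def)
      then have "smooth_on ?T (?f \<circ> inv_into V d)"
        by (rule smooth_on_cong[OF _ T]) (use cd(3) in \<open>auto simp: S_def bump_ext_def\<close>)
      moreover have "y \<in> ?T" using True q W(2) KU unfolding S_def by auto
      ultimately show ?thesis using T by blast
    next
      case False
      let ?T = "d ` (V - K)"
      have T: "open ?T" using cd(1) \<open>closed K\<close> by (intro open_chart_image[OF d]) auto
      have "(?f \<circ> inv_into V d) z = 0" if z: "z \<in> ?T" for z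
      proof -
        obtain x where x: "z = d x" "x \<in> V" "x \<notin> K" using z by blast
        then have "x \<in> U \<Longrightarrow> c x \<notin> ball a r" using KU[of x] ball_subset_cball by blast
        then show ?thesis using x cd(3) bump_eq_0_iff[OF r] by (auto simp: bump_ext_def)
      qed
      then have "smooth_on ?T (?f \<circ> inv_into V d)"
        using smooth_on_cong[OF smooth_on_const[of ?T 0] T] by metis
      then show ?thesis using T False q by blast
    qed
  qed
qed

section \<open>Derivations and their expansion in a chart\<close>

lemma tangent_linear:
  "v \<in> tangent p \<Longrightarrow> smooth f \<Longrightarrow> smooth g \<Longrightarrow>
    v (\<lambda>q. a * f q + b * g q) = a * v f + b * v g"
  by (simp add: tangent_space_def)

lemma tangent_mult:
  "v \<in> tangent p \<Longrightarrow> smooth f \<Longrightarrow> smooth g \<Longrightarrow>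
    v (\<lambda>q. f q * g q) = f p * v g + g p * v f"
  by (simp add: tangent_space_def)

lemma tangent_non_smooth: "v \<in> tangent p \<Longrightarrow> \<not> smooth f \<Longrightarrow> v f = 0"
  by (simp add: tangent_space_def)

lemma tangent_add:
  "v \<in> tangent p \<Longrightarrow> smooth f \<Longrightarrow> smooth g \<Longrightarrow>
    v (\<lambda>q. f q + g q) = v f + v g"
  using tangent_linear[of v p f g 1 1] by simp

lemma tangent_diff:
  "v \<in> tangent p \<Longrightarrow> smooth f \<Longrightarrow> smooth g \<Longrightarrow>
    v (\<lambda>q. f q - g q) = v f - v g"
  using tangent_linear[of v p f g 1 "-1"] by simp

lemma tangent_cmult: "v \<in> tangent p \<Longrightarrow> smooth f \<Longrightarrow> v (\<lambda>q. k * f q) = k * v f"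
  using tangent_linear[of v p f f k 0] by simp

lemma tangent_const: "v \<in> tangent p \<Longrightarrow> v (\<lambda>q. k) = 0"
  using tangent_mult[of v p "\<lambda>q. 1" "\<lambda>q. 1"] tangent_cmult[of v p "\<lambda>q. 1" k] by simp

lemma tangent_minus: "v \<in> tangent p \<Longrightarrow> smooth f \<Longrightarrow> v (\<lambda>q. - f q) = - v f"
  using tangent_cmult[of v p f "-1"] by simp

lemma tangent_sum:
  "v \<in> tangent p \<Longrightarrow> (\<And>i. i \<in> I \<Longrightarrow> smooth (f i)) \<Longrightarrow>
    v (\<lambda>q. \<Sum>i\<in>I. f i q) = (\<Sum>i\<in>I. v (f i))"
proof (induction I rule: infinite_finite_induct)
  case (insert i I)
  then have "v (\<lambda>q. f i q + (\<Sum>i\<in>I. f i q)) = v (f i) + v (\<lambda>q. \<Sum>i\<in>I. f i q)"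
    by (intro tangent_add) auto
  then show ?case using insert by simp
qed (simp_all add: tangent_const)

text \<open>Only two kinds of \<open>u\<close> occur: a constant, which gives a cut-off coordinate
  field, and \<open>uminus\<close>, which gives the cut-off negative Euler field that completes the
  frame.\<close>

definition chart_field :: "'m set \<Rightarrow> ('m \<Rightarrow> 'e) \<Rightarrow> 'e \<Rightarrow> real \<Rightarrow> ('e \<Rightarrow> 'e) \<Rightarrow> 'm vfield" where
  "chart_field U c a r u = (\<lambda>q f. if smooth f
     then bump_ext U c (c ` U) a r (\<lambda>y. frechet_derivative (f \<circ> inv_into U c) (at y) (u y)) q else 0)"

lemma vector_field_chart_field:
  assumes c: "(U, c) \<in> A" and r: "r > 0" "cball a r \<subseteq> c ` U" and u: "bounded_linear u \<or> (\<exists>b. u = (\<lambda>_. b))"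
  shows "vfield (chart_field U c a r u)"
  unfolding vector_field_def
proof (intro conjI allI impI)
  note cc = chart[OF c]
  fix f assume f: "smooth f"
  let ?F = "f \<circ> inv_into U c"
  note F = smooth_fun_chart[OF f c]
  have "smooth_on (c ` U) (\<lambda>y. u y \<bullet> b)" for b
    using u by (auto simp: smooth_on_const intro: smooth_on_bounded_linear bounded_linear_inner_left_comp)
  then have "smooth_on (c ` U) (\<lambda>y. \<Sum>b\<in>Basis. (u y \<bullet> b) * frechet_derivative ?F (at y) b)"
    by (intro smooth_on_sum[OF cc(2)] smooth_on_mult[OF cc(2)] smooth_on_frechet_derivative[OF F])
  then have "smooth_on (c ` U) (\<lambda>y. frechet_derivative ?F (at y) (u y))"
    by (rule smooth_on_cong[OF _ cc(2)])
      (rule linear_eq_sum_Basis[symmetric, OF has_derivative_linear[OF smooth_on_has_derivative[OF F]]])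
  then show "smooth (\<lambda>p. chart_field U c a r u p f)"
    using smooth_fun_bump_ext[OF c r(1) cc(2) r(2) order_refl] f by (simp add: chart_field_def)
next
  fix q
  have D: "(f \<circ> inv_into U c has_derivative frechet_derivative (f \<circ> inv_into U c) (at (c q))) (at (c q))"
    if "smooth f" "q \<in> U" for f
    using smooth_on_has_derivative[OF smooth_fun_chart[OF that(1) c]] that(2) by simp
  have iq: "q \<in> U \<Longrightarrow> inv_into U c (c q) = q" using chart(3)[OF c] by simp
  have "chart_field U c a r u q (\<lambda>q. k * f q + l * g q) =
      k * chart_field U c a r u q f + l * chart_field U c a r u q g"
    if fg: "smooth f" "smooth g" for f g k l
  proof (cases "q \<in> U")
    case True
    from has_derivative_add[OF has_derivative_mult_right[OF D[OF fg(1) True], of k]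
        has_derivative_mult_right[OF D[OF fg(2) True], of l]]
    have "frechet_derivative ((\<lambda>q. k * f q + l * g q) \<circ> inv_into U c) (at (c q)) =
      (\<lambda>w. k * frechet_derivative (f \<circ> inv_into U c) (at (c q)) w +
        l * frechet_derivative (g \<circ> inv_into U c) (at (c q)) w)"
      by (intro frechet_derivative_at[symmetric]) (simp add: o_def)
    then show ?thesis using fg True
      by (simp add: chart_field_def bump_ext_def algebra_simps)
  qed (simp add: chart_field_def bump_ext_def)
  moreover have "chart_field U c a r u q (\<lambda>q. f q * g q) =
      f q * chart_field U c a r u q g + g q * chart_field U c a r u q f"
    if fg: "smooth f" "smooth g" for f g
  proof (cases "q \<in> U")
    case True
    from has_derivative_mult[OF D[OF fg(1) True] D[OF fg(2) True]]
    have "frechet_derivative ((\<lambda>q. f q * g q) \<circ> inv_into U c) (at (c q)) =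
      (\<lambda>w. f q * frechet_derivative (g \<circ> inv_into U c) (at (c q)) w +
        frechet_derivative (f \<circ> inv_into U c) (at (c q)) w * g q)"
      by (intro frechet_derivative_at[symmetric]) (simp add: o_def iq[OF True])
    then show ?thesis using fg True
      by (simp add: chart_field_def bump_ext_def algebra_simps)
  qed (simp add: chart_field_def bump_ext_def)
  ultimately show "chart_field U c a r u q \<in> tangent q"
    unfolding tangent_space_def by (auto simp: chart_field_def)
qed

text \<open>A derivation acts on global functions only, so Hadamard's expansion is first multiplied
  by the square of a bump b. Applying \<open>v\<close> produces f(q) v(b^2) on both sides, which
  cancels, together with a common factor b(q), which is nonzero.\<close>

lemma tangent_chart_expansion:
  assumes c: "(U, c) \<in> A" and q: "q \<in> U" and s: "s > 0" and W: "cball (c q) s \<subseteq> ball (c q) s'" "ball (c q) s' \<subseteq> c ` U"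
    and v: "v \<in> tangent q" and f: "smooth f"
  shows "bump (c q) s (c q) * v f =
    (\<Sum>e\<in>Basis. v (bump_ext U c (ball (c q) s') (c q) s (\<lambda>y. (y - c q) \<bullet> e)) *
      frechet_derivative (f \<circ> inv_into U c) (at (c q)) e)"
proof -
  let ?W = "ball (c q) s'" and ?F = "f \<circ> inv_into U c"
  have cqW: "c q \<in> ?W" using s by (intro subsetD[OF W(1)]) simp
  have iq: "x \<in> U \<Longrightarrow> inv_into U c (c x) = x" for x using chart(3)[OF c] by simp
  have F: "smooth_on ?W ?F" by (rule smooth_on_subset[OF smooth_fun_chart[OF f c] W(2)])
  from hadamard[OF open_ball convex_ball cqW F]
  obtain g where g: "\<And>b. smooth_on ?W (g b)"
    "\<And>x. x \<in> ?W \<Longrightarrow> ?F x = ?F (c q) + (\<Sum>b\<in>Basis. ((x - c q) \<bullet> b) * g b x)"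
    "\<And>b. g b (c q) = frechet_derivative ?F (at (c q)) b" by blast
  let ?E = "bump_ext U c ?W (c q) s"
  let ?b = "?E (\<lambda>_. 1)"
  have sm: "smooth (?E h)" if "smooth_on ?W h" for h
    by (rule smooth_fun_bump_ext[OF c s open_ball W that])
  have smb: "smooth ?b" and smz: "smooth (?E (\<lambda>y. (y - c q) \<bullet> e))"
    and smg: "smooth (?E (g e))" for e
    by (intro sm smooth_on_const smooth_on_inner_diff open_ball g(1))+
  define \<beta> where "\<beta> = bump (c q) s (c q)"
  have \<beta>: "\<beta> \<noteq> 0" using s by (simp add: \<beta>_def bump_eq_0_iff)
  \<comment> \<open>One bump goes to the coordinate difference, which vanishes at \<open>q\<close>,
    the other to the Hadamard coefficient; both factors become global smooth functions, so the
    product rule for \<open>v\<close> applies.\<close>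
  have "(\<lambda>x. (?b x * ?b x) * f x) = (\<lambda>x. f q * (?b x * ?b x) +
      (\<Sum>e\<in>Basis. ?E (\<lambda>y. (y - c q) \<bullet> e) x * ?E (g e) x))"
  proof
    fix x show "(?b x * ?b x) * f x = f q * (?b x * ?b x) +
      (\<Sum>e\<in>Basis. ?E (\<lambda>y. (y - c q) \<bullet> e) x * ?E (g e) x)"
    proof (cases "x \<in> U \<and> c x \<in> ?W")
      case True
      then have "f x = f q + (\<Sum>e\<in>Basis. ((c x - c q) \<bullet> e) * g e (c x))"
        using g(2)[of "c x"] iq q by simp
      then show ?thesis using True
        by (simp add: bump_ext_def algebra_simps sum_distrib_left del: mem_ball)
    next
      case False
      then show ?thesis unfolding bump_ext_def by (simp only: if_False simp_thms mult_zero_left mult_zero_right sum.neutral_const add_0)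
    qed
  qed
  then have "v (\<lambda>x. (?b x * ?b x) * f x) = v (\<lambda>x. f q * (?b x * ?b x) +
      (\<Sum>e\<in>Basis. ?E (\<lambda>y. (y - c q) \<bullet> e) x * ?E (g e) x))" by (rule arg_cong)
  also have "\<dots> = f q * v (\<lambda>x. ?b x * ?b x) +
      (\<Sum>e\<in>Basis. v (\<lambda>x. ?E (\<lambda>y. (y - c q) \<bullet> e) x * ?E (g e) x))"
    by (subst tangent_add[OF v], (intro smooth_fun_sum smooth_fun_mult smooth_fun_const smb smz smg)+)
      (subst tangent_sum[OF v], (intro smooth_fun_sum smooth_fun_mult smooth_fun_const smb smz smg)+,
       subst tangent_cmult[OF v], (intro smooth_fun_mult smb)+, rule refl)
  also have "(\<lambda>e. v (\<lambda>x. ?E (\<lambda>y. (y - c q) \<bullet> e) x * ?E (g e) x)) =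
      (\<lambda>e. \<beta> * frechet_derivative ?F (at (c q)) e * v (?E (\<lambda>y. (y - c q) \<bullet> e)))"
  proof
    fix e
    have "?E (\<lambda>y. (y - c q) \<bullet> e) q = 0" "?E (g e) q = \<beta> * frechet_derivative ?F (at (c q)) e"
      using q cqW g(3) by (auto simp: bump_ext_def \<beta>_def)
    then show "v (\<lambda>x. ?E (\<lambda>y. (y - c q) \<bullet> e) x * ?E (g e) x) =
        \<beta> * frechet_derivative ?F (at (c q)) e * v (?E (\<lambda>y. (y - c q) \<bullet> e))"
      by (simp add: tangent_mult[OF v smz smg])
  qed
  also have "v (\<lambda>x. (?b x * ?b x) * f x) = \<beta> * \<beta> * v f + f q * v (\<lambda>x. ?b x * ?b x)"
    using q cqW by (subst tangent_mult[OF v smooth_fun_mult[OF smb smb] f])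
      (simp add: bump_ext_def \<beta>_def del: mem_ball)
  finally have "\<beta> * (\<beta> * v f) =
      \<beta> * (\<Sum>e\<in>Basis. v (?E (\<lambda>y. (y - c q) \<bullet> e)) * frechet_derivative ?F (at (c q)) e)"
    by (simp add: sum_distrib_left mult_ac o_def)
  then show ?thesis using \<beta> by (simp add: \<beta>_def)
qed

text \<open>A family of fields and functions that is a dual basis wherever \<open>\<theta>\<close> does not vanish;
  the weight \<open>\<theta>\<close> makes the local identity a global one.\<close>

definition weighted_frame ::
    "('m \<Rightarrow> real) \<Rightarrow> 'e set \<Rightarrow> ('e \<Rightarrow> 'm \<Rightarrow> real) \<Rightarrow> ('e \<Rightarrow> 'm vfield) \<Rightarrow> bool" where
  "weighted_frame \<theta> I x E \<longleftrightarrow> finite I \<and> smooth \<theta> \<and> (\<forall>i. smooth (x i)) \<and>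
     (\<forall>i. vfield (E i)) \<and>
     (\<forall>q. \<forall>v\<in>tangent q. \<forall>f. \<theta> q * v f = (\<Sum>i\<in>I. v (x i) * E i q f))"

text \<open>In a chart \<open>c\<close> with bump function \<open>b\<close>, the global functions \<open>b\<close> (index 0) and \<open>b y\<^sub>e\<close> serve as
  coordinates. As \<open>v(b y\<^sub>e) = b v(y\<^sub>e) + y\<^sub>e v(b)\<close>, the fields \<open>b \<partial>\<^sub>e\<close> must be completed by \<open>- b \<Sum>\<^sub>e y\<^sub>e \<partial>\<^sub>e\<close>
  for the index 0, and the weight is \<open>b\<^sup>2\<close>.\<close>

theorem ex_weighted_frame: "\<exists>\<theta> I x E. weighted_frame \<theta> I x E \<and> \<theta> p \<noteq> 0"
proof -
  obtain U c where c: "(U, c) \<in> A" and p: "p \<in> U" by (rule chart_cover)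
  note cc = chart[OF c]
  have iq: "x \<in> U \<Longrightarrow> inv_into U c (c x) = x" for x using chart(3)[OF c] by simp
  define a where "a = c p"
  obtain r where r: "r > 0" "cball a r \<subseteq> c ` U"
    using open_contains_cball cc(2) p unfolding a_def by blast
  define X where "X e = bump_ext U c (c ` U) a r (\<lambda>y. if e = 0 then 1 else y \<bullet> e)" for e
  define E where "E e = chart_field U c a r (if e = 0 then uminus else (\<lambda>_. e))" for e :: 'e
  have sm: "smooth (X e)" for e
    unfolding X_def by (rule smooth_fun_bump_ext[OF c r(1) cc(2) r(2) order_refl])
      (cases "e = 0"; simp add: smooth_on_const smooth_on_inner_left)
  have vf: "vfield (E e)" for e
    unfolding E_def by (rule vector_field_chart_field[OF c r]) (auto intro: bounded_linear_minus bounded_linear_ident)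
  have exp: "(X 0 q * X 0 q) * v f = (\<Sum>e\<in>insert 0 Basis. v (X e) * E e q f)"
    if v: "v \<in> tangent q" for q v f
  proof (cases "smooth f \<and> q \<in> U \<and> c q \<in> ball a r")
    case False
    then show ?thesis
      using bump_eq_0_iff[OF r(1), of a "c q"]
      by (auto simp: X_def E_def chart_field_def bump_ext_def tangent_non_smooth[OF v] simp del: mem_ball)
  next
    case True
    then have f: "smooth f" and q: "q \<in> U" and qb: "c q \<in> ball a r" by auto
    \<comment> \<open>The expansion is needed at \<open>q\<close>, which need not be the centre
      \<open>a\<close>, so a second bump of radius \<open>s\<close> around \<open>q\<close> enters.
      Its value \<open>\<gamma>\<close> is cancelled at the end, and \<open>Z e\<close> plays the
      role of \<gamma> v(y_e).\<close>
    obtain s' where s': "s' > 0" "ball (c q) s' \<subseteq> c ` U"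
      using openE[OF cc(2), of "c q"] q by blast
    define s where "s = s' / 2"
    have s: "s > 0" "cball (c q) s \<subseteq> ball (c q) s'" using s' by (auto simp: s_def)
    define Z where "Z e = v (bump_ext U c (ball (c q) s') (c q) s (\<lambda>y. (y - c q) \<bullet> e))" for e
    define \<gamma> where "\<gamma> = bump (c q) s (c q)"
    define \<beta> where "\<beta> = bump a r (c q)"
    define D where "D g = frechet_derivative (g \<circ> inv_into U c) (at (c q))" for g :: "'m \<Rightarrow> real"
    define d where "d = frechet_derivative (bump a r) (at (c q))"
    have \<gamma>: "\<gamma> \<noteq> 0" using s by (simp add: \<gamma>_def bump_eq_0_iff)
    have key: "\<gamma> * v g = (\<Sum>i\<in>Basis. Z i * D g i)" if "smooth g" for g
      unfolding Z_def D_def \<gamma>_def by (rule tangent_chart_expansion[OF c q s s'(2) v that])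
    have hd: "(bump a r has_derivative d) (at (c q))"
      unfolding d_def by (rule smooth_on_has_derivative[OF smooth_on_bump[OF open_UNIV]]) simp
    have DX: "D (X e) = frechet_derivative (\<lambda>y. bump a r y * (if e = 0 then 1 else y \<bullet> e)) (at (c q))" for e
      unfolding D_def by (rule frechet_derivative_cong_open[OF cc(2)])
        (use q iq in \<open>auto simp: X_def bump_ext_def\<close>)
    have DX0: "D (X 0) = d" unfolding DX d_def by simp
    have DXe: "D (X e) i = d i * (c q \<bullet> e) + \<beta> * (i \<bullet> e)" if "e \<noteq> 0" for e i
    proof -
      have "((\<lambda>y. y \<bullet> e) has_derivative (\<lambda>y. y \<bullet> e)) (at (c q))"
        by (auto intro!: derivative_eq_intros)
      from frechet_derivative_at[OF has_derivative_mult[OF hd this]]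
      have "(\<lambda>h. bump a r (c q) * (h \<bullet> e) + d h * (c q \<bullet> e)) = D (X e)"
        using that by (simp add: DX)
      from fun_cong[OF this, of i] show ?thesis by (simp add: \<beta>_def)
    qed
    have vXe: "\<gamma> * v (X e) = (c q \<bullet> e) * (\<gamma> * v (X 0)) + \<beta> * Z e" if e: "e \<in> Basis" for e
    proof -
      have "\<gamma> * v (X e) = (\<Sum>i\<in>Basis. (c q \<bullet> e) * (Z i * d i) + \<beta> * (Z i * (i \<bullet> e)))"
        unfolding key[OF sm] using e by (intro sum.cong) (auto simp: DXe algebra_simps nonzero_Basis)
      also have "\<dots> = (c q \<bullet> e) * (\<Sum>i\<in>Basis. Z i * d i) + \<beta> * (\<Sum>i\<in>Basis. Z i * (i \<bullet> e))"
        by (simp add: sum.distrib sum_distrib_left)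
      also have "(\<Sum>i\<in>Basis. Z i * (i \<bullet> e)) = Z e"
        using e by (simp add: inner_Basis if_distrib cong: if_cong)
      also have "(\<Sum>i\<in>Basis. Z i * d i) = \<gamma> * v (X 0)"
        unfolding key[OF sm] DX0 ..
      finally show ?thesis .
    qed
    have lin: "linear (D f)" unfolding D_def
      using q by (intro has_derivative_linear[OF smooth_on_has_derivative[OF smooth_fun_chart[OF f c]]]) auto
    have E0: "E 0 q f = - \<beta> * (\<Sum>i\<in>Basis. (c q \<bullet> i) * D f i)"
      using f q linear_eq_sum_Basis[OF lin, of "c q"] linear_neg[OF lin, of "c q"]
      by (simp add: E_def chart_field_def bump_ext_def \<beta>_def D_def)
    have Ee: "E e q f = \<beta> * D f e" if "e \<in> Basis" for e
      using f q that by (auto simp: E_def chart_field_def bump_ext_def \<beta>_def D_def)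
    \<comment> \<open>The summand of index 0 cancels every term containing v(X 0); what remains is
      \<beta>^2 times the expansion of \<gamma> v(f).\<close>
    have "\<gamma> * (\<Sum>e\<in>insert 0 Basis. v (X e) * E e q f) =
        \<gamma> * v (X 0) * E 0 q f + (\<Sum>e\<in>Basis. (\<gamma> * v (X e)) * E e q f)"
      by (simp add: sum_distrib_left algebra_simps)
    also have "(\<Sum>e\<in>Basis. (\<gamma> * v (X e)) * E e q f) =
        (\<Sum>e\<in>Basis. \<gamma> * v (X 0) * \<beta> * ((c q \<bullet> e) * D f e) + \<beta> * \<beta> * (Z e * D f e))"
      by (rule sum.cong) (auto simp: vXe Ee algebra_simps)
    also have "\<dots> = \<gamma> * v (X 0) * \<beta> * (\<Sum>e\<in>Basis. (c q \<bullet> e) * D f e) + \<beta> * \<beta> * (\<Sum>e\<in>Basis. Z e * D f e)"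
      by (simp add: sum.distrib sum_distrib_left)
    also have "(\<Sum>e\<in>Basis. Z e * D f e) = \<gamma> * v f" by (rule key[OF f, symmetric])
    finally have "\<gamma> * (\<Sum>e\<in>insert 0 Basis. v (X e) * E e q f) = \<gamma> * ((\<beta> * \<beta>) * v f)"
      by (simp add: E0 algebra_simps)
    moreover have "X 0 q = \<beta>" using q by (simp add: X_def bump_ext_def \<beta>_def)
    ultimately show ?thesis using \<gamma> by simp
  qed
  have "X 0 p \<noteq> 0" using p r bump_eq_0_iff[OF r(1), of a a] by (simp add: X_def bump_ext_def a_def)
  moreover have "weighted_frame (\<lambda>q. X 0 q * X 0 q) (insert 0 Basis) X E"
    using sm vf exp unfolding weighted_frame_def by (intro conjI ballI allI) auto
  ultimately show ?thesis
    by (intro exI conjI) (assumption, simp)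
qed

end

section \<open>Calculus of global vector fields\<close>

definition act :: "'m vfield \<Rightarrow> ('m \<Rightarrow> real) \<Rightarrow> 'm \<Rightarrow> real" where
  "act X f = (\<lambda>p. X p f)"

text \<open>Sums, differences, negatives and multiples by functions are all written with this one
  operation, so that each construction needs a single rewrite rule for linearity.\<close>

definition vcomb :: "('m \<Rightarrow> real) \<Rightarrow> 'm vfield \<Rightarrow> ('m \<Rightarrow> real) \<Rightarrow> 'm vfield \<Rightarrow> 'm vfield" where
  "vcomb g X h Y = (\<lambda>p f. g p * X p f + h p * Y p f)"

context smooth_manifold
begin

lemma tangent_comb [simp]:
  "u \<in> tangent p \<Longrightarrow> w \<in> tangent p \<Longrightarrow>
    (\<lambda>f. a * u f + b * w f) \<in> tangent p"
  unfolding tangent_space_def by (auto simp: algebra_simps)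

lemma tangent_zero [simp]: "(\<lambda>f. 0) \<in> tangent p"
  unfolding tangent_space_def by auto

lemma tangent_lincomb:
  "(\<And>i. i \<in> I \<Longrightarrow> u i \<in> tangent p) \<Longrightarrow>
    (\<lambda>f. \<Sum>i\<in>I. c i * u i f) \<in> tangent p"
proof (induction I rule: infinite_finite_induct)
  case (insert i I)
  then have "(\<lambda>f. c i * u i f + 1 * (\<Sum>i\<in>I. c i * u i f)) \<in> tangent p"
    by (intro tangent_comb) auto
  then show ?case using insert by simp
qed auto

lemma vector_field_tangent [simp]: "vfield X \<Longrightarrow> X p \<in> tangent p"
  by (simp add: vector_field_def)

lemma smooth_fun_act [simp]: "vfield X \<Longrightarrow> smooth f \<Longrightarrow> smooth (act X f)"
  by (simp add: vector_field_def act_def)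

lemma smooth_fun_divide_const [simp]: "smooth f \<Longrightarrow> smooth (\<lambda>q. f q / k)"
  using smooth_fun_mult[OF _ smooth_fun_const[of "1 / k"], of f] by simp

lemma vector_field_zero [simp]: "vfield (\<lambda>p f. 0)"
  by (simp add: vector_field_def)

lemma vector_field_vcomb [simp]:
  assumes "smooth g" "vfield X" "smooth h" "vfield Y"
  shows "vfield (vcomb g X h Y)"
  unfolding vector_field_def
proof (intro conjI allI impI)
  show "vcomb g X h Y p \<in> tangent p" for p
    using assms by (simp add: vcomb_def)
  show "smooth (\<lambda>p. vcomb g X h Y p f)" if "smooth f" for f
    using smooth_fun_act[OF assms(2) that] smooth_fun_act[OF assms(4) that] assms(1,3)
    by (simp add: vcomb_def act_def)
qed

lemma act_const [simp]: "vfield X \<Longrightarrow> act X (\<lambda>q. k) = (\<lambda>p. 0)"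
  by (simp add: act_def tangent_const[OF vector_field_tangent])

lemma act_add [simp]:
  "vfield X \<Longrightarrow> smooth f \<Longrightarrow> smooth g \<Longrightarrow>
    act X (\<lambda>q. f q + g q) = (\<lambda>p. act X f p + act X g p)"
  by (simp add: act_def tangent_add[OF vector_field_tangent])

lemma act_diff [simp]:
  "vfield X \<Longrightarrow> smooth f \<Longrightarrow> smooth g \<Longrightarrow>
    act X (\<lambda>q. f q - g q) = (\<lambda>p. act X f p - act X g p)"
  by (simp add: act_def tangent_diff[OF vector_field_tangent])

lemma act_minus [simp]:
  "vfield X \<Longrightarrow> smooth f \<Longrightarrow> act X (\<lambda>q. - f q) = (\<lambda>p. - act X f p)"
  by (simp add: act_def tangent_minus[OF vector_field_tangent])

lemma act_mult [simp]:
  "vfield X \<Longrightarrow> smooth f \<Longrightarrow> smooth g \<Longrightarrow>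
    act X (\<lambda>q. f q * g q) = (\<lambda>p. f p * act X g p + g p * act X f p)"
  by (simp add: act_def tangent_mult[OF vector_field_tangent])

lemma act_divide_const [simp]:
  "vfield X \<Longrightarrow> smooth f \<Longrightarrow> act X (\<lambda>q. f q / k) = (\<lambda>p. act X f p / k)"
  using act_mult[OF _ _ smooth_fun_const[of "1 / k"], of X f] by simp

lemma act_vcomb [simp]: "act (vcomb g X h Y) f = (\<lambda>p. g p * act X f p + h p * act Y f p)"
  by (simp add: act_def vcomb_def)

lemma act_lie_bracket: "act (lie_bracket X Y) f = (\<lambda>p. act X (act Y f) p - act Y (act X f) p)"
  by (simp add: act_def lie_bracket_def)

lemma vector_fieldI:
  assumes "\<And>f. smooth f \<Longrightarrow> smooth (act X f)"
    and "\<And>f g a b p. smooth f \<Longrightarrow> smooth g \<Longrightarrow>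
      act X (\<lambda>q. a * f q + b * g q) p = a * act X f p + b * act X g p"
    and "\<And>f g p. smooth f \<Longrightarrow> smooth g \<Longrightarrow>
      act X (\<lambda>q. f q * g q) p = f p * act X g p + g p * act X f p"
    and "\<And>f p. \<not> smooth f \<Longrightarrow> act X f p = 0"
  shows "vfield X"
  using assms unfolding vector_field_def tangent_space_def act_def by auto

lemma vector_field_lie_bracket [simp]:
  assumes "vfield X" "vfield Y"
  shows "vfield (lie_bracket X Y)"
proof (rule vector_fieldI, goal_cases)
  case (4 f p)
  then have "X q f = 0" "Y q f = 0" for q
    using assms by (auto intro: tangent_non_smooth[OF vector_field_tangent])
  then show ?case
    using fun_cong[OF act_const[OF assms(1), of 0], of p] fun_cong[OF act_const[OF assms(2), of 0], of p]
    by (simp add: act_def lie_bracket_def)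
qed (use assms in \<open>simp_all add: act_lie_bracket algebra_simps\<close>)

lemma vector_field_eqI:
  assumes "vfield X" "vfield Y"
    and "\<And>f p. smooth f \<Longrightarrow> act X f p = act Y f p"
  shows "X = Y"
proof (intro ext)
  fix p f show "X p f = Y p f"
  proof (cases "smooth f")
    case False
    then show ?thesis
      using assms(1,2) tangent_non_smooth[OF vector_field_tangent] by metis
  qed (use assms(3) in \<open>simp add: act_def\<close>)
qed

lemma lie_bracket_vcomb:
  assumes "smooth g" "vfield X" "smooth h" "vfield X'" "vfield Y"
  shows "lie_bracket (vcomb g X h X') Y =
    vcomb (\<lambda>_. 1) (vcomb g (lie_bracket X Y) h (lie_bracket X' Y))
      (\<lambda>_. -1) (vcomb (act Y g) X (act Y h) X')"
  by (rule vector_field_eqI) (use assms in \<open>simp_all add: act_lie_bracket algebra_simps\<close>)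

text \<open>The negative is written as a \<open>vcomb\<close> with a dummy first field, so that the
  evaluation rules for \<open>vcomb\<close> apply. As an unrestricted rewrite rule it would loop; it
  is always instantiated.\<close>

lemma lie_bracket_swap: "lie_bracket X Y = vcomb (\<lambda>_. 0) X (\<lambda>_. -1) (lie_bracket Y X)"
  by (simp add: lie_bracket_def vcomb_def)

section \<open>Extension of tangent vectors and tensoriality\<close>

lemma weighted_frameD:
  assumes "weighted_frame \<theta> I x E"
  shows "finite I" "smooth \<theta>" "\<And>i. smooth (x i)" "\<And>i. vfield (E i)"
    "\<And>q v f. v \<in> tangent q \<Longrightarrow> \<theta> q * v f = (\<Sum>i\<in>I. v (x i) * E i q f)"
  using assms unfolding weighted_frame_def by blast+

text \<open>The coefficients of the frame expansion are frozen at \<open>p\<close> and divided by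
  \<theta>(p), while the frame fields are left to vary.\<close>

lemma tangent_extends:
  assumes "v \<in> tangent p"
  obtains X where "vfield X" "X p = v"
proof -
  obtain \<theta> I x E where wf: "weighted_frame \<theta> I x E" and p: "\<theta> p \<noteq> 0"
    using ex_weighted_frame by blast
  note fr = weighted_frameD[OF wf]
  have "vfield (\<lambda>q f. \<Sum>i\<in>I. (v (x i) / \<theta> p) * E i q f)"
    unfolding vector_field_def
  proof (intro conjI allI impI)
    show "(\<lambda>f. \<Sum>i\<in>I. v (x i) / \<theta> p * E i q f) \<in> tangent q" for q
      using fr(4) by (intro tangent_lincomb) auto
    show "smooth (\<lambda>q. \<Sum>i\<in>I. v (x i) / \<theta> p * E i q f)" if "smooth f" for f
      using smooth_fun_act[OF fr(4) that] by (intro smooth_fun_sum) (simp add: act_def)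
  qed
  moreover have "(\<Sum>i\<in>I. v (x i) / \<theta> p * E i p f) = v f" for f
    using fr(5)[OF assms, of f] p by (simp add: field_simps flip: sum_divide_distrib)
  ultimately show thesis using that by blast
qed

definition extend_at :: "'m \<Rightarrow> 'm tvec \<Rightarrow> 'm vfield" where
  "extend_at p v = (SOME X. vfield X \<and> X p = v)"

lemma extend_at:
  assumes "v \<in> tangent p"
  shows "vfield (extend_at p v)" "extend_at p v p = v"
proof -
  have "\<exists>X. vfield X \<and> X p = v" using tangent_extends[OF assms] by blast
  from someI_ex[OF this] show "vfield (extend_at p v)" "extend_at p v p = v"
    by (auto simp: extend_at_def)
qed

lemma alt_form_eqI:
  assumes "\<omega> \<in> alt_forms A p k" "\<eta> \<in> alt_forms A p k"
    and "\<And>Xs. length Xs = k \<Longrightarrow> \<forall>X\<in>set Xs. vfield X \<Longrightarrow>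
      \<omega> (map (\<lambda>X. X p) Xs) = \<eta> (map (\<lambda>X. X p) Xs)"
  shows "\<omega> = \<eta>"
proof
  fix vs show "\<omega> vs = \<eta> vs"
  proof (cases "length vs = k \<and> set vs \<subseteq> tangent p")
    case True
    then have "map (\<lambda>X. X p) (map (extend_at p) vs) = vs"
      by (auto simp: o_def subset_iff extend_at(2) intro!: map_idI)
    then show ?thesis
      using assms(3)[of "map (extend_at p) vs"] True by (auto simp: subset_iff extend_at(1))
  next
    case False
    then show ?thesis using assms(1,2) by (auto simp: alt_forms_def)
  qed
qed

lemma diff_form_alt: "form k \<omega> \<Longrightarrow> \<omega> p \<in> alt_forms A p k"
  by (simp add: diff_form_def)

lemma form_eqI:
  assumes "form k \<omega>" "form k \<eta>"
    and "\<And>Xs p. length Xs = k \<Longrightarrow> \<forall>X\<in>set Xs. vfield X \<Longrightarrow>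
      eval_form \<omega> Xs p = eval_form \<eta> Xs p"
  shows "\<omega> = \<eta>"
proof
  fix p show "\<omega> p = \<eta> p"
    using assms by (intro alt_form_eqI[of _ p k]) (auto simp: diff_form_alt eval_form_def)
qed

text \<open>Multiplying by the weight \<open>\<theta>\<close> turns \<open>X\<close> into a global combination of the frame, whose coefficients at
  \<open>p\<close> depend on \<open>X p\<close> only.\<close>

lemma tensorial_local:
  assumes lin: "\<And>g h X Y p. smooth g \<Longrightarrow> smooth h \<Longrightarrow> vfield X \<Longrightarrow>
      vfield Y \<Longrightarrow> F (vcomb g X h Y) p = g p * F X p + h p * (F Y p :: real)"
    and X: "vfield X" "vfield Y" "X p = Y p"
  shows "F X p = F Y p"
proof -
  obtain \<theta> I x E where wf: "weighted_frame \<theta> I x E" and p: "\<theta> p \<noteq> 0"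
    using ex_weighted_frame by blast
  note fr = weighted_frameD[OF wf]
  let ?S = "\<lambda>J g q f. \<Sum>i\<in>J. g i q * E i q f"
  have sum: "vfield (?S J g) \<and> F (?S J g) p = (\<Sum>i\<in>J. g i p * F (E i) p)"
    if "finite J" "\<And>i. smooth (g i)" for J g
    using that(1)
  proof (induction J rule: finite_induct)
    case empty
    then show ?case using lin[of "\<lambda>_. 0" "\<lambda>_. 0" "E i" "E i" p for i] fr(4)
      by (simp add: vcomb_def)
  next
    case (insert i J)
    have eq: "?S (insert i J) g = vcomb (g i) (E i) (\<lambda>_. 1) (?S J g)"
      using insert by (auto simp: vcomb_def fun_eq_iff)
    show ?case
      unfolding eq using insert lin[of "g i" "\<lambda>_. 1" "E i" "?S J g" p] that(2) fr(4) by simp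
  qed
  have "\<theta> p * F Z p = (\<Sum>i\<in>I. Z p (x i) * F (E i) p)" if Z: "vfield Z" for Z
  proof -
    have "vcomb \<theta> Z (\<lambda>_. 0) Z = ?S I (\<lambda>i. act Z (x i))"
      using fr(5)[OF vector_field_tangent[OF Z]] by (simp add: vcomb_def act_def fun_eq_iff)
    then have "F (vcomb \<theta> Z (\<lambda>_. 0) Z) p = (\<Sum>i\<in>I. act Z (x i) p * F (E i) p)"
      using sum[OF fr(1), of "\<lambda>i. act Z (x i)"] fr(3) Z by simp
    then show ?thesis using lin[of \<theta> "\<lambda>_. 0" Z Z p] fr(2) Z by (simp add: act_def)
  qed
  from this[OF X(1)] this[OF X(2)] show ?thesis
    using p by (metis X(3) mult_left_cancel)
qed

text \<open>By \<open>tensorial_local\<close>, exchanging the fields one slot at a time, the value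
  at \<open>p\<close> depends only on the values of the fields at \<open>p\<close>. The form can
  therefore be defined through arbitrarily chosen extensions of the given tangent vectors.\<close>

lemma tensorial_form:
  fixes F :: "'m vfield list \<Rightarrow> 'm \<Rightarrow> real"
  assumes smooth: "\<And>Xs. length Xs = k \<Longrightarrow> \<forall>X\<in>set Xs. vfield X \<Longrightarrow> smooth (F Xs)"
    and lin: "\<And>Xs i g h X Y p. length Xs = k \<Longrightarrow> \<forall>X\<in>set Xs. vfield X \<Longrightarrow> i < k \<Longrightarrow>
      smooth g \<Longrightarrow> smooth h \<Longrightarrow> vfield X \<Longrightarrow> vfield Y \<Longrightarrow>
      F (Xs[i := vcomb g X h Y]) p = g p * F (Xs[i := X]) p + h p * F (Xs[i := Y]) p"
    and alt: "\<And>Xs i j p. length Xs = k \<Longrightarrow> \<forall>X\<in>set Xs. vfield X \<Longrightarrow> i < j \<Longrightarrow> j < k \<Longrightarrow>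
      Xs ! i = Xs ! j \<Longrightarrow> F Xs p = 0"
  obtains \<eta> where "form k \<eta>"
    "\<And>Xs p. length Xs = k \<Longrightarrow> \<forall>X\<in>set Xs. vfield X \<Longrightarrow> eval_form \<eta> Xs p = F Xs p"
proof -
  have upd: "\<forall>X\<in>set (Xs[i := Z]). vfield X"
    if "\<forall>X\<in>set Xs. vfield X" "vfield Z" for Xs i Z
    using that set_update_subset_insert[of Xs i Z] by auto
  have slot: "F (Xs[i := X]) p = F (Xs[i := Y]) p"
    if "length Xs = k" "\<forall>X\<in>set Xs. vfield X" "i < k" "vfield X" "vfield Y"
      "X p = Y p" for Xs i X Y p
    by (rule tensorial_local[of "\<lambda>Z. F (Xs[i := Z])"]) (use lin that in auto)
  have local: "F Xs p = F Ys p"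
    if Xs: "length Xs = k" "\<forall>X\<in>set Xs. vfield X"
      and Ys: "length Ys = k" "\<forall>X\<in>set Ys. vfield X"
      and eq: "\<And>i. i < k \<Longrightarrow> (Xs ! i) p = (Ys ! i) p" for Xs Ys p
  proof -
    have "F (take n Ys @ drop n Xs) p = F Xs p" if "n \<le> k" for n
      using that
    proof (induction n)
      case (Suc n)
      let ?L = "take n Ys @ drop n Xs"
      have L: "length ?L = k" "\<forall>X\<in>set ?L. vfield X"
        using Xs Ys Suc.prems set_take_subset[of n Ys] set_drop_subset[of n Xs] by auto
      have 1: "?L = ?L[n := Xs ! n]"
        using Suc.prems Xs(1) Ys(1) by (simp add: list_update_append Cons_nth_drop_Suc[symmetric])
      have 2: "take (Suc n) Ys @ drop (Suc n) Xs = ?L[n := Ys ! n]"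
        using Suc.prems Xs(1) Ys(1)
        by (simp add: list_update_append Cons_nth_drop_Suc[symmetric] take_Suc_conv_app_nth)
      have "F (?L[n := Ys ! n]) p = F (?L[n := Xs ! n]) p"
        using Suc.prems Xs Ys by (intro slot[OF L]) (auto simp: eq)
      then show ?case using 1 2 Suc by simp
    qed simp
    from this[of k] show ?thesis using Xs(1) Ys(1) by simp
  qed
  define \<eta> where "\<eta> p vs = (if length vs = k \<and> set vs \<subseteq> tangent p
      then F (map (extend_at p) vs) p else 0)" for p vs
  have ext: "length (map (extend_at p) vs) = k" "\<forall>X\<in>set (map (extend_at p) vs). vfield X"
    if "length vs = k" "set vs \<subseteq> tangent p" for p vs
    using that by (auto simp: extend_at(1) subset_iff)
  have eval: "eval_form \<eta> Xs p = F Xs p" if Xs: "length Xs = k" "\<forall>X\<in>set Xs. vfield X" for Xs p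
  proof -
    have vs: "length (map (\<lambda>X. X p) Xs) = k" "set (map (\<lambda>X. X p) Xs) \<subseteq> tangent p"
      using Xs by auto
    have "F (map (extend_at p) (map (\<lambda>X. X p) Xs)) p = F Xs p"
      by (rule local[OF ext[OF vs] Xs]) (use Xs in \<open>auto simp: extend_at(2)\<close>)
    then show ?thesis using vs by (simp add: eval_form_def \<eta>_def)
  qed
  have "form k \<eta>"
    unfolding diff_form_def
  proof (intro conjI allI impI)
    fix Xs assume "length Xs = k" "\<forall>X\<in>set Xs. vfield X"
    then have "smooth (F Xs)" "eval_form \<eta> Xs = F Xs"
      using smooth eval by auto
    then show "smooth (eval_form \<eta> Xs)" by simp
  next
    fix p
    have lin': "\<eta> p (vs[i := (\<lambda>f. a * u f + b * w f)]) = a * \<eta> p (vs[i := u]) + b * \<eta> p (vs[i := w])"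
      if vs: "length vs = k" "set vs \<subseteq> tangent p" and i: "i < k"
        and u: "u \<in> tangent p" and w: "w \<in> tangent p" for vs i u w a b
    proof -
      let ?M = "map (extend_at p) vs" and ?z = "\<lambda>f. a * u f + b * w f"
      let ?Z = "vcomb (\<lambda>_. a) (extend_at p u) (\<lambda>_. b) (extend_at p w)"
      have sub: "set (vs[i := x]) \<subseteq> tangent p" if "x \<in> tangent p" for x
        using that vs(2) set_update_subset_insert[of vs i x] by auto
      have e: "\<eta> p (vs[i := x]) = F (?M[i := extend_at p x]) p" if "x \<in> tangent p" for x
        using vs sub[OF that] by (simp add: \<eta>_def map_update)
      have "\<eta> p (vs[i := ?z]) = F (?M[i := extend_at p ?z]) p"
        using e u w by simp
      \<comment> \<open>The chosen extension of a combination need not be the combination of the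
        chosen extensions; they only agree at \<open>p\<close>, which is enough by
        \<open>slot\<close>.\<close>
      also have "\<dots> = F (?M[i := ?Z]) p"
        using u w by (intro slot[OF ext[OF vs] i] vector_field_vcomb)
          (simp_all add: extend_at vcomb_def)
      also have "\<dots> = a * F (?M[i := extend_at p u]) p + b * F (?M[i := extend_at p w]) p"
        using u w by (intro lin[OF ext[OF vs] i]) (auto simp: extend_at)
      finally show ?thesis using e u w by simp
    qed
    have "\<eta> p vs = 0" if "length vs = k" "set vs \<subseteq> tangent p" "i < j" "j < k" "vs ! i = vs ! j"
      for vs i j
      using alt[OF ext[OF that(1,2)] that(3,4)] that by (simp add: \<eta>_def)
    with lin' show "\<eta> p \<in> alt_forms A p k"
      unfolding alt_forms_def by (auto simp: \<eta>_def)
  qed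
  with eval show thesis using that by blast
qed

end

section \<open>Differential forms and the exterior derivative\<close>

abbreviation ev :: "'m dform \<Rightarrow> 'm vfield list \<Rightarrow> 'm \<Rightarrow> real" where "ev \<equiv> eval_form"

text \<open>The invariant formula of \<open>ext_d\<close> written out, here and below for degrees 1
  to 3. Being expressions in fields rather than forms, these can be expanded and compared by
  simplification alone.\<close>

definition d1 :: "'m dform \<Rightarrow> 'm vfield \<Rightarrow> 'm vfield \<Rightarrow> 'm \<Rightarrow> real" where
  "d1 \<alpha> X Y = (\<lambda>p. act X (ev \<alpha> [Y]) p - act Y (ev \<alpha> [X]) p -
     ev \<alpha> [lie_bracket X Y] p)"

definition d2 :: "'m dform \<Rightarrow> 'm vfield \<Rightarrow> 'm vfield \<Rightarrow> 'm vfield \<Rightarrow> 'm \<Rightarrow> real" where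
  "d2 \<Omega> X Y Z = (\<lambda>p. act X (ev \<Omega> [Y, Z]) p - act Y (ev \<Omega> [X, Z]) p +
     act Z (ev \<Omega> [X, Y]) p - ev \<Omega> [lie_bracket X Y, Z] p +
     ev \<Omega> [lie_bracket X Z, Y] p - ev \<Omega> [lie_bracket Y Z, X] p)"

definition d3 :: "'m dform \<Rightarrow> 'm vfield \<Rightarrow> 'm vfield \<Rightarrow> 'm vfield \<Rightarrow> 'm vfield \<Rightarrow> 'm \<Rightarrow> real" where
  "d3 \<phi> X Y Z W = (\<lambda>p. act X (ev \<phi> [Y, Z, W]) p - act Y (ev \<phi> [X, Z, W]) p +
     act Z (ev \<phi> [X, Y, W]) p - act W (ev \<phi> [X, Y, Z]) p -
     ev \<phi> [lie_bracket X Y, Z, W] p + ev \<phi> [lie_bracket X Z, Y, W] p -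
     ev \<phi> [lie_bracket Y Z, X, W] p - ev \<phi> [lie_bracket X W, Y, Z] p +
     ev \<phi> [lie_bracket Y W, X, Z] p - ev \<phi> [lie_bracket Z W, X, Y] p)"

lemma alt_form_linear:
  assumes "\<omega> \<in> alt_forms A p k" "length vs = k" "set vs \<subseteq> tangent_space A p" "i < k"
    "u \<in> tangent_space A p" "w \<in> tangent_space A p"
  shows "\<omega> (vs[i := (\<lambda>f. a * u f + b * w f)]) = a * \<omega> (vs[i := u]) + b * \<omega> (vs[i := w])"
  using assms unfolding alt_forms_def mem_Collect_eq by blast

lemma alt_form_eq_0:
  assumes "\<omega> \<in> alt_forms A p k" "length vs = k" "set vs \<subseteq> tangent_space A p" "i < j" "j < k"
    "vs ! i = vs ! j"
  shows "\<omega> vs = 0"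
  using assms unfolding alt_forms_def mem_Collect_eq by blast

lemma alt_form_outside:
  assumes "\<omega> \<in> alt_forms A p k" "\<not> (length vs = k \<and> set vs \<subseteq> tangent_space A p)"
  shows "\<omega> vs = 0"
  using assms unfolding alt_forms_def mem_Collect_eq by blast

context smooth_manifold
begin

text \<open>Polarization: alternation is encoded as vanishing on repeated arguments, and this is
  applied with u + w in both slots.\<close>

lemma alt_form_swap:
  assumes \<omega>: "\<omega> \<in> alt_forms A p k" and vs: "length vs = k" "set vs \<subseteq> tangent p"
    and ij: "i < j" "j < k" and u: "u \<in> tangent p" and w: "w \<in> tangent p"
  shows "\<omega> (vs[i := w, j := u]) = - \<omega> (vs[i := u, j := w])"
proof -
  define s where "s = (\<lambda>f. 1 * u f + 1 * w f)"
  have s: "s \<in> tangent p" unfolding s_def by (rule tangent_comb[OF u w])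
  have sub: "set (vs[i := x, j := y]) \<subseteq> tangent p"
    if "x \<in> tangent p" "y \<in> tangent p" for x y
    using that vs(2) by (meson insert_subset order_trans set_update_subset_insert subsetI insertE subsetD)
  have sub1: "set (vs[i := x]) \<subseteq> tangent p" if "x \<in> tangent p" for x
    using that vs(2) set_update_subset_insert[of vs i x] by auto
  have diag: "\<omega> (vs[i := x, j := x]) = 0" if "x \<in> tangent p" for x
    using sub[OF that that] vs ij by (intro alt_form_eq_0[OF \<omega>, of _ i j]) auto
  have 1: "\<omega> (vs[i := x, j := s]) = \<omega> (vs[i := x, j := u]) + \<omega> (vs[i := x, j := w])"
    if "x \<in> tangent p" for x
    unfolding s_def
    using alt_form_linear[OF \<omega>, of "vs[i := x]" j u w 1 1] sub1[OF that] vs ij u w by simp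
  have 2: "\<omega> (vs[i := s, j := x]) = \<omega> (vs[i := u, j := x]) + \<omega> (vs[i := w, j := x])"
    if "x \<in> tangent p" for x
  proof -
    have "set (vs[j := x]) \<subseteq> tangent p"
      using that vs(2) set_update_subset_insert[of vs j x] by auto
    from alt_form_linear[OF \<omega> _ this, of i u w 1 1] show ?thesis
      unfolding s_def using vs ij u w by (simp add: list_update_swap[of i j])
  qed
  have "0 = \<omega> (vs[i := s, j := s])" using diag[OF s] by simp
  also have "\<dots> = \<omega> (vs[i := u, j := w]) + \<omega> (vs[i := w, j := u])"
    using 1[OF u] 1[OF w] 2[OF s] diag u w by simp
  finally show ?thesis by simp
qed

lemma eval_form_vcomb:
  assumes "form k \<omega>" "length Xs = k" "\<forall>X\<in>set Xs. vfield X" "i < k"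
    "vfield X" "vfield Y"
  shows "ev \<omega> (Xs[i := vcomb g X h Y]) =
    (\<lambda>p. g p * ev \<omega> (Xs[i := X]) p + h p * ev \<omega> (Xs[i := Y]) p)"
proof
  fix p
  have "set (map (\<lambda>X. X p) Xs) \<subseteq> tangent p" using assms(3) by auto
  from alt_form_linear[OF diff_form_alt[OF assms(1)] _ this, of i "X p" "Y p" "g p" "h p"]
  show "ev \<omega> (Xs[i := vcomb g X h Y]) p =
      g p * ev \<omega> (Xs[i := X]) p + h p * ev \<omega> (Xs[i := Y]) p"
    using assms by (simp add: eval_form_def map_update vcomb_def)
qed

lemma eval_form_swap:
  assumes "form k \<omega>" "length Xs = k" "\<forall>X\<in>set Xs. vfield X" "i < j" "j < k"
    "vfield X" "vfield Y"
  shows "ev \<omega> (Xs[i := Y, j := X]) = (\<lambda>p. - ev \<omega> (Xs[i := X, j := Y]) p)"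
proof
  fix p
  have "set (map (\<lambda>X. X p) Xs) \<subseteq> tangent p" using assms(3) by auto
  from alt_form_swap[OF diff_form_alt[OF assms(1)] _ this assms(4,5), of "X p" "Y p"]
  show "ev \<omega> (Xs[i := Y, j := X]) p = - ev \<omega> (Xs[i := X, j := Y]) p"
    using assms by (simp add: eval_form_def map_update)
qed

lemma form1_vcomb [simp]:
  assumes "form 1 \<alpha>" "vfield X" "vfield Y"
  shows "ev \<alpha> [vcomb g X h Y] = (\<lambda>p. g p * ev \<alpha> [X] p + h p * ev \<alpha> [Y] p)"
  using eval_form_vcomb[OF assms(1), of "[X]" 0 X Y] assms by simp

lemma form2_vcomb [simp]:
  assumes "form 2 \<Omega>" "vfield X" "vfield Y" "vfield Z"
  shows "ev \<Omega> [vcomb g X h Y, Z] =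
      (\<lambda>p. g p * ev \<Omega> [X, Z] p + h p * ev \<Omega> [Y, Z] p)"
    and "ev \<Omega> [Z, vcomb g X h Y] =
      (\<lambda>p. g p * ev \<Omega> [Z, X] p + h p * ev \<Omega> [Z, Y] p)"
  using eval_form_vcomb[OF assms(1), of "[X, Z]" 0 X Y] eval_form_vcomb[OF assms(1), of "[Z, X]" 1 X Y]
    assms by simp_all

lemma form3_vcomb [simp]:
  assumes "form 3 \<phi>" "vfield X" "vfield Y" "vfield Z" "vfield W"
  shows "ev \<phi> [vcomb g X h Y, Z, W] =
      (\<lambda>p. g p * ev \<phi> [X, Z, W] p + h p * ev \<phi> [Y, Z, W] p)"
    and "ev \<phi> [Z, vcomb g X h Y, W] =
      (\<lambda>p. g p * ev \<phi> [Z, X, W] p + h p * ev \<phi> [Z, Y, W] p)"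
    and "ev \<phi> [Z, W, vcomb g X h Y] =
      (\<lambda>p. g p * ev \<phi> [Z, W, X] p + h p * ev \<phi> [Z, W, Y] p)"
  using eval_form_vcomb[OF assms(1), of "[X, Z, W]" 0 X Y] eval_form_vcomb[OF assms(1), of "[Z, X, W]" 1 X Y]
    eval_form_vcomb[OF assms(1), of "[Z, W, X]" 2 X Y] assms by simp_all

lemma form2_swap:
  assumes "form 2 \<Omega>" "vfield X" "vfield Y"
  shows "ev \<Omega> [Y, X] = (\<lambda>p. - ev \<Omega> [X, Y] p)"
  using eval_form_swap[OF assms(1), of "[X, X]" 0 1 X Y] assms by simp

lemma form3_swap:
  assumes "form 3 \<phi>" "vfield X" "vfield Y" "vfield Z"
  shows "ev \<phi> [Y, X, Z] = (\<lambda>p. - ev \<phi> [X, Y, Z] p)"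
    and "ev \<phi> [X, Z, Y] = (\<lambda>p. - ev \<phi> [X, Y, Z] p)"
  using eval_form_swap[OF assms(1), of "[X, X, Z]" 0 1 X Y]
    eval_form_swap[OF assms(1), of "[X, X, X]" 1 2 Y Z] assms by simp_all

lemma smooth_fun_eval1 [simp]:
  "form 1 \<alpha> \<Longrightarrow> vfield X \<Longrightarrow> smooth (ev \<alpha> [X])"
  by (auto simp: diff_form_def)

lemma smooth_fun_eval2 [simp]:
  "form 2 \<Omega> \<Longrightarrow> vfield X \<Longrightarrow> vfield Y \<Longrightarrow> smooth (ev \<Omega> [X, Y])"
  by (auto simp: diff_form_def)

lemma smooth_fun_eval3 [simp]:
  "form 3 \<phi> \<Longrightarrow> vfield X \<Longrightarrow> vfield Y \<Longrightarrow> vfield Z \<Longrightarrow>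
    smooth (ev \<phi> [X, Y, Z])"
  by (auto simp: diff_form_def)

lemma less_numeral_cases:
  "(i::nat) < 2 \<longleftrightarrow> i = 0 \<or> i = 1" "(i::nat) < 3 \<longleftrightarrow> i = 0 \<or> i = 1 \<or> i = 2"
  "(i::nat) < 4 \<longleftrightarrow> i = 0 \<or> i = 1 \<or> i = 2 \<or> i = 3"
  by auto

lemma length_numeral_cases:
  "length xs = 1 \<longleftrightarrow> (\<exists>a. xs = [a])"
  "length xs = 2 \<longleftrightarrow> (\<exists>a b. xs = [a, b])" "length xs = 3 \<longleftrightarrow> (\<exists>a b c. xs = [a, b, c])"
  "length xs = 4 \<longleftrightarrow> (\<exists>a b c d. xs = [a, b, c, d])"
  by (auto simp: length_Suc_conv eval_nat_numeral)

lemma tensorial_form1: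
  assumes "\<And>X. vfield X \<Longrightarrow> smooth (G X)"
    and "\<And>g h X Y p. smooth g \<Longrightarrow> smooth h \<Longrightarrow> vfield X \<Longrightarrow>
      vfield Y \<Longrightarrow> G (vcomb g X h Y) p = g p * G X p + h p * G Y p"
  shows "\<exists>\<eta>. form 1 \<eta> \<and> (\<forall>X. vfield X \<longrightarrow> ev \<eta> [X] = G X)"
proof -
  obtain \<eta> where "form 1 \<eta>"
    and e: "\<And>Xs p. length Xs = 1 \<Longrightarrow> \<forall>X\<in>set Xs. vfield X \<Longrightarrow> ev \<eta> Xs p = G (Xs ! 0) p"
    by (rule tensorial_form[of 1 "\<lambda>Xs. G (Xs ! 0)"])
      (use assms in \<open>auto simp: length_numeral_cases\<close>)
  moreover have "ev \<eta> [X] = G X" if "vfield X" for X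
    using e[of "[X]"] that by auto
  ultimately show ?thesis by blast
qed

text \<open>Skew symmetry carries linearity over from the first slot, and G X X = - G X X gives
  vanishing on equal arguments. In degrees 3 and 4 the transpositions of adjacent slots suffice in
  the same way.\<close>

lemma tensorial_form2:
  assumes sm: "\<And>X Y. vfield X \<Longrightarrow> vfield Y \<Longrightarrow> smooth (G X Y)"
    and lin: "\<And>g h X Y Z p. smooth g \<Longrightarrow> smooth h \<Longrightarrow> vfield X \<Longrightarrow>
      vfield Y \<Longrightarrow> vfield Z \<Longrightarrow>
      G (vcomb g X h Y) Z p = g p * G X Z p + h p * G Y Z p"
    and swap: "\<And>X Y p. vfield X \<Longrightarrow> vfield Y \<Longrightarrow> G Y X p = - G X Y p"
  shows "\<exists>\<eta>. form 2 \<eta> \<and>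
    (\<forall>X Y. vfield X \<longrightarrow> vfield Y \<longrightarrow> ev \<eta> [X, Y] = G X Y)"
proof -
  have lin2: "G Z (vcomb g X h Y) p = g p * G Z X p + h p * G Z Y p"
    if "smooth g" "smooth h" "vfield X" "vfield Y" "vfield Z"
    for g h X Y Z p
    using lin[OF that, of p] swap[of Z "vcomb g X h Y" p] swap[of Z X p] swap[of Z Y p] that
    by (simp add: algebra_simps)
  have self: "G X X p = 0" if "vfield X" for X p
    using swap[OF that that, of p] by linarith
  obtain \<eta> where "form 2 \<eta>"
    and e: "\<And>Xs p. length Xs = 2 \<Longrightarrow> \<forall>X\<in>set Xs. vfield X \<Longrightarrow>
      ev \<eta> Xs p = G (Xs ! 0) (Xs ! 1) p"
    by (rule tensorial_form[of 2 "\<lambda>Xs. G (Xs ! 0) (Xs ! 1)"])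
      (use sm lin lin2 self in \<open>auto simp: length_numeral_cases less_numeral_cases\<close>)
  moreover have "ev \<eta> [X, Y] = G X Y" if "vfield X" "vfield Y" for X Y
    using e[of "[X, Y]"] that by auto
  ultimately show ?thesis by blast
qed

lemma tensorial_form3:
  assumes sm: "\<And>X Y Z. vfield X \<Longrightarrow> vfield Y \<Longrightarrow> vfield Z \<Longrightarrow>
      smooth (G X Y Z)"
    and lin: "\<And>g h X Y Z W p. smooth g \<Longrightarrow> smooth h \<Longrightarrow> vfield X \<Longrightarrow>
      vfield Y \<Longrightarrow> vfield Z \<Longrightarrow> vfield W \<Longrightarrow>
      G (vcomb g X h Y) Z W p = g p * G X Z W p + h p * G Y Z W p"
    and s1: "\<And>X Y Z p. vfield X \<Longrightarrow> vfield Y \<Longrightarrow> vfield Z \<Longrightarrow>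
      G Y X Z p = - G X Y Z p"
    and s2: "\<And>X Y Z p. vfield X \<Longrightarrow> vfield Y \<Longrightarrow> vfield Z \<Longrightarrow>
      G X Z Y p = - G X Y Z p"
  shows "\<exists>\<eta>. form 3 \<eta> \<and> (\<forall>X Y Z. vfield X \<longrightarrow> vfield Y \<longrightarrow>
    vfield Z \<longrightarrow> ev \<eta> [X, Y, Z] = G X Y Z)"
proof -
  have lin2: "G Z (vcomb g X h Y) W p = g p * G Z X W p + h p * G Z Y W p"
    if "smooth g" "smooth h" "vfield X" "vfield Y" "vfield Z"
      "vfield W" for g h X Y Z W p
    using lin[OF that, of p] s1[of Z "vcomb g X h Y" W p] s1[of Z X W p] s1[of Z Y W p] that
    by (simp add: algebra_simps)
  have lin3: "G Z W (vcomb g X h Y) p = g p * G Z W X p + h p * G Z W Y p"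
    if "smooth g" "smooth h" "vfield X" "vfield Y" "vfield Z"
      "vfield W" for g h X Y Z W p
    using lin2[OF that, of p] s2[of Z "vcomb g X h Y" W p] s2[of Z X W p] s2[of Z Y W p] that
    by (simp add: algebra_simps)
  have self: "G X X Y p = 0" "G Y X X p = 0" "G X Y X p = 0"
    if "vfield X" "vfield Y" for X Y p
    using s1[OF that(1,1,2), of p] s2[OF that(2,1,1), of p] s1[OF that(1,2,1), of p] by linarith+
  obtain \<eta> where "form 3 \<eta>"
    and e: "\<And>Xs p. length Xs = 3 \<Longrightarrow> \<forall>X\<in>set Xs. vfield X \<Longrightarrow>
      ev \<eta> Xs p = G (Xs ! 0) (Xs ! 1) (Xs ! 2) p"
    by (rule tensorial_form[of 3 "\<lambda>Xs. G (Xs ! 0) (Xs ! 1) (Xs ! 2)"])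
      (use sm lin lin2 lin3 self in \<open>auto simp: length_numeral_cases less_numeral_cases\<close>)
  moreover have "ev \<eta> [X, Y, Z] = G X Y Z"
    if "vfield X" "vfield Y" "vfield Z" for X Y Z
    using e[of "[X, Y, Z]"] that by auto
  ultimately show ?thesis by blast
qed

lemma tensorial_form4:
  assumes sm: "\<And>X Y Z W. vfield X \<Longrightarrow> vfield Y \<Longrightarrow> vfield Z \<Longrightarrow>
      vfield W \<Longrightarrow> smooth (G X Y Z W)"
    and lin: "\<And>g h X Y Z W V p. smooth g \<Longrightarrow> smooth h \<Longrightarrow> vfield X \<Longrightarrow>
      vfield Y \<Longrightarrow> vfield Z \<Longrightarrow> vfield W \<Longrightarrow> vfield V \<Longrightarrow>
      G (vcomb g X h Y) Z W V p = g p * G X Z W V p + h p * G Y Z W V p"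
    and s1: "\<And>X Y Z W p. vfield X \<Longrightarrow> vfield Y \<Longrightarrow> vfield Z \<Longrightarrow>
      vfield W \<Longrightarrow> G Y X Z W p = - G X Y Z W p"
    and s2: "\<And>X Y Z W p. vfield X \<Longrightarrow> vfield Y \<Longrightarrow> vfield Z \<Longrightarrow>
      vfield W \<Longrightarrow> G X Z Y W p = - G X Y Z W p"
    and s3: "\<And>X Y Z W p. vfield X \<Longrightarrow> vfield Y \<Longrightarrow> vfield Z \<Longrightarrow>
      vfield W \<Longrightarrow> G X Y W Z p = - G X Y Z W p"
  shows "\<exists>\<eta>. form 4 \<eta> \<and> (\<forall>X Y Z W. vfield X \<longrightarrow> vfield Y \<longrightarrow>
    vfield Z \<longrightarrow> vfield W \<longrightarrow> ev \<eta> [X, Y, Z, W] = G X Y Z W)"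
proof -
  have lin2: "G Z (vcomb g X h Y) W V p = g p * G Z X W V p + h p * G Z Y W V p"
    if "smooth g" "smooth h" "vfield X" "vfield Y" "vfield Z"
      "vfield W" "vfield V" for g h X Y Z W V p
    using lin[OF that, of p] s1[of Z "vcomb g X h Y" W V p] s1[of Z X W V p] s1[of Z Y W V p] that
    by (simp add: algebra_simps)
  have lin3: "G Z W (vcomb g X h Y) V p = g p * G Z W X V p + h p * G Z W Y V p"
    if "smooth g" "smooth h" "vfield X" "vfield Y" "vfield Z"
      "vfield W" "vfield V" for g h X Y Z W V p
    using lin2[OF that, of p] s2[of Z "vcomb g X h Y" W V p] s2[of Z X W V p] s2[of Z Y W V p] that
    by (simp add: algebra_simps)
  have lin4: "G Z W V (vcomb g X h Y) p = g p * G Z W V X p + h p * G Z W V Y p"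
    if "smooth g" "smooth h" "vfield X" "vfield Y" "vfield Z"
      "vfield W" "vfield V" for g h X Y Z W V p
    using lin3[OF that, of p] s3[of Z W "vcomb g X h Y" V p] s3[of Z W X V p] s3[of Z W Y V p] that
    by (simp add: algebra_simps)
  have self1: "G X X Y Z p = 0" "G Y X X Z p = 0" "G Y Z X X p = 0"
    if "vfield X" "vfield Y" "vfield Z" for X Y Z p
    using s1[OF that(1,1,2,3), of p] s2[OF that(2,1,1,3), of p] s3[OF that(2,3,1,1), of p] by linarith+
  then have self2: "G X Y X Z p = 0" "G Y X Z X p = 0"
    if "vfield X" "vfield Y" "vfield Z" for X Y Z p
    using s1[of X Y X Z p] s3[of Y X X Z p] that by auto
  then have self3: "G X Y Z X p = 0"
    if "vfield X" "vfield Y" "vfield Z" for X Y Z p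
    using s1[of X Y Z X p] that by auto
  obtain \<eta> where "form 4 \<eta>"
    and e: "\<And>Xs p. length Xs = 4 \<Longrightarrow> \<forall>X\<in>set Xs. vfield X \<Longrightarrow>
      ev \<eta> Xs p = G (Xs ! 0) (Xs ! 1) (Xs ! 2) (Xs ! 3) p"
    by (rule tensorial_form[of 4 "\<lambda>Xs. G (Xs ! 0) (Xs ! 1) (Xs ! 2) (Xs ! 3)"])
      (use sm lin lin2 lin3 lin4 self1 self2 self3 in
        \<open>auto simp: length_numeral_cases less_numeral_cases\<close>)
  moreover have "ev \<eta> [X, Y, Z, W] = G X Y Z W"
    if "vfield X" "vfield Y" "vfield Z" "vfield W" for X Y Z W
    using e[of "[X, Y, Z, W]"] that by auto
  ultimately show ?thesis by blast
qed

lemma ext_d_eqI: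
  assumes "form (Suc k) \<eta>"
    and "\<And>Xs p. length Xs = Suc k \<Longrightarrow> \<forall>X\<in>set Xs. vfield X \<Longrightarrow> ev \<eta> Xs p =
           (\<Sum>i\<le>k. (-1) ^ i * (Xs ! i) p (ev \<omega> (delete_nth i Xs))) +
           (\<Sum>j\<le>k. \<Sum>i<j. (-1) ^ (i + j) *
              ev \<omega> (lie_bracket (Xs ! i) (Xs ! j) # delete_nth i (delete_nth j Xs)) p)"
  shows "ext_d A k \<omega> = \<eta>"
  unfolding ext_d_def
proof (rule the_equality, goal_cases)
  case 1
  then show ?case using assms by simp
next
  case (2 \<zeta>)
  then show ?case using assms by (intro form_eqI[of "Suc k"]) auto
qed

lemma ext_d0:
  assumes f: "smooth f"
  shows "form 1 (ext_d A 0 (form0 f))"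
    and "vfield X \<Longrightarrow> ev (ext_d A 0 (form0 f)) [X] = act X f"
proof -
  obtain \<eta> where \<eta>: "form 1 \<eta>" "\<And>X. vfield X \<Longrightarrow> ev \<eta> [X] = act X f"
    using tensorial_form1[of "\<lambda>X. act X f"] f by auto
  have "ev (form0 f) [] = f" by (simp add: eval_form_def form0_def)
  then have "ext_d A 0 (form0 f) = \<eta>"
    using \<eta> by (intro ext_d_eqI) (auto simp: length_Suc_conv delete_nth_def act_def)
  then show "form 1 (ext_d A 0 (form0 f))"
    "vfield X \<Longrightarrow> ev (ext_d A 0 (form0 f)) [X] = act X f"
    using \<eta> by auto
qed

text \<open>Derivatives of the coefficients cancel between the terms where a field acts and the
  terms with a Lie bracket. The formula is thus tensorial, and the definite description in
  \<open>ext_d\<close> denotes the form so obtained.\<close>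

lemma ext_d2:
  assumes \<Omega>: "form 2 \<Omega>"
  shows "form 3 (ext_d A 2 \<Omega>)"
    and "vfield X \<Longrightarrow> vfield Y \<Longrightarrow> vfield Z \<Longrightarrow>
      ev (ext_d A 2 \<Omega>) [X, Y, Z] = d2 \<Omega> X Y Z"
proof -
  have "\<exists>\<eta>. form 3 \<eta> \<and> (\<forall>X Y Z. vfield X \<longrightarrow> vfield Y \<longrightarrow>
      vfield Z \<longrightarrow> ev \<eta> [X, Y, Z] = d2 \<Omega> X Y Z)"
  proof (rule tensorial_form3, goal_cases)
    case (3 X Y Z p)
    then show ?case using \<Omega> form2_swap[OF \<Omega>, of X Y]
      by (simp add: d2_def lie_bracket_swap[of Y X])
  next
    case (4 X Y Z p)
    then show ?case using \<Omega> form2_swap[OF \<Omega>, of Y Z]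
      by (simp add: d2_def lie_bracket_swap[of Z Y])
  qed (use \<Omega> in \<open>simp_all add: d2_def lie_bracket_vcomb algebra_simps\<close>)
  then obtain \<eta> where \<eta>: "form 3 \<eta>"
    "\<And>X Y Z. vfield X \<Longrightarrow> vfield Y \<Longrightarrow> vfield Z \<Longrightarrow>
      ev \<eta> [X, Y, Z] = d2 \<Omega> X Y Z" by blast
  then have "ext_d A 2 \<Omega> = \<eta>"
    by (intro ext_d_eqI)
      (auto simp: length_Suc_conv delete_nth_def act_def d2_def eval_nat_numeral)
  then show "form 3 (ext_d A 2 \<Omega>)"
    "vfield X \<Longrightarrow> vfield Y \<Longrightarrow> vfield Z \<Longrightarrow>
      ev (ext_d A 2 \<Omega>) [X, Y, Z] = d2 \<Omega> X Y Z"
    using \<eta> by auto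
qed

lemma ext_d3:
  assumes \<phi>: "form 3 \<phi>"
  shows "form 4 (ext_d A 3 \<phi>)"
    and "vfield X \<Longrightarrow> vfield Y \<Longrightarrow> vfield Z \<Longrightarrow> vfield W \<Longrightarrow>
      ev (ext_d A 3 \<phi>) [X, Y, Z, W] = d3 \<phi> X Y Z W"
proof -
  have "\<exists>\<eta>. form 4 \<eta> \<and> (\<forall>X Y Z W. vfield X \<longrightarrow> vfield Y \<longrightarrow>
      vfield Z \<longrightarrow> vfield W \<longrightarrow> ev \<eta> [X, Y, Z, W] = d3 \<phi> X Y Z W)"
  proof (rule tensorial_form4, goal_cases)
    case (3 X Y Z W p)
    then show ?case using \<phi> form3_swap(1)[OF \<phi>, of X Y] form3_swap(2)[OF \<phi>, of _ X Y]
      by (simp add: d3_def lie_bracket_swap[of Y X])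
  next
    case (4 X Y Z W p)
    then show ?case using \<phi> form3_swap(1)[OF \<phi>, of Y Z] form3_swap(2)[OF \<phi>, of _ Y Z]
      by (simp add: d3_def lie_bracket_swap[of Z Y])
  next
    case (5 X Y Z W p)
    then show ?case using \<phi> form3_swap(2)[OF \<phi>, of _ Z W]
      by (simp add: d3_def lie_bracket_swap[of W Z])
  qed (use \<phi> in \<open>simp_all add: d3_def lie_bracket_vcomb algebra_simps\<close>)
  then obtain \<eta> where \<eta>: "form 4 \<eta>"
    "\<And>X Y Z W. vfield X \<Longrightarrow> vfield Y \<Longrightarrow> vfield Z \<Longrightarrow> vfield W \<Longrightarrow>
      ev \<eta> [X, Y, Z, W] = d3 \<phi> X Y Z W" by blast
  then have "ext_d A 3 \<phi> = \<eta>"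
    by (intro ext_d_eqI)
      (auto simp: length_Suc_conv delete_nth_def act_def d3_def eval_nat_numeral)
  then show "form 4 (ext_d A 3 \<phi>)"
    "vfield X \<Longrightarrow> vfield Y \<Longrightarrow> vfield Z \<Longrightarrow> vfield W \<Longrightarrow>
      ev (ext_d A 3 \<phi>) [X, Y, Z, W] = d3 \<phi> X Y Z W"
    using \<eta> by auto
qed

end

section \<open>Linear operations on forms, endomorphisms, contractions and the Lie
  derivative\<close>

context smooth_manifold
begin

declare One_nat_def [simp del] \<comment> \<open>otherwise the degree in \<open>form 1 \<alpha>\<close> becomes \<open>Suc 0\<close> and the rules below never fire\<close>

lemma alt_form_comb:
  assumes "\<omega> \<in> alt_forms A p k" "\<eta> \<in> alt_forms A p k"
  shows "(\<lambda>vs. a * \<omega> vs + b * \<eta> vs) \<in> alt_forms A p k"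
  using assms unfolding alt_forms_def by (simp add: algebra_simps)

lemma alt_form_zero: "(\<lambda>vs. 0) \<in> alt_forms A p k"
  by (simp add: alt_forms_def)

lemma alt_form_lincomb:
  "(\<And>i. i \<in> I \<Longrightarrow> \<omega> i \<in> alt_forms A p k) \<Longrightarrow> (\<lambda>vs. \<Sum>i\<in>I. c i * \<omega> i vs) \<in> alt_forms A p k"
proof (induction I rule: infinite_finite_induct)
  case (insert i I)
  then have "(\<lambda>vs. c i * \<omega> i vs + 1 * (\<Sum>i\<in>I. c i * \<omega> i vs)) \<in> alt_forms A p k"
    by (intro alt_form_comb) auto
  then show ?case using insert by simp
qed (simp_all add: alt_form_zero)

lemma eval_form_comb [simp]:
  "ev (\<lambda>p vs. g p * \<omega> p vs + h p * \<eta> p vs) Xs =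
    (\<lambda>p. g p * ev \<omega> Xs p + h p * ev \<eta> Xs p)"
  by (simp add: eval_form_def)

lemma diff_form_comb:
  assumes "smooth g" "form k \<omega>" "smooth h" "form k \<eta>"
  shows "form k (\<lambda>p vs. g p * \<omega> p vs + h p * \<eta> p vs)"
proof -
  have "smooth (ev \<omega> Xs)" "smooth (ev \<eta> Xs)"
    if "length Xs = k" "\<forall>X\<in>set Xs. vfield X" for Xs
    using assms that by (auto simp: diff_form_def)
  then show ?thesis
    using assms unfolding diff_form_def by (auto intro: alt_form_comb)
qed

lemma diff_form_zero [simp]: "form k (\<lambda>p vs. 0)"
  by (simp add: diff_form_def alt_form_zero eval_form_def)

lemma diff_form_scale: "smooth g \<Longrightarrow> form k \<omega> \<Longrightarrow> form k (\<lambda>p vs. g p * \<omega> p vs)"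
  using diff_form_comb[of g k \<omega> "\<lambda>_. 0" \<omega>] by simp

lemma diff_form_add: "form k \<omega> \<Longrightarrow> form k \<eta> \<Longrightarrow> form k (\<lambda>p vs. \<omega> p vs + \<eta> p vs)"
  using diff_form_comb[of "\<lambda>_. 1" k \<omega> "\<lambda>_. 1" \<eta>] by simp

lemma diff_form_diff: "form k \<omega> \<Longrightarrow> form k \<eta> \<Longrightarrow> form k (\<lambda>p vs. \<omega> p vs - \<eta> p vs)"
  using diff_form_comb[of "\<lambda>_. 1" k \<omega> "\<lambda>_. -1" \<eta>] by simp

text \<open>Unlike in \<open>form_eqI\<close>, \<open>\<omega>\<close> is not yet known to be a
  form. This is how \<open>ins_endo\<close> and \<open>wedge\<close> are shown to produce forms:
  they are identified with a form supplied by tensoriality.\<close>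

lemma diff_form_cong:
  assumes "form k \<eta>"
    and "\<And>p vs. \<not> (length vs = k \<and> set vs \<subseteq> tangent p) \<Longrightarrow> \<omega> p vs = 0"
    and "\<And>Xs p. length Xs = k \<Longrightarrow> \<forall>X\<in>set Xs. vfield X \<Longrightarrow>
      ev \<omega> Xs p = ev \<eta> Xs p"
  shows "\<omega> = \<eta>"
proof (intro ext)
  fix p vs show "\<omega> p vs = \<eta> p vs"
  proof (cases "length vs = k \<and> set vs \<subseteq> tangent p")
    case True
    then have "map (\<lambda>X. X p) (map (extend_at p) vs) = vs"
      by (auto simp: o_def subset_iff extend_at(2) intro!: map_idI)
    then show ?thesis
      using assms(3)[of "map (extend_at p) vs" p] True
      by (auto simp: subset_iff extend_at(1) eval_form_def)
  next
    case False
    then show ?thesis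
      using assms(2)[OF False] alt_form_outside[OF diff_form_alt[OF assms(1)] False] by simp
  qed
qed

lemma eval_form_ext_d0 [simp]:
  "smooth f \<Longrightarrow> vfield X \<Longrightarrow> ev (ext_d A 0 (form0 f)) [X] = act X f"
  by (rule ext_d0)

lemma diff_form_ext_d0 [simp]: "smooth f \<Longrightarrow> form 1 (ext_d A 0 (form0 f))"
  by (rule ext_d0)

lemma closed_form2_iff:
  assumes "form 2 \<Omega>"
  shows "closed_form A 2 \<Omega> \<longleftrightarrow> (\<forall>X Y Z. vfield X \<longrightarrow> vfield Y \<longrightarrow>
    vfield Z \<longrightarrow> d2 \<Omega> X Y Z = (\<lambda>p. 0))"
proof
  assume "closed_form A 2 \<Omega>"
  then show "\<forall>X Y Z. vfield X \<longrightarrow> vfield Y \<longrightarrow>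
      vfield Z \<longrightarrow> d2 \<Omega> X Y Z = (\<lambda>p. 0)"
    using ext_d2(2)[OF assms, symmetric] by (simp add: closed_form_def eval_form_def)
next
  assume *: "\<forall>X Y Z. vfield X \<longrightarrow> vfield Y \<longrightarrow>
      vfield Z \<longrightarrow> d2 \<Omega> X Y Z = (\<lambda>p. 0)"
  show "closed_form A 2 \<Omega>"
    unfolding closed_form_def
  proof (rule form_eqI[OF ext_d2(1)[OF assms] diff_form_zero])
    fix Xs p assume "length Xs = 3" "\<forall>X\<in>set Xs. vfield X"
    then show "ev (ext_d A 2 \<Omega>) Xs p = ev (\<lambda>p vs. 0) Xs p"
      using * ext_d2(2)[OF assms] by (auto simp: length_numeral_cases eval_form_def[of "\<lambda>p vs. 0"])
  qed
qed

lemma closed_form3_iff: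
  assumes "form 3 \<phi>"
  shows "closed_form A 3 \<phi> \<longleftrightarrow> (\<forall>X Y Z W. vfield X \<longrightarrow> vfield Y \<longrightarrow>
    vfield Z \<longrightarrow> vfield W \<longrightarrow> d3 \<phi> X Y Z W = (\<lambda>p. 0))"
proof
  assume "closed_form A 3 \<phi>"
  then show "\<forall>X Y Z W. vfield X \<longrightarrow> vfield Y \<longrightarrow>
      vfield Z \<longrightarrow> vfield W \<longrightarrow> d3 \<phi> X Y Z W = (\<lambda>p. 0)"
    using ext_d3(2)[OF assms, symmetric] by (simp add: closed_form_def eval_form_def)
next
  assume *: "\<forall>X Y Z W. vfield X \<longrightarrow> vfield Y \<longrightarrow>
      vfield Z \<longrightarrow> vfield W \<longrightarrow> d3 \<phi> X Y Z W = (\<lambda>p. 0)"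
  show "closed_form A 3 \<phi>"
    unfolding closed_form_def
  proof (rule form_eqI[OF ext_d3(1)[OF assms] diff_form_zero])
    fix Xs p assume "length Xs = 4" "\<forall>X\<in>set Xs. vfield X"
    then show "ev (ext_d A 3 \<phi>) Xs p = ev (\<lambda>p vs. 0) Xs p"
      using * ext_d3(2)[OF assms] by (auto simp: length_numeral_cases eval_form_def[of "\<lambda>p vs. 0"])
  qed
qed

lemma endo_fieldD:
  assumes "endo_field A N"
  shows "v \<in> tangent p \<Longrightarrow> N p v \<in> tangent p"
    and "v \<in> tangent p \<Longrightarrow> w \<in> tangent p \<Longrightarrow>
      N p (\<lambda>f. a * v f + b * w f) = (\<lambda>f. a * N p v f + b * N p w f)"
    and "v \<notin> tangent p \<Longrightarrow> N p v = (\<lambda>f. 0)"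
  using assms unfolding endo_field_def by blast+

lemma endo_tangent: "endo_field A N \<Longrightarrow> N p v \<in> tangent p"
  using endo_fieldD(1,3)[of N] tangent_zero by metis

lemma vector_field_apply_endo [simp]:
  "endo_field A N \<Longrightarrow> vfield X \<Longrightarrow> vfield (apply_endo N X)"
  by (simp add: endo_field_def apply_endo_def)

lemma apply_endo_vcomb [simp]:
  "endo_field A N \<Longrightarrow> vfield X \<Longrightarrow> vfield Y \<Longrightarrow>
    apply_endo N (vcomb g X h Y) = vcomb g (apply_endo N X) h (apply_endo N Y)"
  by (simp add: apply_endo_def vcomb_def endo_fieldD(2))

lemma alt_form_update_zero:
  assumes "\<omega> \<in> alt_forms A p k" "i < length vs"
  shows "\<omega> (vs[i := (\<lambda>f. 0)]) = 0"
proof (cases "length vs = k \<and> set (vs[i := (\<lambda>f. 0)]) \<subseteq> tangent p")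
  case True
  then show ?thesis
    using alt_form_linear[OF assms(1), of "vs[i := (\<lambda>f. 0)]" i "\<lambda>f. 0" "\<lambda>f. 0" 0 0] assms(2) by simp
next
  case False
  then show ?thesis using alt_form_outside[OF assms(1), of "vs[i := (\<lambda>f. 0)]"] by simp
qed

text \<open>\<open>N\<close> sends a vector that is not tangent to zero, which is tangent, so a
  summand may have admissible arguments although the original list is inadmissible. Such a summand
  vanishes because one of its arguments is zero.\<close>

lemma ins_endo_outside:
  assumes "endo_field A N" "form k \<omega>" "\<not> (length vs = k \<and> set vs \<subseteq> tangent p)"
  shows "ins_endo N \<omega> p vs = 0"
  unfolding ins_endo_def
proof (rule sum.neutral, rule ballI)
  fix i assume i: "i \<in> {..<length vs}"
  note \<omega> = diff_form_alt[OF assms(2), of p]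
  show "\<omega> p (vs[i := N p (vs ! i)]) = 0"
  proof (cases "vs ! i \<in> tangent p")
    case False
    then show ?thesis
      using endo_fieldD(3)[OF assms(1)] alt_form_update_zero[OF \<omega>, of i vs] i by simp
  next
    case True
    have "\<not> (length (vs[i := N p (vs ! i)]) = k \<and> set (vs[i := N p (vs ! i)]) \<subseteq> tangent p)"
    proof
      assume *: "length (vs[i := N p (vs ! i)]) = k \<and> set (vs[i := N p (vs ! i)]) \<subseteq> tangent p"
      have "vs ! j \<in> tangent p" if "j < length vs" for j
        using * that True nth_mem[of j "vs[i := N p (vs ! i)]"] by (cases "i = j") auto
      then show False using assms(3) * by (auto simp: in_set_conv_nth subset_iff)
    qed
    then show ?thesis by (rule alt_form_outside[OF \<omega>])
  qed
qed

lemma eval_ins_endo2 [simp]: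
  "ev (ins_endo N \<Omega>) [X, Y] =
    (\<lambda>p. ev \<Omega> [apply_endo N X, Y] p + ev \<Omega> [X, apply_endo N Y] p)"
  by (simp add: eval_form_def ins_endo_def apply_endo_def eval_nat_numeral)

lemma eval_ins_endo3 [simp]:
  "ev (ins_endo N \<phi>) [X, Y, Z] =
    (\<lambda>p. ev \<phi> [apply_endo N X, Y, Z] p + ev \<phi> [X, apply_endo N Y, Z] p +
      ev \<phi> [X, Y, apply_endo N Z] p)"
  by (simp add: eval_form_def ins_endo_def apply_endo_def eval_nat_numeral)

lemma diff_form_ins_endo2 [simp]:
  assumes N: "endo_field A N" and \<Omega>: "form 2 \<Omega>"
  shows "form 2 (ins_endo N \<Omega>)"
proof -
  have "\<exists>\<eta>. form 2 \<eta> \<and> (\<forall>X Y. vfield X \<longrightarrow> vfield Y \<longrightarrow>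
      ev \<eta> [X, Y] = ev (ins_endo N \<Omega>) [X, Y])"
  proof (rule tensorial_form2, goal_cases)
    case (3 X Y p)
    then show ?case
      using N form2_swap[OF \<Omega>, of "apply_endo N X" Y] form2_swap[OF \<Omega>, of X "apply_endo N Y"]
      by simp
  qed (use N \<Omega> in \<open>simp_all add: algebra_simps\<close>)
  then obtain \<eta> where "form 2 \<eta>" "\<forall>X Y. vfield X \<longrightarrow> vfield Y \<longrightarrow>
      ev \<eta> [X, Y] = ev (ins_endo N \<Omega>) [X, Y]" by blast
  moreover from this have "ins_endo N \<Omega> = \<eta>"
    by (intro diff_form_cong[of 2]) (auto simp: length_numeral_cases ins_endo_outside[OF N \<Omega>] simp del: eval_ins_endo2)
  ultimately show ?thesis by simp
qed

lemma diff_form_ins_endo3 [simp]: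
  assumes N: "endo_field A N" and \<phi>: "form 3 \<phi>"
  shows "form 3 (ins_endo N \<phi>)"
proof -
  have "\<exists>\<eta>. form 3 \<eta> \<and> (\<forall>X Y Z. vfield X \<longrightarrow> vfield Y \<longrightarrow> vfield Z \<longrightarrow>
      ev \<eta> [X, Y, Z] = ev (ins_endo N \<phi>) [X, Y, Z])"
  proof (rule tensorial_form3, goal_cases)
    case (3 X Y Z p)
    then show ?case
      using N form3_swap(1)[OF \<phi>, of "apply_endo N X" Y] form3_swap(1)[OF \<phi>, of X "apply_endo N Y"]
        form3_swap(1)[OF \<phi>, of X Y] by simp
  next
    case (4 X Y Z p)
    then show ?case
      using N form3_swap(2)[OF \<phi>, of _ "apply_endo N Y" Z] form3_swap(2)[OF \<phi>, of _ Y "apply_endo N Z"]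
        form3_swap(2)[OF \<phi>, of _ Y Z] by simp
  qed (use N \<phi> in \<open>simp_all add: algebra_simps\<close>)
  then obtain \<eta> where "form 3 \<eta>" "\<forall>X Y Z. vfield X \<longrightarrow> vfield Y \<longrightarrow>
      vfield Z \<longrightarrow> ev \<eta> [X, Y, Z] = ev (ins_endo N \<phi>) [X, Y, Z]" by blast
  moreover from this have "ins_endo N \<phi> = \<eta>"
    by (intro diff_form_cong[of 3]) (auto simp: length_numeral_cases ins_endo_outside[OF N \<phi>] simp del: eval_ins_endo3)
  ultimately show ?thesis by simp
qed

lemma diff_form1I:
  assumes "\<And>p. \<alpha> p \<in> alt_forms A p 1" and "\<And>X. vfield X \<Longrightarrow> smooth (ev \<alpha> [X])"
  shows "form 1 \<alpha>"
  unfolding diff_form_def by (auto simp: length_numeral_cases assms)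

lemma alt_form1I:
  assumes "\<And>vs. \<not> (\<exists>v\<in>tangent p. vs = [v]) \<Longrightarrow> \<alpha> vs = 0"
    and "\<And>u w a b. u \<in> tangent p \<Longrightarrow> w \<in> tangent p \<Longrightarrow>
      \<alpha> [\<lambda>f. a * u f + b * w f] = a * \<alpha> [u] + b * \<alpha> [w]"
  shows "\<alpha> \<in> alt_forms A p 1"
  unfolding alt_forms_def
proof (intro CollectI conjI allI impI)
  fix vs assume "\<not> (length vs = 1 \<and> set vs \<subseteq> tangent p)"
  then show "\<alpha> vs = 0" by (intro assms(1)) (auto simp: length_numeral_cases)
qed (use assms(2) in \<open>auto simp: length_Suc_conv One_nat_def\<close>)

lemma alt_form1_linear:
  "\<alpha> \<in> alt_forms A p 1 \<Longrightarrow> u \<in> tangent p \<Longrightarrow> w \<in> tangent p \<Longrightarrow>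
      \<alpha> [\<lambda>f. a * u f + b * w f] = a * \<alpha> [u] + b * \<alpha> [w]"
  using alt_form_linear[of \<alpha> A p 1 "[u]" 0 u w a b] by simp

lemma alt_form1_outside:
  assumes "\<alpha> \<in> alt_forms A p 1" "\<not> (\<exists>v\<in>tangent p. vs = [v])"
  shows "\<alpha> vs = 0"
proof (rule alt_form_outside[OF assms(1)], rule notI, elim conjE)
  assume "length vs = 1" and sub: "set vs \<subseteq> tangent p"
  then obtain v where "vs = [v]" unfolding length_numeral_cases(1) by blast
  then show False using sub assms(2) by simp
qed

lemma alt_form1_sum:
  "\<alpha> \<in> alt_forms A p 1 \<Longrightarrow> (\<And>i. i \<in> I \<Longrightarrow> u i \<in> tangent p) \<Longrightarrow>
    \<alpha> [\<lambda>f. \<Sum>i\<in>I. c i * u i f] = (\<Sum>i\<in>I. c i * \<alpha> [u i])"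
proof (induction I rule: infinite_finite_induct)
  case (insert i I)
  then have "\<alpha> [\<lambda>f. c i * u i f + 1 * (\<Sum>i\<in>I. c i * u i f)] = c i * \<alpha> [u i] + 1 * \<alpha> [\<lambda>f. \<Sum>i\<in>I. c i * u i f]"
    by (intro alt_form1_linear tangent_lincomb) auto
  then show ?case using insert by simp
qed (use alt_form_update_zero[of \<alpha> p 1 0 "[undefined]"] in simp_all)

lemma alt_form_Cons:
  assumes "\<omega> \<in> alt_forms A p (Suc k)" "v \<in> tangent p"
  shows "(\<lambda>ws. \<omega> (v # ws)) \<in> alt_forms A p k"
  unfolding alt_forms_def mem_Collect_eq
proof (intro conjI allI impI)
  fix vs assume "\<not> (length vs = k \<and> set vs \<subseteq> tangent p)"
  then show "\<omega> (v # vs) = 0" by (intro alt_form_outside[OF assms(1)]) auto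
next
  fix vs i u w and a b :: real
  assume "length vs = k" "set vs \<subseteq> tangent p" "i < k" "u \<in> tangent p" "w \<in> tangent p"
  then show "\<omega> (v # vs[i := \<lambda>f. a * u f + b * w f]) = a * \<omega> (v # vs[i := u]) + b * \<omega> (v # vs[i := w])"
    using alt_form_linear[OF assms(1), of "v # vs" "Suc i" u w a b] assms(2) by simp
next
  fix vs and i j :: nat
  assume "length vs = k" "set vs \<subseteq> tangent p" "i < j" "j < k" "vs ! i = vs ! j"
  then show "\<omega> (v # vs) = 0"
    using assms(2) by (intro alt_form_eq_0[OF assms(1), of _ "Suc i" "Suc j"]) auto
qed

lemma eval_form_Cons [simp]: "ev (\<lambda>p ws. \<omega> p (X p # ws)) Ys = ev \<omega> (X # Ys)"
  by (simp add: eval_form_def)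

lemma diff_form_Cons:
  assumes "form (Suc k) \<omega>" "vfield X"
  shows "form k (\<lambda>p ws. \<omega> p (X p # ws))"
  unfolding diff_form_def eval_form_Cons
  using assms by (auto intro: alt_form_Cons simp: diff_form_def)

lemma alt_form_transpose:
  assumes N: "endo_field A N" and \<alpha>: "\<alpha> \<in> alt_forms A p 1"
  shows "transpose_endo N p \<alpha> \<in> alt_forms A p 1"
proof (rule alt_form1I)
  fix vs assume vs: "\<not> (\<exists>v\<in>tangent p. vs = [v])"
  show "transpose_endo N p \<alpha> vs = 0"
  proof (cases "\<exists>v. vs = [v]")
    case True
    then obtain v where "vs = [v]" "v \<notin> tangent p" using vs by blast
    then show ?thesis
      using endo_fieldD(3)[OF N] alt_form_update_zero[OF \<alpha>, of 0 "[v]"] by (simp add: transpose_endo_def)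
  next
    case False
    then show ?thesis
      by (auto simp: transpose_endo_def intro!: alt_form1_outside[OF \<alpha>])
  qed
qed (use endo_tangent[OF N] alt_form1_linear[OF \<alpha>] in \<open>simp add: transpose_endo_def endo_fieldD(2)[OF N]\<close>)

lemma eval_transpose_form [simp]:
  "ev (transpose_form N \<alpha>) [X] = ev \<alpha> [apply_endo N X]"
  by (simp add: eval_form_def transpose_form_def transpose_endo_def apply_endo_def)

lemma diff_form_transpose [simp]:
  assumes "endo_field A N" "form 1 \<alpha>" shows "form 1 (transpose_form N \<alpha>)"
  using assms
  by (intro diff_form1I) (simp_all only: eval_transpose_form, simp_all add: transpose_form_def alt_form_transpose diff_form_alt)

lemma lie_deriv1:
  assumes \<alpha>: "form 1 \<alpha>" and X: "vfield X"
  shows "form 1 (lie_deriv A 1 X \<alpha>)"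
    and "vfield Y \<Longrightarrow> ev (lie_deriv A 1 X \<alpha>) [Y] =
      (\<lambda>p. act X (ev \<alpha> [Y]) p - ev \<alpha> [lie_bracket X Y] p)"
proof -
  let ?G = "\<lambda>Y p. act X (ev \<alpha> [Y]) p - ev \<alpha> [lie_bracket X Y] p"
  have br: "lie_bracket X (vcomb g Y h Z) = vcomb (\<lambda>_. 1) (vcomb g (lie_bracket X Y) h (lie_bracket X Z))
      (\<lambda>_. 1) (vcomb (act X g) Y (act X h) Z)"
    if "smooth g" "smooth h" "vfield Y" "vfield Z" for g h Y Z
    by (rule vector_field_eqI) (use X that in \<open>simp_all add: act_lie_bracket algebra_simps\<close>)
  obtain \<eta> where \<eta>: "form 1 \<eta>" "\<And>Y. vfield Y \<Longrightarrow> ev \<eta> [Y] = ?G Y"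
    using tensorial_form1[of ?G] \<alpha> X by (auto simp: br algebra_simps)
  have "lie_deriv A 1 X \<alpha> = \<eta>"
    unfolding lie_deriv_def
  proof (rule the_equality, goal_cases)
    case 1
    then show ?case using \<eta> by (auto simp: length_numeral_cases act_def)
  next
    case (2 \<zeta>)
    then show ?case using \<eta> by (intro form_eqI[of 1]) (auto simp: length_numeral_cases act_def)
  qed
  then show "form 1 (lie_deriv A 1 X \<alpha>)"
    "vfield Y \<Longrightarrow> ev (lie_deriv A 1 X \<alpha>) [Y] = ?G Y"
    using \<eta> by auto
qed

end

section \<open>Bivectors\<close>

context smooth_manifold
begin

lemma ext_d0_apply:
  assumes "smooth f" "v \<in> tangent p"
  shows "ext_d A 0 (form0 f) p [v] = v f"
proof -
  have "ev (ext_d A 0 (form0 f)) [extend_at p v] p = act (extend_at p v) f p"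
    using assms extend_at(1)[OF assms(2)] by simp
  then show ?thesis
    by (simp add: eval_form_def act_def extend_at(2)[OF assms(2)])
qed

lemma tangent_eqI:
  assumes "u \<in> tangent p" "w \<in> tangent p"
    and "\<And>\<beta>. \<beta> \<in> alt_forms A p 1 \<Longrightarrow> \<beta> [u] = \<beta> [w]"
  shows "u = w"
proof
  fix f show "u f = w f"
  proof (cases "smooth f")
    case True
    then show ?thesis
      using assms(3)[OF diff_form_alt[OF diff_form_ext_d0[OF True]]]
        ext_d0_apply[OF True assms(1)] ext_d0_apply[OF True assms(2)] by simp
  next
    case False
    then show ?thesis
      using tangent_non_smooth[OF assms(1)] tangent_non_smooth[OF assms(2)] by simp
  qed
qed

lemma vector_field_eqI_eval:
  assumes "vfield X" "vfield Y"
    and "\<And>\<beta> p. form 1 \<beta> \<Longrightarrow> ev \<beta> [X] p = ev \<beta> [Y] p"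
  shows "X = Y"
proof (rule vector_field_eqI[OF assms(1,2)])
  fix f p assume f: "smooth f"
  from assms(3)[OF diff_form_ext_d0[OF f], of p] show "act X f p = act Y f p"
    using assms(1,2) f by simp
qed

text \<open>Dual to the expansion of tangent vectors, with v(x i) read as the value of the
  differential of x i on v.\<close>

lemma covector_expansion:
  assumes "weighted_frame \<theta> I x E" "\<beta> \<in> alt_forms A p 1"
  shows "(\<lambda>vs. \<theta> p * \<beta> vs) = (\<lambda>vs. \<Sum>i\<in>I. \<beta> [E i p] * ext_d A 0 (form0 (x i)) p vs)"
proof -
  note fr = weighted_frameD[OF assms(1)]
  have E: "E i p \<in> tangent p" for i using fr(4) by simp
  have dx: "ext_d A 0 (form0 (x i)) p \<in> alt_forms A p 1" for i
    by (rule diff_form_alt[OF diff_form_ext_d0[OF fr(3)]])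
  have 1: "(\<lambda>vs. \<theta> p * \<beta> vs) \<in> alt_forms A p 1"
    using alt_form_comb[OF assms(2,2), of "\<theta> p" 0] by simp
  have 2: "(\<lambda>vs. \<Sum>i\<in>I. \<beta> [E i p] * ext_d A 0 (form0 (x i)) p vs) \<in> alt_forms A p 1"
    by (rule alt_form_lincomb[OF dx])
  show ?thesis
  proof (rule alt_form_eqI[OF 1 2])
    fix Xs :: "'m vfield list" assume "length Xs = 1" "\<forall>X\<in>set Xs. vfield X"
    then obtain X where X: "Xs = [X]" "vfield X" by (auto simp: length_numeral_cases)
    then have v: "X p \<in> tangent p" by simp
    have "\<theta> p * \<beta> [X p] = \<beta> [\<lambda>f. \<theta> p * X p f]"
      using alt_form1_linear[OF assms(2) v v, of "\<theta> p" 0] by simp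
    also have "(\<lambda>f. \<theta> p * X p f) = (\<lambda>f. \<Sum>i\<in>I. X p (x i) * E i p f)"
      using fr(5)[OF v] by auto
    also have "\<beta> [\<lambda>f. \<Sum>i\<in>I. X p (x i) * E i p f] = (\<Sum>i\<in>I. X p (x i) * \<beta> [E i p])"
      by (rule alt_form1_sum[OF assms(2) E])
    finally show "\<theta> p * \<beta> (map (\<lambda>X. X p) Xs) =
        (\<Sum>i\<in>I. \<beta> [E i p] * ext_d A 0 (form0 (x i)) p (map (\<lambda>X. X p) Xs))"
      using X(1) by (simp add: ext_d0_apply[OF fr(3) v] mult.commute)
  qed
qed

lemma bivector_linear1:
  "bivector_field A \<pi> \<Longrightarrow> \<alpha> \<in> alt_forms A p 1 \<Longrightarrow> \<beta> \<in> alt_forms A p 1 \<Longrightarrow> \<gamma> \<in> alt_forms A p 1 \<Longrightarrow>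
    \<pi> p (\<lambda>vs. a * \<alpha> vs + b * \<beta> vs) \<gamma> = a * \<pi> p \<alpha> \<gamma> + b * \<pi> p \<beta> \<gamma>"
  unfolding bivector_field_def by blast

lemma bivector_smooth:
  "bivector_field A \<pi> \<Longrightarrow> form 1 \<alpha> \<Longrightarrow> form 1 \<beta> \<Longrightarrow>
    smooth (\<lambda>p. \<pi> p (\<alpha> p) (\<beta> p))"
  unfolding bivector_field_def by blast

lemma bivector_swap:
  "bivector_field A \<pi> \<Longrightarrow> \<alpha> \<in> alt_forms A p 1 \<Longrightarrow> \<beta> \<in> alt_forms A p 1 \<Longrightarrow> \<pi> p \<alpha> \<beta> = - \<pi> p \<beta> \<alpha>"
  unfolding bivector_field_def by blast

lemma bivector_linear2:
  "bivector_field A \<pi> \<Longrightarrow> \<alpha> \<in> alt_forms A p 1 \<Longrightarrow> \<beta> \<in> alt_forms A p 1 \<Longrightarrow> \<gamma> \<in> alt_forms A p 1 \<Longrightarrow>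
    \<pi> p \<gamma> (\<lambda>vs. a * \<alpha> vs + b * \<beta> vs) = a * \<pi> p \<gamma> \<alpha> + b * \<pi> p \<gamma> \<beta>"
  using bivector_linear1[of \<pi> \<alpha> p \<beta> \<gamma> a b] bivector_swap[of \<pi> \<gamma> p "\<lambda>vs. a * \<alpha> vs + b * \<beta> vs"]
    bivector_swap[of \<pi> \<gamma> p \<alpha>] bivector_swap[of \<pi> \<gamma> p \<beta>] alt_form_comb[of \<alpha> p 1 \<beta> a b]
  by simp

lemma bivector_sum2:
  assumes \<pi>: "bivector_field A \<pi>" and \<gamma>: "\<gamma> \<in> alt_forms A p 1"
  shows "(\<And>i. i \<in> I \<Longrightarrow> \<alpha> i \<in> alt_forms A p 1) \<Longrightarrow>
    \<pi> p \<gamma> (\<lambda>vs. \<Sum>i\<in>I. c i * \<alpha> i vs) = (\<Sum>i\<in>I. c i * \<pi> p \<gamma> (\<alpha> i))"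
proof (induction I rule: infinite_finite_induct)
  case (insert i I)
  then have "\<pi> p \<gamma> (\<lambda>vs. c i * \<alpha> i vs + 1 * (\<Sum>i\<in>I. c i * \<alpha> i vs)) =
      c i * \<pi> p \<gamma> (\<alpha> i) + 1 * \<pi> p \<gamma> (\<lambda>vs. \<Sum>i\<in>I. c i * \<alpha> i vs)"
    by (intro bivector_linear2 \<pi> \<gamma> alt_form_lincomb) auto
  then show ?case using insert by simp
qed (use bivector_linear2[OF \<pi> alt_form_zero alt_form_zero \<gamma>, of 0 0] in simp_all)

text \<open>Finite dimensionality enters through the frame, which also gives the witness: its
  coefficient at E i is \<pi>(\<alpha>, dx_i) / \<theta>.\<close>

lemma sharp_ex:
  assumes \<pi>: "bivector_field A \<pi>" and \<alpha>: "\<alpha> \<in> alt_forms A p 1"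
  shows "\<exists>v\<in>tangent p. \<forall>\<beta>\<in>alt_forms A p 1. \<beta> [v] = \<pi> p \<alpha> \<beta>"
proof -
  obtain \<theta> I x E where wf: "weighted_frame \<theta> I x E" and p: "\<theta> p \<noteq> 0"
    using ex_weighted_frame by blast
  note fr = weighted_frameD[OF wf]
  let ?c = "\<lambda>i. \<pi> p \<alpha> (ext_d A 0 (form0 (x i)) p) / \<theta> p"
  let ?v = "\<lambda>f. \<Sum>i\<in>I. ?c i * E i p f"
  have E: "E i p \<in> tangent p" for i using fr(4) by simp
  have dx: "ext_d A 0 (form0 (x i)) p \<in> alt_forms A p 1" for i
    by (rule diff_form_alt[OF diff_form_ext_d0[OF fr(3)]])
  have "\<beta> [?v] = \<pi> p \<alpha> \<beta>" if \<beta>: "\<beta> \<in> alt_forms A p 1" for \<beta>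
  proof -
    have "\<theta> p * \<pi> p \<alpha> \<beta> = \<pi> p \<alpha> (\<lambda>vs. \<theta> p * \<beta> vs)"
      using bivector_linear2[OF \<pi> \<beta> \<beta> \<alpha>, of "\<theta> p" 0] by simp
    also have "\<dots> = \<pi> p \<alpha> (\<lambda>vs. \<Sum>i\<in>I. \<beta> [E i p] * ext_d A 0 (form0 (x i)) p vs)"
      unfolding covector_expansion[OF wf \<beta>] ..
    also have "\<dots> = (\<Sum>i\<in>I. \<beta> [E i p] * \<pi> p \<alpha> (ext_d A 0 (form0 (x i)) p))"
      by (rule bivector_sum2[OF \<pi> \<alpha> dx])
    also have "\<dots> = \<theta> p * (\<Sum>i\<in>I. ?c i * \<beta> [E i p])"
      using p by (simp add: sum_distrib_left mult.commute)
    also have "\<dots> = \<theta> p * \<beta> [?v]"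
      by (simp only: alt_form1_sum[OF \<beta> E])
    finally show ?thesis using p by simp
  qed
  moreover have "?v \<in> tangent p" by (rule tangent_lincomb[OF E])
  ultimately show ?thesis by blast
qed

lemma sharp_eqI:
  assumes "v \<in> tangent p" "\<And>\<beta>. \<beta> \<in> alt_forms A p 1 \<Longrightarrow> \<beta> [v] = \<pi> p \<alpha> \<beta>"
  shows "sharp A \<pi> p \<alpha> = v"
  unfolding sharp_def
proof (rule the_equality)
  show "v \<in> tangent p \<and> (\<forall>\<beta>\<in>alt_forms A p 1. \<beta> [v] = \<pi> p \<alpha> \<beta>)"
    using assms by blast
qed (use assms in \<open>auto intro: tangent_eqI[of _ p]\<close>)

lemma sharp:
  assumes "bivector_field A \<pi>" "\<alpha> \<in> alt_forms A p 1"
  shows "sharp A \<pi> p \<alpha> \<in> tangent p"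
    and "\<beta> \<in> alt_forms A p 1 \<Longrightarrow> \<beta> [sharp A \<pi> p \<alpha>] = \<pi> p \<alpha> \<beta>"
  using sharp_ex[OF assms] sharp_eqI[of _ p \<pi> \<alpha>] by auto

lemma sharp_comb:
  assumes "bivector_field A \<pi>" "\<alpha> \<in> alt_forms A p 1" "\<beta> \<in> alt_forms A p 1"
  shows "sharp A \<pi> p (\<lambda>vs. a * \<alpha> vs + b * \<beta> vs) = (\<lambda>f. a * sharp A \<pi> p \<alpha> f + b * sharp A \<pi> p \<beta> f)"
  using assms sharp[OF assms(1)]
  by (intro sharp_eqI tangent_comb) (simp_all add: alt_form1_linear bivector_linear1)

lemma sharp_zero: "bivector_field A \<pi> \<Longrightarrow> sharp A \<pi> p (\<lambda>vs. 0) = (\<lambda>f. 0)"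
  using sharp_comb[OF _ alt_form_zero alt_form_zero, of \<pi> p 0 0] by simp

lemma vector_field_sharp [simp]:
  assumes "bivector_field A \<pi>" "form 1 \<alpha>"
  shows "vfield (sharp_field A \<pi> \<alpha>)"
  unfolding vector_field_def sharp_field_def
proof (intro conjI allI impI)
  show t: "sharp A \<pi> p (\<alpha> p) \<in> tangent p" for p
    by (rule sharp(1)[OF assms(1) diff_form_alt[OF assms(2)]])
  fix f assume f: "smooth f"
  have "sharp A \<pi> p (\<alpha> p) f = \<pi> p (\<alpha> p) (ext_d A 0 (form0 f) p)" for p
    using sharp(2)[OF assms(1) diff_form_alt[OF assms(2)] diff_form_alt[OF diff_form_ext_d0[OF f]], of p]
    by (simp add: ext_d0_apply[OF f t])
  then show "smooth (\<lambda>p. sharp A \<pi> p (\<alpha> p) f)"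
    using bivector_smooth[OF assms diff_form_ext_d0[OF f]] by simp
qed

lemma eval_sharp:
  assumes "bivector_field A \<pi>" "form 1 \<alpha>" "form 1 \<beta>"
  shows "ev \<beta> [sharp_field A \<pi> \<alpha>] = (\<lambda>p. \<pi> p (\<alpha> p) (\<beta> p))"
  using sharp(2)[OF assms(1) diff_form_alt[OF assms(2)] diff_form_alt[OF assms(3)]]
  by (simp add: eval_form_def sharp_field_def)

lemma eval_sharp_swap:
  assumes "bivector_field A \<pi>" "form 1 \<alpha>" "form 1 \<beta>"
  shows "ev \<beta> [sharp_field A \<pi> \<alpha>] = (\<lambda>p. - ev \<alpha> [sharp_field A \<pi> \<beta>] p)"
  using assms bivector_swap[OF assms(1) diff_form_alt[OF assms(2)] diff_form_alt[OF assms(3)]]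
  by (simp add: eval_sharp)

lemma sharp_field_comb:
  assumes "bivector_field A \<pi>" "form 1 \<alpha>" "form 1 \<beta>"
  shows "sharp_field A \<pi> (\<lambda>p vs. g p * \<alpha> p vs + h p * \<beta> p vs) =
    vcomb g (sharp_field A \<pi> \<alpha>) h (sharp_field A \<pi> \<beta>)"
  using assms by (simp add: sharp_field_def vcomb_def sharp_comb diff_form_alt)

lemma diff_form_bracket1 [simp]:
  assumes "bivector_field A \<pi>" "form 1 \<alpha>" "form 1 \<beta>"
  shows "form 1 (bracket1 A \<pi> \<alpha> \<beta>)"
  unfolding bracket1_def using assms
  by (intro diff_form_diff lie_deriv1 diff_form_ext_d0 vector_field_sharp) auto

lemma eval_bracket1:
  assumes "bivector_field A \<pi>" "form 1 \<alpha>" "form 1 \<beta>" "vfield Z"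
  shows "ev (bracket1 A \<pi> \<alpha> \<beta>) [Z] = (\<lambda>p. act (sharp_field A \<pi> \<alpha>) (ev \<beta> [Z]) p -
    ev \<beta> [lie_bracket (sharp_field A \<pi> \<alpha>) Z] p - act (sharp_field A \<pi> \<beta>) (ev \<alpha> [Z]) p +
    ev \<alpha> [lie_bracket (sharp_field A \<pi> \<beta>) Z] p - act Z (ev \<beta> [sharp_field A \<pi> \<alpha>]) p)"
proof -
  have e: "ev (bracket1 A \<pi> \<alpha> \<beta>) [Z] p = ev (lie_deriv A 1 (sharp_field A \<pi> \<alpha>) \<beta>) [Z] p -
      ev (lie_deriv A 1 (sharp_field A \<pi> \<beta>) \<alpha>) [Z] p -
      ev (ext_d A 0 (form0 (ev \<beta> [sharp_field A \<pi> \<alpha>]))) [Z] p" for p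
    by (simp add: bracket1_def eval_form_def)
  have X: "vfield (sharp_field A \<pi> \<alpha>)" "vfield (sharp_field A \<pi> \<beta>)"
    using assms by simp_all
  show ?thesis
    using assms X by (simp add: fun_eq_iff e lie_deriv1(2))
qed

text \<open>\<open>\<theta> \<alpha>\<close> is a combination of the exact forms dx_i with smooth
  coefficients. In applications \<open>T\<close> is the defect, at the fixed point \<open>p\<close>,
  of an identity that is linear over functions.\<close>

lemma one_form_functional_eq_0:
  fixes T :: "'m dform \<Rightarrow> real"
  assumes lin: "\<And>g h \<alpha> \<beta>. smooth g \<Longrightarrow> smooth h \<Longrightarrow> form 1 \<alpha> \<Longrightarrow>
      form 1 \<beta> \<Longrightarrow> T (\<lambda>q vs. g q * \<alpha> q vs + h q * \<beta> q vs) = g p * T \<alpha> + h p * T \<beta>"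
    and exact: "\<And>f. smooth f \<Longrightarrow> T (ext_d A 0 (form0 f)) = 0"
    and \<alpha>: "form 1 \<alpha>"
  shows "T \<alpha> = 0"
proof -
  obtain \<theta> I x E where wf: "weighted_frame \<theta> I x E" and p: "\<theta> p \<noteq> 0"
    using ex_weighted_frame by blast
  note fr = weighted_frameD[OF wf]
  have *: "form 1 (\<lambda>q vs. \<Sum>i\<in>J. g i q * ext_d A 0 (form0 (x i)) q vs) \<and>
      T (\<lambda>q vs. \<Sum>i\<in>J. g i q * ext_d A 0 (form0 (x i)) q vs) = 0"
    if "finite J" "\<And>i. smooth (g i)" for g J
    using that(1)
  proof (induction J rule: finite_induct)
    case empty
    then show ?case using lin[of "\<lambda>_. 0" "\<lambda>_. 0" \<alpha> \<alpha>] \<alpha> by simp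
  next
    case (insert i J)
    then show ?case
      using that(2) diff_form_ext_d0[OF fr(3), of i] exact[OF fr(3), of i]
        lin[of "g i" "\<lambda>_. 1" "ext_d A 0 (form0 (x i))" "\<lambda>q vs. \<Sum>i\<in>J. g i q * ext_d A 0 (form0 (x i)) q vs"]
        diff_form_comb[of "g i" 1 "ext_d A 0 (form0 (x i))" "\<lambda>_. 1" "\<lambda>q vs. \<Sum>i\<in>J. g i q * ext_d A 0 (form0 (x i)) q vs"]
      by simp
  qed
  have "(\<lambda>q vs. \<theta> q * \<alpha> q vs + 0 * \<alpha> q vs) =
      (\<lambda>q vs. \<Sum>i\<in>I. ev \<alpha> [E i] q * ext_d A 0 (form0 (x i)) q vs)"
    using covector_expansion[OF wf diff_form_alt[OF \<alpha>]] by (auto simp: eval_form_def fun_eq_iff)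
  moreover have "T (\<lambda>q vs. \<Sum>i\<in>I. ev \<alpha> [E i] q * ext_d A 0 (form0 (x i)) q vs) = 0"
    using *[OF fr(1), of "\<lambda>i. ev \<alpha> [E i]"] \<alpha> fr(4) by simp
  ultimately have "\<theta> p * T \<alpha> = 0"
    using lin[of \<theta> "\<lambda>_. 0" \<alpha> \<alpha>] fr(2) \<alpha> by simp
  then show ?thesis using p by simp
qed

end

section \<open>Contractions, the deformed endomorphism and brackets of sharp fields\<close>

definition contr :: "'m vfield \<Rightarrow> 'm dform \<Rightarrow> 'm dform" where
  "contr X \<omega> = (\<lambda>p ws. \<omega> p (X p # ws))"

context smooth_manifold
begin

abbreviation df :: "('m \<Rightarrow> real) \<Rightarrow> 'm dform" where "df f \<equiv> ext_d A 0 (form0 f)"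

lemma eval_contr [simp]: "ev (contr X \<omega>) Ys = ev \<omega> (X # Ys)"
  by (simp add: contr_def)

lemma diff_form_contr2 [simp]: "form 2 \<Omega> \<Longrightarrow> vfield X \<Longrightarrow> form 1 (contr X \<Omega>)"
  unfolding contr_def by (rule diff_form_Cons) (simp_all add: numeral_2_eq_2 One_nat_def)

lemma diff_form_contr3 [simp]: "form 3 \<phi> \<Longrightarrow> vfield X \<Longrightarrow> form 2 (contr X \<phi>)"
  unfolding contr_def by (rule diff_form_Cons) (simp_all add: numeral_2_eq_2 numeral_3_eq_3)

lemma flat_comb:
  assumes \<Omega>: "form 2 \<Omega>" and u: "u \<in> tangent p" and w: "w \<in> tangent p"
  shows "flat \<Omega> p (\<lambda>f. a * u f + b * w f) = (\<lambda>ws. a * flat \<Omega> p u ws + b * flat \<Omega> p w ws)"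
proof
  fix ws
  note \<omega> = diff_form_alt[OF \<Omega>, of p]
  show "flat \<Omega> p (\<lambda>f. a * u f + b * w f) ws = a * flat \<Omega> p u ws + b * flat \<Omega> p w ws"
  proof (cases "length ws = 1 \<and> set ws \<subseteq> tangent p")
    case True
    then show ?thesis
      using alt_form_linear[OF \<omega>, of "u # ws" 0 u w a b] u w by (simp add: flat_def)
  next
    case False
    have "\<Omega> p (v # ws) = 0" for v
      by (rule alt_form_outside[OF \<omega>]) (use False in \<open>auto simp: numeral_2_eq_2 One_nat_def\<close>)
    then show ?thesis by (simp add: flat_def)
  qed
qed

lemma alt_form_flat:
  "form 2 \<Omega> \<Longrightarrow> v \<in> tangent p \<Longrightarrow> flat \<Omega> p v \<in> alt_forms A p 1"
  unfolding flat_def using diff_form_alt[of 2 \<Omega> p]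
  by (intro alt_form_Cons) (simp_all add: numeral_2_eq_2 One_nat_def)

lemma apply_deformed_endo:
  "apply_endo (deformed_endo A \<pi> N \<Omega>) X =
    vcomb (\<lambda>_. 1) (apply_endo N X) (\<lambda>_. 1) (sharp_field A \<pi> (contr X \<Omega>))"
  by (simp add: apply_endo_def deformed_endo_def vcomb_def sharp_field_def contr_def flat_def)

lemma endo_field_deformed:
  assumes \<pi>: "bivector_field A \<pi>" and N: "endo_field A N" and \<Omega>: "form 2 \<Omega>"
  shows "endo_field A (deformed_endo A \<pi> N \<Omega>)"
  unfolding endo_field_def
proof (intro conjI allI ballI impI)
  fix p v assume v: "v \<in> tangent p"
  note [simp] = sharp(1)[OF \<pi> alt_form_flat[OF \<Omega>]] endo_tangent[OF N]
  show "deformed_endo A \<pi> N \<Omega> p v \<in> tangent p"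
    using tangent_comb[of "N p v" p "sharp A \<pi> p (flat \<Omega> p v)" 1 1] v by (simp add: deformed_endo_def)
  fix w and a b :: real assume w: "w \<in> tangent p"
  show "deformed_endo A \<pi> N \<Omega> p (\<lambda>f. a * v f + b * w f) =
      (\<lambda>f. a * deformed_endo A \<pi> N \<Omega> p v f + b * deformed_endo A \<pi> N \<Omega> p w f)"
    using v w by (simp add: deformed_endo_def endo_fieldD(2)[OF N] flat_comb[OF \<Omega>]
        sharp_comb[OF \<pi> alt_form_flat[OF \<Omega>] alt_form_flat[OF \<Omega>]] algebra_simps)
next
  fix p v assume v: "v \<notin> tangent p"
  have "flat \<Omega> p v = (\<lambda>ws. 0)"
    unfolding flat_def by (rule ext, rule alt_form_outside[OF diff_form_alt[OF \<Omega>]]) (use v in simp)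
  then show "deformed_endo A \<pi> N \<Omega> p v = (\<lambda>f. 0)"
    using v by (simp add: deformed_endo_def endo_fieldD(3)[OF N] sharp_zero[OF \<pi>])
next
  fix X assume X: "vfield X"
  have "vfield (apply_endo (deformed_endo A \<pi> N \<Omega>) X)"
    unfolding apply_deformed_endo using \<pi> N \<Omega> X by simp
  then show "vfield (\<lambda>p. deformed_endo A \<pi> N \<Omega> p (X p))" by (simp add: apply_endo_def)
qed

lemma endo_field_zero: "endo_field A (\<lambda>p v f. 0)"
  by (simp add: endo_field_def)

lemma poisson_bracket_eq:
  assumes "bivector_field A \<pi>" "smooth f" "smooth g"
  shows "poisson_bracket A \<pi> f g = act (sharp_field A \<pi> (df f)) g"
  using eval_sharp[OF assms(1) diff_form_ext_d0[OF assms(2)] diff_form_ext_d0[OF assms(3)]] assms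
  by (simp add: poisson_bracket_def)

lemma bracket1_swap:
  assumes "bivector_field A \<pi>" "form 1 \<alpha>" "form 1 \<beta>" "vfield Z"
  shows "ev (bracket1 A \<pi> \<beta> \<alpha>) [Z] p = - ev (bracket1 A \<pi> \<alpha> \<beta>) [Z] p"
  using assms eval_sharp_swap[OF assms(1,2,3)] by (simp add: eval_bracket1)

text \<open>The defect \<open>K\<close>, tested on a function f, is linear over functions in
  \<alpha> and, by skew symmetry, also in \<beta>. It therefore suffices to take both forms exact,
  where the statement is the Jacobi identity of the Poisson bracket.\<close>

theorem lie_bracket_sharp:
  assumes poisson: "poisson_bivector A \<pi>" and \<alpha>: "form 1 \<alpha>" and \<beta>: "form 1 \<beta>"
  shows "lie_bracket (sharp_field A \<pi> \<alpha>) (sharp_field A \<pi> \<beta>) = sharp_field A \<pi> (bracket1 A \<pi> \<alpha> \<beta>)"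
proof -
  have \<pi>: "bivector_field A \<pi>" using poisson by (simp add: poisson_bivector_def)
  let ?X = "sharp_field A \<pi>"
  \<comment> \<open>The plus sign is correct: pairing a 1-form with the sharp of df is minus the
    action on f of the sharp of that 1-form.\<close>
  define K where "K \<alpha> \<beta> f p = act (lie_bracket (?X \<alpha>) (?X \<beta>)) f p +
      ev (bracket1 A \<pi> \<alpha> \<beta>) [?X (df f)] p" for \<alpha> \<beta> f p
  have K_swap: "K \<beta> \<alpha> f p = - K \<alpha> \<beta> f p"
    if "form 1 \<alpha>" "form 1 \<beta>" "smooth f" for \<alpha> \<beta> f p
    using bracket1_swap[OF \<pi> that(1,2), of "?X (df f)" p] \<pi> that
    by (simp add: K_def act_lie_bracket)
  have K_lin: "K (\<lambda>q vs. g q * \<alpha> q vs + h q * \<alpha>' q vs) \<beta> f p = g p * K \<alpha> \<beta> f p + h p * K \<alpha>' \<beta> f p"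
    if "smooth g" "smooth h" "form 1 \<alpha>" "form 1 \<alpha>'" "form 1 \<beta>"
      "smooth f" for g h \<alpha> \<alpha>' \<beta> f p
  proof -
    have "ev \<gamma> [?X (df f)] = (\<lambda>p. - act (?X \<gamma>) f p)" if "form 1 \<gamma>" for \<gamma>
      using eval_sharp_swap[OF \<pi> diff_form_ext_d0[OF \<open>smooth f\<close>] that] \<pi> that
        \<open>smooth f\<close> by simp
    note this[OF that(3)] this[OF that(4)]
    then show ?thesis
      using that \<pi> unfolding K_def
      by (simp add: sharp_field_comb lie_bracket_vcomb eval_bracket1 diff_form_comb algebra_simps)
  qed
  have K_exact: "K (df g) (df h) f p = 0"
    if g: "smooth g" and h: "smooth h" and f: "smooth f" for g h f p
  proof -
    have sw: "act (?X (df u)) v = (\<lambda>p. - act (?X (df v)) u p)" if "smooth u" "smooth v" for u v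
      using eval_sharp_swap[OF \<pi> diff_form_ext_d0[OF that(1)] diff_form_ext_d0[OF that(2)]] \<pi> that by simp
    have "act (?X (df g)) (act (?X (df h)) f) p + act (?X (df h)) (act (?X (df f)) g) p +
        act (?X (df f)) (act (?X (df g)) h) p = 0"
      using poisson g h f \<pi> unfolding poisson_bivector_def
      by (metis (no_types, lifting) poisson_bracket_eq smooth_fun_act vector_field_sharp diff_form_ext_d0)
    then show ?thesis
      using sw[OF f g] sw[OF h g] \<pi> g h f by (simp add: K_def act_lie_bracket eval_bracket1)
  qed
  have K1: "K \<alpha> (df h) f p = 0" if "form 1 \<alpha>" "smooth h" "smooth f" for \<alpha> h f p
    by (rule one_form_functional_eq_0[of "\<lambda>\<alpha>. K \<alpha> (df h) f p" p]) (use that K_lin K_exact in auto)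
  have K0: "K \<alpha> \<beta> f p = 0" if "smooth f" for f p
  proof (rule one_form_functional_eq_0[of "\<lambda>\<alpha>. K \<alpha> \<beta> f p" p, OF _ _ \<alpha>])
    show "K (df h) \<beta> f p = 0" if h: "smooth h" for h
      using K_swap[OF \<beta> diff_form_ext_d0[OF h] \<open>smooth f\<close>] K1[OF \<beta> h \<open>smooth f\<close>] by simp
  qed (use that K_lin \<beta> in auto)
  show ?thesis
  proof (rule vector_field_eqI)
    fix f p assume f: "smooth f"
    have "ev (bracket1 A \<pi> \<alpha> \<beta>) [?X (df f)] p = - act (?X (bracket1 A \<pi> \<alpha> \<beta>)) f p"
      using eval_sharp_swap[OF \<pi> diff_form_ext_d0[OF f] diff_form_bracket1[OF \<pi> \<alpha> \<beta>]] \<pi> \<alpha> \<beta> f by simp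
    then show "act (lie_bracket (?X \<alpha>) (?X \<beta>)) f p = act (?X (bracket1 A \<pi> \<alpha> \<beta>)) f p"
      using K0[OF f, of p] by (simp add: K_def)
  qed (use \<pi> \<alpha> \<beta> in simp_all)
qed

lemma eval_lie_bracket_sharp:
  assumes "poisson_bivector A \<pi>" "form 1 \<alpha>" "form 1 \<beta>" "form 1 \<gamma>"
  shows "ev \<gamma> [lie_bracket (sharp_field A \<pi> \<alpha>) (sharp_field A \<pi> \<beta>)] =
    (\<lambda>p. - ev (bracket1 A \<pi> \<alpha> \<beta>) [sharp_field A \<pi> \<gamma>] p)"
proof -
  have \<pi>: "bivector_field A \<pi>" using assms(1) by (simp add: poisson_bivector_def)
  show ?thesis
    unfolding lie_bracket_sharp[OF assms(1-3)]
    by (rule eval_sharp_swap[OF \<pi> diff_form_bracket1[OF \<pi> assms(2,3)] assms(4)])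
qed

definition commutes_sharp :: "'m bivec \<Rightarrow> 'm endo \<Rightarrow> bool" where
  "commutes_sharp \<pi> N \<longleftrightarrow>
    (\<forall>p. \<forall>\<alpha>\<in>alt_forms A p 1. N p (sharp A \<pi> p \<alpha>) = sharp A \<pi> p (transpose_endo N p \<alpha>))"

lemma apply_endo_sharp:
  "commutes_sharp \<pi> N \<Longrightarrow> form 1 \<alpha> \<Longrightarrow>
    apply_endo N (sharp_field A \<pi> \<alpha>) = sharp_field A \<pi> (transpose_form N \<alpha>)"
  by (simp add: commutes_sharp_def apply_endo_def sharp_field_def transpose_form_def diff_form_alt)

text \<open>Commuting with sharp means that \<beta>(N sharp \<alpha>) is skew in \<alpha> and
  \<beta>. Global forms suffice for the test, since every covector extends to one by freezing its
  coefficients in \<open>covector_expansion\<close>.\<close>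

lemma commutes_sharpI:
  assumes \<pi>: "bivector_field A \<pi>" and N: "endo_field A N"
    and *: "\<And>\<alpha> \<beta> p. form 1 \<alpha> \<Longrightarrow> form 1 \<beta> \<Longrightarrow>
      ev \<beta> [apply_endo N (sharp_field A \<pi> \<alpha>)] p = - ev \<alpha> [apply_endo N (sharp_field A \<pi> \<beta>)] p"
  shows "commutes_sharp \<pi> N"
  unfolding commutes_sharp_def
proof (intro allI ballI)
  have ex: "\<exists>\<alpha>'. form 1 \<alpha>' \<and> \<alpha>' p = \<alpha>" if \<alpha>: "\<alpha> \<in> alt_forms A p 1" for \<alpha> p
  proof -
    obtain \<theta> I x E where wf: "weighted_frame \<theta> I x E" and p: "\<theta> p \<noteq> 0"
      using ex_weighted_frame by blast
    note fr = weighted_frameD[OF wf]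
    let ?c = "\<lambda>i. \<alpha> [E i p] / \<theta> p"
    have "form 1 (\<lambda>q vs. \<Sum>i\<in>J. ?c i * df (x i) q vs)" if "finite J" for J
      using that
    proof (induction J rule: finite_induct)
      case (insert i J)
      then show ?case
        using diff_form_comb[OF smooth_fun_const[of "?c i"] diff_form_ext_d0[OF fr(3)[of i]]
            smooth_fun_const[of 1] insert.IH] by simp
    qed simp
    moreover have "(\<Sum>i\<in>I. ?c i * df (x i) p vs) = \<alpha> vs" for vs
      using fun_cong[OF covector_expansion[OF wf \<alpha>], of vs] p
      by (simp add: field_simps flip: sum_divide_distrib)
    ultimately show ?thesis using fr(1)
      by (intro exI[of _ "\<lambda>q vs. \<Sum>i\<in>I. ?c i * df (x i) q vs"] conjI) auto
  qed
  fix p \<alpha> assume "\<alpha> \<in> alt_forms A p 1"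
  then obtain \<alpha>' where \<alpha>': "form 1 \<alpha>'" "\<alpha>' p = \<alpha>" using ex by blast
  have "sharp A \<pi> p (transpose_endo N p (\<alpha>' p)) = N p (sharp A \<pi> p (\<alpha>' p))"
  proof (rule sharp_eqI[OF endo_tangent[OF N]])
    fix \<beta> assume "\<beta> \<in> alt_forms A p 1"
    then obtain \<beta>' where \<beta>': "form 1 \<beta>'" "\<beta>' p = \<beta>" using ex by blast
    have "- ev \<alpha>' [apply_endo N (sharp_field A \<pi> \<beta>')] p =
        ev \<beta>' [sharp_field A \<pi> (transpose_form N \<alpha>')] p"
      using eval_sharp_swap[OF \<pi> diff_form_transpose[OF N \<alpha>'(1)] \<beta>'(1)] by simp
    also have "\<dots> = \<pi> p (transpose_endo N p (\<alpha>' p)) \<beta>"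
      using eval_sharp[OF \<pi> diff_form_transpose[OF N \<alpha>'(1)] \<beta>'(1)] \<beta>'(2) by (simp add: transpose_form_def)
    finally show "\<beta> [N p (sharp A \<pi> p (\<alpha>' p))] = \<pi> p (transpose_endo N p (\<alpha>' p)) \<beta>"
      using *[OF \<alpha>'(1) \<beta>'(1), of p] \<beta>'(2) by (simp add: eval_form_def apply_endo_def sharp_field_def)
  qed
  then show "N p (sharp A \<pi> p \<alpha>) = sharp A \<pi> p (transpose_endo N p \<alpha>)" using \<alpha>'(2) by simp
qed

lemma commutes_sharp_swap:
  assumes "bivector_field A \<pi>" "endo_field A N" "commutes_sharp \<pi> N" "form 1 \<alpha>" "form 1 \<beta>"
  shows "ev \<beta> [apply_endo N (sharp_field A \<pi> \<alpha>)] =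
    (\<lambda>p. - ev \<alpha> [apply_endo N (sharp_field A \<pi> \<beta>)] p)"
  using eval_sharp_swap[OF assms(1) diff_form_transpose[OF assms(2,4)] assms(5)] assms
  by (simp add: apply_endo_sharp)

lemma bivec_endo:
  assumes \<pi>: "bivector_field A \<pi>" and N: "endo_field A N" and c: "commutes_sharp \<pi> N"
  shows "bivector_field A (bivec_endo A \<pi> N)"
    and "sharp_field A (bivec_endo A \<pi> N) \<alpha> = apply_endo N (sharp_field A \<pi> \<alpha>)"
proof -
  have t: "sharp A \<pi> p \<alpha> \<in> tangent p" if "\<alpha> \<in> alt_forms A p 1" for \<alpha> p
    by (rule sharp(1)[OF \<pi> that])
  have b: "bivec_endo A \<pi> N p \<alpha> \<beta> = \<pi> p (transpose_endo N p \<alpha>) \<beta>"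
    if "\<alpha> \<in> alt_forms A p 1" "\<beta> \<in> alt_forms A p 1" for \<alpha> \<beta> p
    using c that sharp(2)[OF \<pi> alt_form_transpose[OF N]] by (simp add: bivec_endo_def commutes_sharp_def)
  show "bivector_field A (bivec_endo A \<pi> N)"
    unfolding bivector_field_def
  proof (intro conjI allI ballI impI)
    fix p \<alpha> \<beta> assume ab: "\<alpha> \<in> alt_forms A p 1" "\<beta> \<in> alt_forms A p 1"
    have "bivec_endo A \<pi> N p \<alpha> \<beta> = transpose_endo N p \<beta> [sharp A \<pi> p \<alpha>]"
      by (simp add: bivec_endo_def transpose_endo_def)
    also have "\<dots> = \<pi> p \<alpha> (transpose_endo N p \<beta>)"
      using sharp(2)[OF \<pi> ab(1) alt_form_transpose[OF N ab(2)]] .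
    also have "\<dots> = - bivec_endo A \<pi> N p \<beta> \<alpha>"
      using b[OF ab(2,1)] bivector_swap[OF \<pi> ab(1) alt_form_transpose[OF N ab(2)]] by simp
    finally show "bivec_endo A \<pi> N p \<alpha> \<beta> = - bivec_endo A \<pi> N p \<beta> \<alpha>" .
    fix \<gamma> and a b :: real assume "\<gamma> \<in> alt_forms A p 1"
    then show "bivec_endo A \<pi> N p (\<lambda>vs. a * \<alpha> vs + b * \<beta> vs) \<gamma> =
        a * bivec_endo A \<pi> N p \<alpha> \<gamma> + b * bivec_endo A \<pi> N p \<beta> \<gamma>"
      using ab t by (simp add: bivec_endo_def sharp_comb[OF \<pi>] endo_fieldD(2)[OF N]
          alt_form1_linear endo_tangent[OF N])
  next
    fix \<alpha> \<beta> assume ab: "form 1 \<alpha>" "form 1 \<beta>"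
    then have "smooth (ev \<beta> [apply_endo N (sharp_field A \<pi> \<alpha>)])"
      using N \<pi> by simp
    then show "smooth (\<lambda>p. bivec_endo A \<pi> N p (\<alpha> p) (\<beta> p))"
      by (simp add: eval_form_def bivec_endo_def apply_endo_def sharp_field_def)
  qed
  show "sharp_field A (bivec_endo A \<pi> N) \<alpha> = apply_endo N (sharp_field A \<pi> \<alpha>)"
    unfolding sharp_field_def apply_endo_def
    by (rule ext, rule sharp_eqI[OF endo_tangent[OF N]]) (simp add: bivec_endo_def)
qed

text \<open>Both sides of the bracket condition are 1-forms, compared on a field X. After
  \<open>eval_bracket1\<close>, skew symmetry of the pairings and commutation with sharp make the
  two equations linear rearrangements of one another. The bivector \<pi>_N, and with it the bracket
  it defines, drops out.\<close>

lemma compatible_iff: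
  assumes \<pi>: "bivector_field A \<pi>" and N: "endo_field A N"
  shows "compatible A \<pi> N \<longleftrightarrow> commutes_sharp \<pi> N \<and>
    (\<forall>\<alpha> \<beta> X. form 1 \<alpha> \<longrightarrow> form 1 \<beta> \<longrightarrow> vfield X \<longrightarrow>
      (\<lambda>p. ev \<beta> [lie_bracket (sharp_field A \<pi> \<alpha>) (apply_endo N X)] p -
        ev \<beta> [apply_endo N (lie_bracket (sharp_field A \<pi> \<alpha>) X)] p) =
      (\<lambda>p. d1 (transpose_form N \<alpha>) (sharp_field A \<pi> \<beta>) X p - d1 \<alpha> (sharp_field A \<pi> \<beta>) (apply_endo N X) p))"
proof (cases "commutes_sharp \<pi> N")
  case False
  then show ?thesis by (auto simp: compatible_def commutes_sharp_def)
next
  case c: True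
  let ?r = "\<lambda>\<alpha> \<beta> p vs. bracket1 A \<pi> (transpose_form N \<alpha>) \<beta> p vs +
      bracket1 A \<pi> \<alpha> (transpose_form N \<beta>) p vs - transpose_form N (bracket1 A \<pi> \<alpha> \<beta>) p vs"
  have main: "bracket1 A (bivec_endo A \<pi> N) \<alpha> \<beta> = ?r \<alpha> \<beta> \<longleftrightarrow>
      (\<forall>X. vfield X \<longrightarrow>
      (\<lambda>p. ev \<beta> [lie_bracket (sharp_field A \<pi> \<alpha>) (apply_endo N X)] p -
        ev \<beta> [apply_endo N (lie_bracket (sharp_field A \<pi> \<alpha>) X)] p) =
      (\<lambda>p. d1 (transpose_form N \<alpha>) (sharp_field A \<pi> \<beta>) X p - d1 \<alpha> (sharp_field A \<pi> \<beta>) (apply_endo N X) p))"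
    if ab: "form 1 \<alpha>" "form 1 \<beta>" for \<alpha> \<beta>
  proof -
    have r: "form 1 (?r \<alpha> \<beta>)"
      using ab \<pi> N by (intro diff_form_diff diff_form_add) auto
    have l: "form 1 (bracket1 A (bivec_endo A \<pi> N) \<alpha> \<beta>)"
      using ab bivec_endo(1)[OF \<pi> N c] by simp
    have er: "ev (?r \<alpha> \<beta>) [X] p = ev (bracket1 A \<pi> (transpose_form N \<alpha>) \<beta>) [X] p +
        ev (bracket1 A \<pi> \<alpha> (transpose_form N \<beta>)) [X] p -
        ev (transpose_form N (bracket1 A \<pi> \<alpha> \<beta>)) [X] p" for X p
      by (simp add: eval_form_def)
    have "bracket1 A (bivec_endo A \<pi> N) \<alpha> \<beta> = ?r \<alpha> \<beta> \<longleftrightarrow> (\<forall>X p. vfield X \<longrightarrow>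
        ev (bracket1 A (bivec_endo A \<pi> N) \<alpha> \<beta>) [X] p = ev (?r \<alpha> \<beta>) [X] p)"
      by (auto intro!: form_eqI[OF l r] simp: length_numeral_cases)
    also have "\<dots> \<longleftrightarrow> (\<forall>X p. vfield X \<longrightarrow>
      ev \<beta> [lie_bracket (sharp_field A \<pi> \<alpha>) (apply_endo N X)] p -
        ev \<beta> [apply_endo N (lie_bracket (sharp_field A \<pi> \<alpha>) X)] p =
      d1 (transpose_form N \<alpha>) (sharp_field A \<pi> \<beta>) X p - d1 \<alpha> (sharp_field A \<pi> \<beta>) (apply_endo N X) p)"
    proof (intro all_cong1 imp_cong refl)
      fix X p assume X: "vfield X"
      note ns = apply_endo_sharp[OF c ab(1)] apply_endo_sharp[OF c ab(2)]
      note sw = eval_sharp_swap[OF \<pi> ab] eval_sharp_swap[OF \<pi> diff_form_transpose[OF N ab(1)] ab(2)]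
        commutes_sharp_swap[OF \<pi> N c ab]
      show "ev (bracket1 A (bivec_endo A \<pi> N) \<alpha> \<beta>) [X] p = ev (?r \<alpha> \<beta>) [X] p \<longleftrightarrow>
        ev \<beta> [lie_bracket (sharp_field A \<pi> \<alpha>) (apply_endo N X)] p -
          ev \<beta> [apply_endo N (lie_bracket (sharp_field A \<pi> \<alpha>) X)] p =
        d1 (transpose_form N \<alpha>) (sharp_field A \<pi> \<beta>) X p - d1 \<alpha> (sharp_field A \<pi> \<beta>) (apply_endo N X) p"
        unfolding er using ab \<pi> N X bivec_endo(1)[OF \<pi> N c] sw ns
        by (simp add: eval_bracket1 bivec_endo(2)[OF \<pi> N c] d1_def) linarith
    qed
    finally show ?thesis by (simp add: fun_eq_iff)
  qed
  show ?thesis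
    using c main unfolding compatible_def commutes_sharp_def[symmetric] by (auto simp del: One_nat_def)
qed

end

section \<open>Evaluation of forms on torsion, and d d = 0\<close>

context smooth_manifold
begin

lemma torsion_vcomb:
  "bracket_endo N X Y = vcomb (\<lambda>_. 1) (vcomb (\<lambda>_. 1) (lie_bracket (apply_endo N X) Y) (\<lambda>_. 1)
      (lie_bracket X (apply_endo N Y))) (\<lambda>_. -1) (apply_endo N (lie_bracket X Y))"
  "torsion N X Y = vcomb (\<lambda>_. 1) (lie_bracket (apply_endo N X) (apply_endo N Y)) (\<lambda>_. -1)
      (apply_endo N (bracket_endo N X Y))"
  by (simp_all add: bracket_endo_def torsion_def vcomb_def)

lemma lie_bracket_vadd:
  assumes "vfield X" "vfield X'" "vfield Y"
  shows "lie_bracket (vcomb (\<lambda>_. 1) X (\<lambda>_. 1) X') Y = vcomb (\<lambda>_. 1) (lie_bracket X Y) (\<lambda>_. 1) (lie_bracket X' Y)"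
    "lie_bracket Y (vcomb (\<lambda>_. 1) X (\<lambda>_. 1) X') = vcomb (\<lambda>_. 1) (lie_bracket Y X) (\<lambda>_. 1) (lie_bracket Y X')"
  by (rule vector_field_eqI; use assms in \<open>simp add: act_lie_bracket\<close>)+

lemma eval1_torsion:
  assumes "endo_field A N" "form 1 \<beta>" "vfield X" "vfield Y"
  shows "ev \<beta> [torsion N X Y] = (\<lambda>p. ev \<beta> [lie_bracket (apply_endo N X) (apply_endo N Y)] p -
    ev \<beta> [apply_endo N (lie_bracket (apply_endo N X) Y)] p -
    ev \<beta> [apply_endo N (lie_bracket X (apply_endo N Y))] p +
    ev \<beta> [apply_endo N (apply_endo N (lie_bracket X Y))] p)"
  using assms by (simp add: torsion_vcomb algebra_simps)

lemma eval2_torsion: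
  assumes "endo_field A N" "form 2 \<Omega>" "vfield X" "vfield Y" "vfield Z"
  shows "ev \<Omega> [torsion N X Y, Z] = (\<lambda>p. ev \<Omega> [lie_bracket (apply_endo N X) (apply_endo N Y), Z] p -
    ev \<Omega> [apply_endo N (lie_bracket (apply_endo N X) Y), Z] p -
    ev \<Omega> [apply_endo N (lie_bracket X (apply_endo N Y)), Z] p +
    ev \<Omega> [apply_endo N (apply_endo N (lie_bracket X Y)), Z] p)"
  using assms by (simp add: torsion_vcomb algebra_simps)

lemma eval_bracket_swap1:
  "form 1 \<alpha> \<Longrightarrow> vfield X \<Longrightarrow> vfield Y \<Longrightarrow>
    ev \<alpha> [lie_bracket Y X] = (\<lambda>p. - ev \<alpha> [lie_bracket X Y] p)"
  by (simp add: lie_bracket_swap[of Y X])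

lemma eval_bracket_swap2:
  assumes "form 2 \<Omega>" "vfield X" "vfield Y" "vfield Z"
  shows "ev \<Omega> [Z, lie_bracket Y X] = ev \<Omega> [lie_bracket X Y, Z]"
    and "endo_field A N \<Longrightarrow> ev \<Omega> [Z, apply_endo N (lie_bracket Y X)] =
      ev \<Omega> [apply_endo N (lie_bracket X Y), Z]"
  using form2_swap[OF assms(1), of "lie_bracket X Y" Z]
    form2_swap[OF assms(1), of "apply_endo N (lie_bracket X Y)" Z] assms
  by (simp_all add: lie_bracket_swap[of Y X])

lemma eval_bracket_jacobi:
  assumes "form 2 \<omega>" "vfield X" "vfield Y" "vfield Z" "vfield W"
  shows "ev \<omega> [lie_bracket (lie_bracket Y Z) X, W] p =
    ev \<omega> [lie_bracket (lie_bracket X Z) Y, W] p - ev \<omega> [lie_bracket (lie_bracket X Y) Z, W] p"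
proof -
  have "lie_bracket (lie_bracket Y Z) X =
      vcomb (\<lambda>_. 1) (lie_bracket (lie_bracket X Z) Y) (\<lambda>_. -1) (lie_bracket (lie_bracket X Y) Z)"
    by (rule vector_field_eqI) (use assms in \<open>simp_all add: act_lie_bracket\<close>)
  then show ?thesis using assms by simp
qed

text \<open>Second derivatives cancel by the definition of the bracket, double brackets by one
  Jacobi identity for each choice of the field left out, and values on two brackets by skew
  symmetry.\<close>

lemma d3_ext_d2:
  assumes \<omega>: "form 2 \<omega>"
    and v: "vfield X" "vfield Y" "vfield Z" "vfield W"
  shows "d3 (ext_d A 2 \<omega>) X Y Z W p = 0"
proof -
  note j = eval_bracket_jacobi[OF \<omega> v(1,2,3,4)] eval_bracket_jacobi[OF \<omega> v(1,2,4,3)]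
    eval_bracket_jacobi[OF \<omega> v(1,3,4,2)] eval_bracket_jacobi[OF \<omega> v(2,3,4,1)]
  have s: "ev \<omega> [lie_bracket Z W, lie_bracket X Y] p = - ev \<omega> [lie_bracket X Y, lie_bracket Z W] p"
    "ev \<omega> [lie_bracket Y W, lie_bracket X Z] p = - ev \<omega> [lie_bracket X Z, lie_bracket Y W] p"
    "ev \<omega> [lie_bracket Y Z, lie_bracket X W] p = - ev \<omega> [lie_bracket X W, lie_bracket Y Z] p"
    using form2_swap[OF \<omega>, of "lie_bracket X Y" "lie_bracket Z W"]
      form2_swap[OF \<omega>, of "lie_bracket X Z" "lie_bracket Y W"]
      form2_swap[OF \<omega>, of "lie_bracket X W" "lie_bracket Y Z"] v by simp_all
  show ?thesis
    using \<omega> v by (simp add: d3_def ext_d2(2)) (simp add: d2_def act_lie_bracket j s)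
qed

lemma compatible_swap:
  assumes "bivector_field A \<pi>" "endo_field A N" "compatible A \<pi> N"
    "form 1 \<alpha>" "form 1 \<beta>" "vfield X"
  shows "ev \<beta> [lie_bracket (sharp_field A \<pi> \<alpha>) (apply_endo N X)] p =
      ev \<beta> [apply_endo N (lie_bracket (sharp_field A \<pi> \<alpha>) X)] p +
      d1 (transpose_form N \<alpha>) (sharp_field A \<pi> \<beta>) X p - d1 \<alpha> (sharp_field A \<pi> \<beta>) (apply_endo N X) p"
proof -
  have "(\<lambda>p. ev \<beta> [lie_bracket (sharp_field A \<pi> \<alpha>) (apply_endo N X)] p -
        ev \<beta> [apply_endo N (lie_bracket (sharp_field A \<pi> \<alpha>) X)] p) =
      (\<lambda>p. d1 (transpose_form N \<alpha>) (sharp_field A \<pi> \<beta>) X p - d1 \<alpha> (sharp_field A \<pi> \<beta>) (apply_endo N X) p)"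
    using assms compatible_iff[OF assms(1,2)] by blast
  from fun_cong[OF this, of p] show ?thesis by simp
qed

end

section \<open>Deformation by a closed 2-form\<close>

locale poisson_closed_form = smooth_manifold A
  for A :: "('m::{t2_space,second_countable_topology}, 'e::euclidean_space) atlas" +
  fixes \<pi> :: "'m bivec" and \<Omega> :: "'m dform"
  assumes poisson: "poisson_bivector A \<pi>" and \<Omega> [simp]: "diff_form A 2 \<Omega>" and closed: "closed_form A 2 \<Omega>"
begin

lemma \<pi> [simp]: "bivector_field A \<pi>"
  using poisson by (simp add: poisson_bivector_def)

lemma d2_closed: "vfield X \<Longrightarrow> vfield Y \<Longrightarrow> vfield Z \<Longrightarrow> d2 \<Omega> X Y Z p = 0"
  using closed closed_form2_iff[OF \<Omega>] by simp

abbreviation sh :: "'m dform \<Rightarrow> 'm vfield" where "sh \<equiv> sharp_field A \<pi>"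

text \<open>Written as the deformation of the zero endomorphism, so that
  \<open>endo_field_deformed\<close> applies to it.\<close>

definition P :: "'m endo" where "P = deformed_endo A \<pi> (\<lambda>p v f. 0) \<Omega>"

lemma endo_P [simp]: "endo_field A P"
  unfolding P_def by (rule endo_field_deformed[OF \<pi> endo_field_zero \<Omega>])

lemma apply_P: "apply_endo P X = sh (contr X \<Omega>)"
  by (simp add: P_def apply_endo_def deformed_endo_def sharp_field_def contr_def flat_def)

lemma eval_P: "form 1 \<beta> \<Longrightarrow> vfield X \<Longrightarrow>
    ev \<beta> [apply_endo P X] = (\<lambda>p. - ev \<Omega> [X, sh \<beta>] p)"
  unfolding apply_P using eval_sharp_swap[OF \<pi>, of "contr X \<Omega>" \<beta>] by simp

text \<open>Both sides equal - \<pi>(i_X \<Omega>, i_Y \<Omega>). Consequently i_P \<Omega> is twice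
  \<Omega>(P X, Y), which accounts for the factor 2 in \<open>eval_torsion_P\<close>.\<close>

lemma eval_P2: "vfield X \<Longrightarrow> vfield Y \<Longrightarrow>
    ev \<Omega> [apply_endo P X, Y] = ev \<Omega> [X, apply_endo P Y]"
  using eval_P[of "contr Y \<Omega>" X] form2_swap[OF \<Omega>, of "apply_endo P X" Y]
  by (simp add: fun_eq_iff flip: apply_P)

lemma eval_bracket_P:
  assumes "form 1 \<alpha>" "form 1 \<beta>" "vfield X"
  shows "ev \<beta> [lie_bracket (sh \<alpha>) (apply_endo P X)] =
    (\<lambda>p. - ev (bracket1 A \<pi> \<alpha> (contr X \<Omega>)) [sh \<beta>] p)"
  unfolding apply_P using assms by (simp add: eval_lie_bracket_sharp[OF poisson])

lemma commutes_sharp_P: "commutes_sharp \<pi> P"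
proof (rule commutes_sharpI)
  fix \<alpha> \<beta> p assume "form 1 \<alpha>" "form 1 \<beta>"
  then show "ev \<beta> [apply_endo P (sh \<alpha>)] p = - ev \<alpha> [apply_endo P (sh \<beta>)] p"
    using form2_swap[OF \<Omega>, of "sh \<alpha>" "sh \<beta>"] by (simp add: eval_P)
qed simp_all

text \<open>P X is the sharp of i_X \<Omega>, so the Poisson property turns
  \<beta>([sharp \<alpha>, P X]) into a bracket of 1-forms evaluated on sharp \<beta>. After
  expansion the two sides differ by a value of d\<Omega> on sharp \<alpha>, sharp \<beta> and
  X.\<close>

lemma compatible_P: "compatible A \<pi> P"
  unfolding compatible_iff[OF \<pi> endo_P]
proof (intro conjI allI impI ext commutes_sharp_P)
  fix \<alpha> \<beta> X p assume a: "form 1 \<alpha>" and b: "form 1 \<beta>" and X: "vfield X"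
  let ?a = "sh \<alpha>" and ?b = "sh \<beta>" and ?x = "apply_endo P X"
  have v: "vfield ?a" "vfield ?b" "vfield ?x" using a b X by simp_all
  have dp: "d1 (transpose_form P \<alpha>) ?b X p = act ?b (ev \<Omega> [?a, X]) p - act X (ev \<Omega> [?a, ?b]) p -
      ev \<Omega> [?a, lie_bracket ?b X] p"
    using a X v form2_swap[OF \<Omega>, of ?a] by (simp add: d1_def eval_P)
  have da: "d1 \<alpha> ?b ?x p = - act ?b (ev \<Omega> [X, ?a]) p - act ?x (ev \<alpha> [?b]) p -
      ev \<alpha> [lie_bracket ?b ?x] p"
    using a X v by (simp add: d1_def eval_P)
  have br: "ev (bracket1 A \<pi> \<alpha> (contr X \<Omega>)) [?b] p = act ?a (ev \<Omega> [X, ?b]) p -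
      ev \<Omega> [X, lie_bracket ?a ?b] p - act ?x (ev \<alpha> [?b]) p +
      ev \<alpha> [lie_bracket ?x ?b] p - act ?b (ev \<Omega> [X, ?a]) p"
    using a X v by (simp add: eval_bracket1 apply_P)
  show "ev \<beta> [lie_bracket ?a (apply_endo P X)] p - ev \<beta> [apply_endo P (lie_bracket ?a X)] p =
      d1 (transpose_form P \<alpha>) ?b X p - d1 \<alpha> ?b (apply_endo P X) p"
    using d2_closed[OF v(1,2) X, of p] a b X v eval_bracket_swap1[OF a v(3,2)]
      form2_swap[OF \<Omega> v(1) X] form2_swap[OF \<Omega> v(2) X]
      form2_swap[OF \<Omega>, of "lie_bracket ?b X" ?a] form2_swap[OF \<Omega>, of "lie_bracket ?a ?b" X]
    unfolding dp da by (simp add: eval_bracket_P br eval_P d2_def)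
qed

text \<open>[P X, P Y] is a bracket of two sharp fields and is expanded by the Poisson property. The
  rest is d\<Omega> = 0 on the three triples obtained from X, Y, sharp \<beta> by applying P to one
  entry.\<close>

lemma eval_torsion_P:
  assumes b: "form 1 \<beta>" and X: "vfield X" and Y: "vfield Y"
  shows "2 * ev \<beta> [torsion P X Y] p = d2 (ins_endo P \<Omega>) X Y (sh \<beta>) p"
proof -
  let ?b = "sh \<beta>" and ?x = "apply_endo P X" and ?y = "apply_endo P Y"
  have v: "vfield ?b" "vfield ?x" "vfield ?y" "vfield (apply_endo P ?b)" using b X Y by simp_all
  have br: "ev (bracket1 A \<pi> (contr X \<Omega>) (contr Y \<Omega>)) [?b] p = act ?x (ev \<Omega> [Y, ?b]) p -
      ev \<Omega> [Y, lie_bracket ?x ?b] p - act ?y (ev \<Omega> [X, ?b]) p +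
      ev \<Omega> [X, lie_bracket ?y ?b] p - act ?b (ev \<Omega> [Y, ?x]) p"
    using X Y v by (simp add: eval_bracket1 apply_P)
  have t1: "ev \<beta> [lie_bracket ?x ?y] p = - ev (bracket1 A \<pi> (contr X \<Omega>) (contr Y \<Omega>)) [?b] p"
    using eval_bracket_P[of "contr X \<Omega>" \<beta> Y] b X Y by (simp add: apply_P)
  have d: "d2 \<Omega> ?x Y ?b p = 0" "d2 \<Omega> X ?y ?b p = 0" "d2 \<Omega> X Y (apply_endo P ?b) p = 0"
    using X Y v by (simp_all add: d2_closed)
  show ?thesis
    using d b X Y v form2_swap[OF \<Omega>, of X Y] form2_swap[OF \<Omega>, of "lie_bracket ?x ?b" Y]
      form2_swap[OF \<Omega>, of "lie_bracket ?y ?b" X] form2_swap[OF \<Omega>, of X ?y] form2_swap[OF \<Omega>, of Y ?x]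
    by (simp add: eval1_torsion t1 br eval_P eval_P2 d2_def algebra_simps)
qed

text \<open>The left side is the part of the torsion of N + P that is linear in N and in P. The
  brackets of an N-field with a P-field are removed by compatibility with \<alpha> = i_X \<Omega>
  and \<alpha> = i_Y \<Omega>, whose sharps are P X and P Y. What remains is d\<Omega> = 0 with N
  applied to one entry of the triple.\<close>

lemma eval_torsion_cross:
  assumes N: "endo_field A N" and c: "compatible A \<pi> N"
    and b: "form 1 \<beta>" and X: "vfield X" and Y: "vfield Y"
  shows "ev \<beta> [lie_bracket (apply_endo N X) (apply_endo P Y)] p +
      ev \<beta> [lie_bracket (apply_endo P X) (apply_endo N Y)] p -
      ev \<beta> [apply_endo N (lie_bracket (apply_endo P X) Y)] p -
      ev \<beta> [apply_endo N (lie_bracket X (apply_endo P Y))] p +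
      ev \<beta> [apply_endo N (apply_endo P (lie_bracket X Y))] p -
      ev \<beta> [apply_endo P (lie_bracket (apply_endo N X) Y)] p -
      ev \<beta> [apply_endo P (lie_bracket X (apply_endo N Y))] p +
      ev \<beta> [apply_endo P (apply_endo N (lie_bracket X Y))] p =
    d2 (ins_endo N \<Omega>) X Y (sh \<beta>) p"
proof -
  let ?b = "sh \<beta>" and ?x = "apply_endo P X" and ?y = "apply_endo P Y"
    and ?nx = "apply_endo N X" and ?ny = "apply_endo N Y" and ?nb = "apply_endo N (sh \<beta>)"
  have v: "vfield ?b" "vfield ?x" "vfield ?y" "vfield ?nx"
    "vfield ?ny" "vfield ?nb" using b X Y N by simp_all
  have cs: "commutes_sharp \<pi> N" using c compatible_iff[OF \<pi> N] by blast
  have np: "ev \<beta> [apply_endo N (apply_endo P Z)] = (\<lambda>p. - ev \<Omega> [Z, ?nb] p)"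
    if "vfield Z" for Z
    unfolding apply_P using commutes_sharp_swap[OF \<pi> N cs, of "contr Z \<Omega>" \<beta>] that b by simp
  have 1: "ev \<beta> [lie_bracket ?y ?nx] p = ev \<beta> [apply_endo N (lie_bracket ?y X)] p +
      d1 (transpose_form N (contr Y \<Omega>)) ?b X p - d1 (contr Y \<Omega>) ?b ?nx p"
    using compatible_swap[OF \<pi> N c, of "contr Y \<Omega>" \<beta> X p] X Y b by (simp add: apply_P)
  have 2: "ev \<beta> [lie_bracket ?x ?ny] p = ev \<beta> [apply_endo N (lie_bracket ?x Y)] p +
      d1 (transpose_form N (contr X \<Omega>)) ?b Y p - d1 (contr X \<Omega>) ?b ?ny p"
    using compatible_swap[OF \<pi> N c, of "contr X \<Omega>" \<beta> Y p] X Y b by (simp add: apply_P)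
  have 3: "ev \<beta> [lie_bracket ?nx ?y] p = - ev \<beta> [lie_bracket ?y ?nx] p"
    using eval_bracket_swap1[OF b v(3,4)] by simp
  have 4: "ev \<beta> [apply_endo N (lie_bracket X ?y)] p = - ev \<beta> [apply_endo N (lie_bracket ?y X)] p"
    using eval_bracket_swap1[OF diff_form_transpose[OF N b] v(3) X] by simp
  have d: "d2 \<Omega> ?nx Y ?b p = 0" "d2 \<Omega> X ?ny ?b p = 0" "d2 \<Omega> X Y ?nb p = 0"
    using X Y v by (simp_all add: d2_closed)
  show ?thesis
    using d b X Y v N eval_bracket_swap2(1)[OF \<Omega> v(5,1) X] eval_bracket_swap2(1)[OF \<Omega> v(4,1) Y]
      eval_bracket_swap2(2)[OF \<Omega> X v(1) Y N] eval_bracket_swap2(2)[OF \<Omega> Y v(1) X N]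
    by (simp add: 1 2 3 4 np eval_P d2_def d1_def algebra_simps)
qed

lemma apply_deformed: "apply_endo (deformed_endo A \<pi> N \<Omega>) X =
    vcomb (\<lambda>_. 1) (apply_endo N X) (\<lambda>_. 1) (apply_endo P X)"
  by (simp add: apply_deformed_endo apply_P)

text \<open>Torsion is quadratic in the endomorphism, so it splits into the two pure parts and the
  cross part.\<close>

lemma eval_torsion_deformed:
  assumes N: "endo_field A N" and c: "compatible A \<pi> N"
    and b: "form 1 \<beta>" and X: "vfield X" and Y: "vfield Y"
  shows "ev \<beta> [torsion (deformed_endo A \<pi> N \<Omega>) X Y] p = ev \<beta> [torsion N X Y] p +
    d2 (ins_endo N \<Omega>) X Y (sh \<beta>) p + 1/2 * d2 (ins_endo P \<Omega>) X Y (sh \<beta>) p"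
proof -
  let ?M = "deformed_endo A \<pi> N \<Omega>"
  have M: "endo_field A ?M" by (rule endo_field_deformed[OF \<pi> N \<Omega>])
  show ?thesis
    using eval_torsion_P[OF b X Y, of p] eval_torsion_cross[OF N c b X Y, of p] N b X Y
    by (simp add: eval1_torsion M apply_deformed lie_bracket_vadd)
qed

lemma commutes_sharp_deformed:
  assumes N: "endo_field A N" and c: "commutes_sharp \<pi> N"
  shows "commutes_sharp \<pi> (deformed_endo A \<pi> N \<Omega>)"
proof (rule commutes_sharpI)
  fix \<alpha> \<beta> p assume a: "form 1 \<alpha>" "form 1 \<beta>"
  show "ev \<beta> [apply_endo (deformed_endo A \<pi> N \<Omega>) (sh \<alpha>)] p =
      - ev \<alpha> [apply_endo (deformed_endo A \<pi> N \<Omega>) (sh \<beta>)] p"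
    using a N commutes_sharp_swap[OF \<pi> N c a] commutes_sharp_swap[OF \<pi> endo_P commutes_sharp_P a]
    by (simp add: apply_deformed)
qed (use endo_field_deformed[OF \<pi> N \<Omega>] in simp_all)

lemma compatible_deformed:
  assumes N: "endo_field A N" and c: "compatible A \<pi> N"
  shows "compatible A \<pi> (deformed_endo A \<pi> N \<Omega>)"
proof -
  let ?M = "deformed_endo A \<pi> N \<Omega>"
  have M: "endo_field A ?M" by (rule endo_field_deformed[OF \<pi> N \<Omega>])
  have cs: "commutes_sharp \<pi> N" using c compatible_iff[OF \<pi> N] by blast
  show ?thesis
    unfolding compatible_iff[OF \<pi> M]
  proof (intro conjI allI impI ext commutes_sharp_deformed[OF N cs])
    fix \<alpha> \<beta> X p assume a: "form 1 \<alpha>" and b: "form 1 \<beta>" and X: "vfield X"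
    show "ev \<beta> [lie_bracket (sh \<alpha>) (apply_endo ?M X)] p -
        ev \<beta> [apply_endo ?M (lie_bracket (sh \<alpha>) X)] p =
      d1 (transpose_form ?M \<alpha>) (sh \<beta>) X p - d1 \<alpha> (sh \<beta>) (apply_endo ?M X) p"
      using compatible_swap[OF \<pi> N c a b X, of p] compatible_swap[OF \<pi> endo_P compatible_P a b X, of p] N a b X
      by (simp add: apply_deformed lie_bracket_vadd d1_def)
  qed
qed

end

section \<open>A closed 2-form and an arbitrary endomorphism\<close>

context smooth_manifold
begin

lemma ex_pullback_form2:
  assumes K: "endo_field A K" and \<Omega>: "form 2 \<Omega>"
  shows "\<exists>\<eta>. form 2 \<eta> \<and> (\<forall>X Y. vfield X \<longrightarrow> vfield Y \<longrightarrow>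
      ev \<eta> [X, Y] = ev \<Omega> [apply_endo K X, apply_endo K Y])"
proof (rule tensorial_form2, goal_cases)
  case (3 X Y p)
  then show ?case using K form2_swap[OF \<Omega>, of "apply_endo K X" "apply_endo K Y"] by simp
qed (use K \<Omega> in simp_all)

lemma d3_cong:
  assumes "\<And>X Y Z. vfield X \<Longrightarrow> vfield Y \<Longrightarrow> vfield Z \<Longrightarrow>
      ev \<phi> [X, Y, Z] = ev \<psi> [X, Y, Z]"
    and "vfield X" "vfield Y" "vfield Z" "vfield W"
  shows "d3 \<phi> X Y Z W = d3 \<psi> X Y Z W"
  using assms by (simp add: d3_def)

lemma eval_form_add: "ev (\<lambda>p vs. \<omega> p vs + \<eta> p vs) Xs = (\<lambda>p. ev \<omega> Xs p + ev \<eta> Xs p)"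
  by (simp add: eval_form_def)

lemma eval_form_diff: "ev (\<lambda>p vs. \<omega> p vs - \<eta> p vs) Xs = (\<lambda>p. ev \<omega> Xs p - ev \<eta> Xs p)"
  by (simp add: eval_form_def)

lemma eval_form_scale: "ev (\<lambda>p vs. c * \<omega> p vs) Xs = (\<lambda>p. c * ev \<omega> Xs p)"
  by (simp add: eval_form_def)

lemma d3_add:
  assumes "form 3 \<phi>" "form 3 \<psi>"
    and "vfield X" "vfield Y" "vfield Z" "vfield W"
  shows "d3 (\<lambda>p vs. \<phi> p vs + \<psi> p vs) X Y Z W p = d3 \<phi> X Y Z W p + d3 \<psi> X Y Z W p"
  using assms by (simp add: d3_def eval_form_add)

text \<open>The 2-form \<open>i\<^sub>K i\<^sub>K \<Omega> - \<Omega>(K\<cdot>, K\<cdot>)\<close> is a primitive of the difference of \<open>i\<^sub>K d i\<^sub>K \<Omega>\<close> and \<open>i\<^sub>T \<Omega>\<close>.\<close>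

theorem d3_ins_endo_ext_d2_ins_endo:
  assumes \<Omega>: "form 2 \<Omega>" and closed: "closed_form A 2 \<Omega>" and K: "endo_field A K"
    and \<psi>: "form 3 \<psi>"
    and torsion: "\<And>X Y Z. vfield X \<Longrightarrow> vfield Y \<Longrightarrow> vfield Z \<Longrightarrow>
      ev \<psi> [X, Y, Z] = (\<lambda>p. ev \<Omega> [torsion K X Y, Z] p +
        ev \<Omega> [torsion K Y Z, X] p - ev \<Omega> [torsion K X Z, Y] p)"
    and v: "vfield X" "vfield Y" "vfield Z" "vfield W"
  shows "d3 (ins_endo K (ext_d A 2 (ins_endo K \<Omega>))) X Y Z W p = d3 \<psi> X Y Z W p"
proof -
  obtain \<eta> where \<eta>: "form 2 \<eta>" "\<And>X Y. vfield X \<Longrightarrow> vfield Y \<Longrightarrow>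
      ev \<eta> [X, Y] = ev \<Omega> [apply_endo K X, apply_endo K Y]"
    using ex_pullback_form2[OF K \<Omega>] by blast
  let ?\<omega> = "\<lambda>p vs. ins_endo K (ins_endo K \<Omega>) p vs - \<eta> p vs"
  have \<omega>: "form 2 ?\<omega>" using K \<Omega> \<eta> by (intro diff_form_diff) auto
  have "ev (ins_endo K (ext_d A 2 (ins_endo K \<Omega>))) [X, Y, Z] p =
      ev (\<lambda>p vs. \<psi> p vs + ext_d A 2 ?\<omega> p vs) [X, Y, Z] p"
    if v: "vfield X" "vfield Y" "vfield Z" for X Y Z p
  proof -
    let ?x = "apply_endo K X" and ?y = "apply_endo K Y" and ?z = "apply_endo K Z"
    have d2: "d2 \<Omega> U V W = (\<lambda>p. 0)" if "vfield U" "vfield V" "vfield W" for U V W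
      using closed closed_form2_iff[OF \<Omega>] that by blast
    \<comment> \<open>Closedness is used with K in two of the three slots: these are the instances
      containing brackets [K X, K Y], as the torsion does.\<close>
    have d: "d2 \<Omega> X ?y ?z p = 0" "d2 \<Omega> ?x Y ?z p = 0" "d2 \<Omega> ?x ?y Z p = 0"
      using d2 v K by simp_all
    show ?thesis
      using d v K \<Omega> \<eta>
      by (simp add: ext_d2(2) \<omega> eval_form_add torsion eval2_torsion)
        (simp add: d2_def eval_form_diff algebra_simps)
  qed
  then have "d3 (ins_endo K (ext_d A 2 (ins_endo K \<Omega>))) X Y Z W =
      d3 (\<lambda>p vs. \<psi> p vs + ext_d A 2 ?\<omega> p vs) X Y Z W"
    by (intro d3_cong[OF _ v]) (simp add: fun_eq_iff)
  then show ?thesis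
    using d3_add[OF \<psi> ext_d2(1)[OF \<omega>] v, of p] d3_ext_d2[OF \<omega> v, of p] by simp
qed

end

section \<open>The Koszul bracket\<close>

lemma sum_Pow_insert:
  assumes "finite S" "n \<notin> S"
  shows "(\<Sum>I\<in>Pow (insert n S). f I) = (\<Sum>I\<in>Pow S. f I + f (insert n I))"
proof -
  have "inj_on (insert n) (Pow S)" using assms(2) by (auto simp: inj_on_def)
  moreover have "Pow S \<inter> insert n ` Pow S = {}" using assms(2) by auto
  ultimately show ?thesis
    using assms(1) by (simp add: Pow_insert sum.union_disjoint sum.reindex sum.distrib)
qed

definition shuffle_inversions :: "nat set \<Rightarrow> nat" where
  "shuffle_inversions I = card {(i, j). i \<in> I \<and> j \<notin> I \<and> j < i}"

lemma shuffle_inversions_simps: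
  "shuffle_inversions {} = 0" "shuffle_inversions {0} = 0" "shuffle_inversions {Suc 0} = 1"
  "shuffle_inversions {Suc 0, 0} = 0" "shuffle_inversions {Suc (Suc 0)} = 2"
  "shuffle_inversions {Suc (Suc 0), 0} = 1" "shuffle_inversions {Suc (Suc 0), Suc 0} = 2"
  "shuffle_inversions {Suc (Suc 0), Suc 0, 0} = 0"
proof -
  have "{(i, j). i \<in> {} \<and> j \<notin> {} \<and> j < i} = ({} :: (nat \<times> nat) set)"
    "{(i, j). i \<in> {0} \<and> j \<notin> {0} \<and> j < i} = ({} :: (nat \<times> nat) set)"
    "{(i, j). i \<in> {Suc 0} \<and> j \<notin> {Suc 0} \<and> j < i} = {(Suc 0, 0)}"
    "{(i, j). i \<in> {Suc 0, 0} \<and> j \<notin> {Suc 0, 0} \<and> j < i} = {}"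
    "{(i, j). i \<in> {Suc (Suc 0)} \<and> j \<notin> {Suc (Suc 0)} \<and> j < i} = {(Suc (Suc 0), 0), (Suc (Suc 0), Suc 0)}"
    "{(i, j). i \<in> {Suc (Suc 0), 0} \<and> j \<notin> {Suc (Suc 0), 0} \<and> j < i} = {(Suc (Suc 0), Suc 0)}"
    "{(i, j). i \<in> {Suc (Suc 0), Suc 0} \<and> j \<notin> {Suc (Suc 0), Suc 0} \<and> j < i} =
      {(Suc (Suc 0), 0), (Suc 0, 0)}"
    "{(i, j). i \<in> {Suc (Suc 0), Suc 0, 0} \<and> j \<notin> {Suc (Suc 0), Suc 0, 0} \<and> j < i} = {}"
    by auto
  note this[folded shuffle_inversions_def]
  then show "shuffle_inversions {} = 0" "shuffle_inversions {0} = 0" "shuffle_inversions {Suc 0} = 1"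
    "shuffle_inversions {Suc 0, 0} = 0" "shuffle_inversions {Suc (Suc 0)} = 2"
    "shuffle_inversions {Suc (Suc 0), 0} = 1" "shuffle_inversions {Suc (Suc 0), Suc 0} = 2"
    "shuffle_inversions {Suc (Suc 0), Suc 0, 0} = 0"
    unfolding shuffle_inversions_def by (simp_all only: card.empty card_insert_disjoint) auto
qed

lemma wedge_1: "wedge \<omega> \<eta> p [u] = \<omega> p [] * \<eta> p [u] + \<omega> p [u] * \<eta> p []"
  unfolding wedge_def shuffle_inversions_def[symmetric]
  by (simp add: lessThan_Suc sum_Pow_insert shuffle_inversions_simps nths_Cons)

lemma wedge_2: "wedge \<omega> \<eta> p [u, v] =
    \<omega> p [] * \<eta> p [u, v] + \<omega> p [u] * \<eta> p [v] - \<omega> p [v] * \<eta> p [u] + \<omega> p [u, v] * \<eta> p []"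
  unfolding wedge_def shuffle_inversions_def[symmetric]
  by (simp add: lessThan_Suc sum_Pow_insert shuffle_inversions_simps nths_Cons)

lemma wedge_3: "wedge \<omega> \<eta> p [u, v, w] =
    \<omega> p [] * \<eta> p [u, v, w] + \<omega> p [u] * \<eta> p [v, w] - \<omega> p [v] * \<eta> p [u, w] + \<omega> p [w] * \<eta> p [u, v] +
    \<omega> p [u, v] * \<eta> p [w] - \<omega> p [u, w] * \<eta> p [v] + \<omega> p [v, w] * \<eta> p [u] + \<omega> p [u, v, w] * \<eta> p []"
  unfolding wedge_def shuffle_inversions_def[symmetric]
  by (simp add: lessThan_Suc sum_Pow_insert shuffle_inversions_simps nths_Cons)

text \<open>Only the empty shuffle survives, because a 0-form vanishes on nonempty lists.\<close>

lemma wedge_form0: "wedge (form0 g) \<eta> = (\<lambda>p vs. g p * \<eta> p vs)"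
proof (intro ext)
  fix p and vs :: "'a tvec list"
  let ?f = "\<lambda>I. (-1) ^ card {(i, j). i \<in> I \<and> j \<notin> I \<and> j < i} * form0 g p (nths vs I) * \<eta> p (nths vs (- I))"
  have "?f I = 0" if "I \<in> Pow {..<length vs} - {{}}" for I
  proof -
    have "I \<noteq> {}" "I \<subseteq> {..<length vs}" using that by auto
    then obtain i where "i \<in> I" "i < length vs" by auto
    then have "vs ! i \<in> set (nths vs I)" by (auto simp: set_nths)
    then have "nths vs I \<noteq> []" by auto
    then show ?thesis by (simp add: form0_def)
  qed
  then have "wedge (form0 g) \<eta> p vs = (\<Sum>I\<in>{{}}. ?f I)"
    unfolding wedge_def by (intro sum.mono_neutral_right) auto
  then show "wedge (form0 g) \<eta> p vs = g p * \<eta> p vs"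
    by (simp add: form0_def nths_all)
qed

context smooth_manifold
begin

lemma diff_form_form0 [simp]: "smooth f \<Longrightarrow> form 0 (form0 f)"
  by (auto simp: diff_form_def form0_def alt_forms_def eval_form_def)

lemma form0_Nil [simp]: "form0 f p [] = f p" and form0_Cons [simp]: "form0 f p (v # vs) = 0"
  by (simp_all add: form0_def)

lemma form_Nil [simp]:
  "form 1 \<alpha> \<Longrightarrow> \<alpha> p [] = 0" "form 2 \<Omega> \<Longrightarrow> \<Omega> p [] = 0"
  "form 1 \<alpha> \<Longrightarrow> \<alpha> p [u, v] = 0" "form 2 \<Omega> \<Longrightarrow> \<Omega> p [u] = 0"
  "form 1 \<alpha> \<Longrightarrow> \<alpha> p [u, v, w] = 0" "form 2 \<Omega> \<Longrightarrow> \<Omega> p [u, v, w] = 0"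
  by (erule alt_form_outside[OF diff_form_alt], simp add: One_nat_def numeral_2_eq_2)+

lemma eval_wedge11 [simp]:
  assumes "form 1 \<alpha>" "form 1 \<beta>"
  shows "ev (wedge \<alpha> \<beta>) [X, Y] =
    (\<lambda>p. ev \<alpha> [X] p * ev \<beta> [Y] p - ev \<alpha> [Y] p * ev \<beta> [X] p)"
  using assms by (simp add: eval_form_def wedge_2)

lemma eval_wedge12 [simp]:
  assumes "form 1 \<alpha>" "form 2 \<omega>"
  shows "ev (wedge \<alpha> \<omega>) [X, Y, Z] = (\<lambda>p. ev \<alpha> [X] p * ev \<omega> [Y, Z] p -
    ev \<alpha> [Y] p * ev \<omega> [X, Z] p + ev \<alpha> [Z] p * ev \<omega> [X, Y] p)"
  using assms by (simp add: eval_form_def wedge_3)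

lemma eval_wedge21 [simp]:
  assumes "form 2 \<omega>" "form 1 \<alpha>"
  shows "ev (wedge \<omega> \<alpha>) [X, Y, Z] = (\<lambda>p. ev \<omega> [X, Y] p * ev \<alpha> [Z] p -
    ev \<omega> [X, Z] p * ev \<alpha> [Y] p + ev \<omega> [Y, Z] p * ev \<alpha> [X] p)"
  using assms by (simp add: eval_form_def wedge_3)

lemma diff_form_wedge11 [simp]:
  assumes \<alpha>: "form 1 \<alpha>" and \<beta>: "form 1 \<beta>"
  shows "form 2 (wedge \<alpha> \<beta>)"
proof -
  have "\<exists>\<eta>. form 2 \<eta> \<and> (\<forall>X Y. vfield X \<longrightarrow> vfield Y \<longrightarrow>
      ev \<eta> [X, Y] = ev (wedge \<alpha> \<beta>) [X, Y])"
    by (rule tensorial_form2) (use assms in \<open>simp_all add: algebra_simps\<close>)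
  then obtain \<eta> where \<eta>: "form 2 \<eta>" "\<And>X Y. vfield X \<Longrightarrow> vfield Y \<Longrightarrow>
      ev \<eta> [X, Y] = ev (wedge \<alpha> \<beta>) [X, Y]" by blast
  have "wedge \<alpha> \<beta> = \<eta>"
  proof (rule diff_form_cong[OF \<eta>(1)])
    fix p and vs :: "'m tvec list" assume out: "\<not> (length vs = 2 \<and> set vs \<subseteq> tangent p)"
    show "wedge \<alpha> \<beta> p vs = 0"
      unfolding wedge_def
    proof (rule sum.neutral, rule ballI)
      fix I assume "I \<in> Pow {..<length vs}"
      have "\<alpha> p (nths vs I) = 0 \<or> \<beta> p (nths vs (- I)) = 0"
      proof (rule ccontr)
        assume "\<not> ?thesis"
        then have a: "length (nths vs I) = 1 \<and> set (nths vs I) \<subseteq> tangent p"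
          and b: "length (nths vs (- I)) = 1 \<and> set (nths vs (- I)) \<subseteq> tangent p"
          using alt_form_outside[OF diff_form_alt[OF \<alpha>]] alt_form_outside[OF diff_form_alt[OF \<beta>]] by blast+
        have "{..<length vs} = {i. i < length vs \<and> i \<in> I} \<union> {i. i < length vs \<and> i \<in> - I}" by auto
        then have "length vs = card ({i. i < length vs \<and> i \<in> I} \<union> {i. i < length vs \<and> i \<in> - I})"
          by (metis card_lessThan)
        also have "\<dots> = 2"
          using a b by (subst card_Un_disjoint) (auto simp: length_nths)
        finally have "length vs = 2" .
        moreover have "set vs \<subseteq> set (nths vs I) \<union> set (nths vs (- I))"
        proof
          fix v assume "v \<in> set vs"
          then obtain i where "i < length vs" "v = vs ! i" by (auto simp: in_set_conv_nth)
          then show "v \<in> set (nths vs I) \<union> set (nths vs (- I))"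
            by (cases "i \<in> I") (auto simp: set_nths)
        qed
        ultimately show False using a b out by blast
      qed
      then show "(- 1) ^ card {(i, j). i \<in> I \<and> j \<notin> I \<and> j < i} * \<alpha> p (nths vs I) * \<beta> p (nths vs (- I)) = 0"
        by auto
    qed
  next
    fix Xs p assume "length Xs = 2" "\<forall>X\<in>set Xs. vfield X"
    then show "ev (wedge \<alpha> \<beta>) Xs p = ev \<eta> Xs p"
      using \<eta>(2) unfolding length_numeral_cases by fastforce
  qed
  then show ?thesis using \<eta>(1) by simp
qed

text \<open>The sum of dx_i \<and> i_{E_i} \<Omega> over the frame is 2 \<theta> \<Omega>, which
  reduces to wedges of two 1-forms; \<open>one_form_functional_eq_0\<close> then makes first one
  factor and then the other exact.\<close>

lemma two_form_functional_eq_0: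
  fixes T :: "'m dform \<Rightarrow> real"
  assumes lin: "\<And>g h \<omega> \<eta>. smooth g \<Longrightarrow> smooth h \<Longrightarrow> form 2 \<omega> \<Longrightarrow>
      form 2 \<eta> \<Longrightarrow> T (\<lambda>q vs. g q * \<omega> q vs + h q * \<eta> q vs) = g p * T \<omega> + h p * T \<eta>"
    and exact: "\<And>f g. smooth f \<Longrightarrow> smooth g \<Longrightarrow> T (wedge (df f) (df g)) = 0"
    and \<Omega>: "form 2 \<Omega>"
  shows "T \<Omega> = 0"
proof -
  have wl: "wedge (\<lambda>q vs. g q * \<alpha> q vs + h q * \<alpha>' q vs) \<beta> =
      (\<lambda>q vs. g q * wedge \<alpha> \<beta> q vs + h q * wedge \<alpha>' \<beta> q vs)" for g h :: "'m \<Rightarrow> real" and \<alpha> \<alpha>' \<beta>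
    by (simp add: wedge_def sum.distrib sum_distrib_left algebra_simps fun_eq_iff)
  have wr: "wedge \<beta> (\<lambda>q vs. g q * \<alpha> q vs + h q * \<alpha>' q vs) =
      (\<lambda>q vs. g q * wedge \<beta> \<alpha> q vs + h q * wedge \<beta> \<alpha>' q vs)" for g h :: "'m \<Rightarrow> real" and \<alpha> \<alpha>' \<beta>
    by (simp add: wedge_def sum.distrib sum_distrib_left algebra_simps fun_eq_iff)
  have T1: "T (wedge \<alpha> (df g)) = 0" if "form 1 \<alpha>" "smooth g" for \<alpha> g
    by (rule one_form_functional_eq_0[of "\<lambda>\<alpha>. T (wedge \<alpha> (df g))" p]) (use that lin exact in \<open>auto simp: wl\<close>)
  have T2: "T (wedge \<alpha> \<beta>) = 0" if "form 1 \<alpha>" "form 1 \<beta>" for \<alpha> \<beta>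
    by (rule one_form_functional_eq_0[of "\<lambda>\<beta>. T (wedge \<alpha> \<beta>)" p]) (use that lin T1 in \<open>auto simp: wr\<close>)
  obtain \<theta> I x E where wf: "weighted_frame \<theta> I x E" and p: "\<theta> p \<noteq> 0"
    using ex_weighted_frame by blast
  note fr = weighted_frameD[OF wf]
  define W where "W J = (\<lambda>q vs. \<Sum>i\<in>J. wedge (df (x i)) (contr (E i) \<Omega>) q vs)" for J
  have *: "form 2 (W J) \<and> T (W J) = 0" if "finite J" for J
    using that
  proof (induction J rule: finite_induct)
    case empty
    then show ?case using lin[of "\<lambda>_. 0" "\<lambda>_. 0" \<Omega> \<Omega>] \<Omega> by (simp add: W_def)
  next
    case (insert i J)
    have a: "form 1 (df (x i))" "form 1 (contr (E i) \<Omega>)" using fr(3,4) \<Omega> by simp_all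
    have "W (insert i J) = (\<lambda>q vs. (\<lambda>_. 1) q * wedge (df (x i)) (contr (E i) \<Omega>) q vs + (\<lambda>_. 1) q * W J q vs)"
      using insert by (simp add: W_def)
    then show ?case
      using insert.IH lin[of "\<lambda>_. 1" "\<lambda>_. 1" "wedge (df (x i)) (contr (E i) \<Omega>)" "W J"] T2[OF a]
        diff_form_comb[of "\<lambda>_. 1" 2 "wedge (df (x i)) (contr (E i) \<Omega>)" "\<lambda>_. 1" "W J"] a by simp
  qed
  \<comment> \<open>The factor 2 is the degree: each of the two slots contributes one copy of
    \<theta> \<Omega>.\<close>
  let ?S = "\<lambda>q vs. 2 * \<theta> q * \<Omega> q vs + 0 * \<Omega> q vs"
  have S: "form 2 ?S" using fr(2) \<Omega> by (intro diff_form_comb) auto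
  have "W I = ?S"
  proof (rule form_eqI[OF _ S])
    show "form 2 (W I)" using * fr(1) by blast
    fix Xs q assume "length Xs = 2" "\<forall>X\<in>set Xs. vfield X"
    then obtain X Y where XY: "Xs = [X, Y]" "vfield X" "vfield Y"
      by (auto simp: length_numeral_cases)
    have ex: "(\<Sum>i\<in>I. act U (x i) q * ev \<Omega> [E i, V] q) = \<theta> q * ev \<Omega> [U, V] q"
      if U: "vfield U" and V: "vfield V" for U V
    proof -
      have "(\<lambda>ws. \<Omega> q (ws @ [V q])) \<in> alt_forms A q 1"
      proof (rule alt_form1I)
        fix vs assume "\<not> (\<exists>v\<in>tangent q. vs = [v])"
        then show "\<Omega> q (vs @ [V q]) = 0"
          by (intro alt_form_outside[OF diff_form_alt[OF \<Omega>]])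
            (auto simp: numeral_2_eq_2 length_Suc_conv)
      next
        fix u w and a b :: real assume "u \<in> tangent q" "w \<in> tangent q"
        then show "\<Omega> q ([\<lambda>f. a * u f + b * w f] @ [V q]) = a * \<Omega> q ([u] @ [V q]) + b * \<Omega> q ([w] @ [V q])"
          using alt_form_linear[OF diff_form_alt[OF \<Omega>], of "[u, V q]" q 0 u w a b] V by simp
      qed
      from fun_cong[OF covector_expansion[OF wf this], of "[U q]"]
      show ?thesis
        using ext_d0_apply[OF fr(3) vector_field_tangent[OF U]]
        by (simp add: act_def eval_form_def mult.commute)
    qed
    have "ev (W I) Xs q = (\<Sum>i\<in>I. ev (wedge (df (x i)) (contr (E i) \<Omega>)) [X, Y] q)"
      by (simp add: W_def eval_form_def XY)
    also have "\<dots> = (\<Sum>i\<in>I. act X (x i) q * ev \<Omega> [E i, Y] q) - (\<Sum>i\<in>I. act Y (x i) q * ev \<Omega> [E i, X] q)"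
      using fr(3,4) \<Omega> XY by (simp add: sum_subtractf)
    also have "\<dots> = \<theta> q * ev \<Omega> [X, Y] q - \<theta> q * ev \<Omega> [Y, X] q"
      using ex XY by simp
    also have "\<dots> = ev ?S Xs q"
      using form2_swap[OF \<Omega> XY(2,3)] by (simp add: XY(1) eval_form_def)
    finally show "ev (W I) Xs q = ev ?S Xs q" .
  qed
  then have "T ?S = 0" using *[OF fr(1)] by simp
  then have "2 * \<theta> p * T \<Omega> = 0"
    using lin[of "\<lambda>q. 2 * \<theta> q" "\<lambda>_. 0" \<Omega> \<Omega>] fr(2) \<Omega> by simp
  then show ?thesis using p by simp
qed

end

section \<open>The axioms of the Koszul bracket in usable form\<close>

context smooth_manifold
begin

lemmas koszul_degree =
  koszul_bracket_def[THEN iffD1, THEN conjunct1, rule_format]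

lemmas koszul_functions =
  koszul_bracket_def[THEN iffD1, THEN conjunct2, THEN conjunct1, rule_format]

lemmas koszul_linear =
  koszul_bracket_def[THEN iffD1, THEN conjunct2, THEN conjunct2, THEN conjunct1, rule_format, THEN conjunct2]

lemmas koszul_one_forms =
  koszul_bracket_def[THEN iffD1, THEN conjunct2, THEN conjunct2, THEN conjunct2, THEN conjunct1, rule_format]

lemmas koszul_one_form_function =
  koszul_bracket_def[THEN iffD1, THEN conjunct2, THEN conjunct2, THEN conjunct2, THEN conjunct2, THEN conjunct1, rule_format]

lemmas koszul_swap =
  koszul_bracket_def[THEN iffD1, THEN conjunct2, THEN conjunct2, THEN conjunct2, THEN conjunct2, THEN conjunct2, THEN conjunct1, rule_format]

lemmas koszul_wedge =
  koszul_bracket_def[THEN iffD1, THEN conjunct2, THEN conjunct2, THEN conjunct2, THEN conjunct2, THEN conjunct2, THEN conjunct2, rule_format]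

text \<open>A multiple by a function is a wedge with a 0-form, and the sign in the Leibniz rule is
  then (-1)^0. The terms containing \<open>B \<zeta> (form0 g)\<close> are what the other side of an
  identity must reproduce before \<open>two_form_functional_eq_0\<close> applies.\<close>

lemma koszul_comb:
  assumes B: "koszul_bracket A \<pi> B" and "smooth g" "smooth h"
    and "form q \<zeta>" "form k \<omega>" "form k \<eta>"
  shows "B \<zeta> (\<lambda>p vs. g p * \<omega> p vs + h p * \<eta> p vs) =
    (\<lambda>p vs. wedge (B \<zeta> (form0 g)) \<omega> p vs + g p * B \<zeta> \<omega> p vs +
      (wedge (B \<zeta> (form0 h)) \<eta> p vs + h p * B \<zeta> \<eta> p vs))"
proof -
  have w: "B \<zeta> (\<lambda>p vs. f p * \<xi> p vs) = (\<lambda>p vs. wedge (B \<zeta> (form0 f)) \<xi> p vs + f p * B \<zeta> \<xi> p vs)"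
    if "smooth f" "form k \<xi>" for f \<xi>
    using koszul_wedge[OF B assms(4) diff_form_form0[OF that(1)] that(2)] by (simp add: wedge_form0)
  show ?thesis
    using koszul_linear[OF B diff_form_scale[OF assms(2,5)] diff_form_scale[OF assms(3,6)] assms(4), of 1 1]
    by (simp add: w assms)
qed

end

section \<open>Brackets of 2-forms with functions, exact 1-forms and the closed 2-form\<close>

context poisson_closed_form
begin

lemma eval_df_sharp:
  "smooth f \<Longrightarrow> form 1 \<alpha> \<Longrightarrow> ev \<alpha> [sh (df f)] = (\<lambda>p. - act (sh \<alpha>) f p)"
  using eval_sharp_swap[OF \<pi> diff_form_ext_d0, of f \<alpha>] by simp

text \<open>As the bracket of two functions is zero, the left side has no derivative terms and is
  linear over functions in \<eta>. On du \<and> dv the claim reduces to the brackets of f with du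
  and dv, given by (K1) and (K2).\<close>

lemma koszul_fun_form2:
  assumes B: "koszul_bracket A \<pi> B" and f: "smooth f" and \<eta>: "form 2 \<eta>"
    and X: "vfield X"
  shows "ev (B (form0 f) \<eta>) [X] p = ev \<eta> [sh (df f), X] p"
proof -
  let ?T = "\<lambda>\<eta>. ev (B (form0 f) \<eta>) [X] p - ev \<eta> [sh (df f), X] p"
  have "?T \<eta> = 0"
  proof (rule two_form_functional_eq_0[of ?T p, OF _ _ \<eta>])
    fix g h \<omega> \<eta> assume g: "smooth g" and h: "smooth h" and "form 2 \<omega>" "form 2 \<eta>"
    from koszul_comb[OF B g h diff_form_form0[OF f] this(3,4)]
    show "?T (\<lambda>q vs. g q * \<omega> q vs + h q * \<eta> q vs) = g p * ?T \<omega> + h p * ?T \<eta>"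
      using koszul_functions[OF B diff_form_form0[OF f]] g h
      by (simp add: eval_form_def wedge_def algebra_simps)
  next
    fix u v assume u: "smooth u" and v: "smooth v"
    have b: "B (form0 f) (df w) = (\<lambda>p vs. - form0 (act (sh (df w)) f) p vs)" if "smooth w" for w
      using koszul_swap[OF B diff_form_form0[OF f] diff_form_ext_d0[OF that]]
        koszul_one_form_function[OF B diff_form_ext_d0[OF that] f] f that by simp
    show "?T (wedge (df u) (df v)) = 0"
      using koszul_wedge[OF B diff_form_form0[OF f] diff_form_ext_d0[OF u] diff_form_ext_d0[OF v]]
        f u v X eval_df_sharp[OF f diff_form_ext_d0[OF u]] eval_df_sharp[OF f diff_form_ext_d0[OF v]]
      by (simp add: b) (simp add: eval_form_def wedge_1 ext_d0_apply act_def)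
  qed
  then show ?thesis by simp
qed

text \<open>The right side is the Lie derivative of \<eta> along the Hamiltonian field sharp df.
  Both sides are derivations in \<eta>; they act in the same way on functions, and both send dw to
  the differential of the derivative of w along this field.\<close>

lemma koszul_exact_form2:
  assumes B: "koszul_bracket A \<pi> B" and f: "smooth f" and \<eta>: "form 2 \<eta>"
    and X: "vfield X" and Y: "vfield Y"
  shows "ev (B (df f) \<eta>) [X, Y] p = act (sh (df f)) (ev \<eta> [X, Y]) p -
    ev \<eta> [lie_bracket (sh (df f)) X, Y] p - ev \<eta> [X, lie_bracket (sh (df f)) Y] p"
proof -
  let ?F = "sh (df f)"
  have F: "vfield ?F" using f by simp
  let ?T = "\<lambda>\<eta>. ev (B (df f) \<eta>) [X, Y] p - (act ?F (ev \<eta> [X, Y]) p -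
    ev \<eta> [lie_bracket ?F X, Y] p - ev \<eta> [X, lie_bracket ?F Y] p)"
  have "?T \<eta> = 0"
  proof (rule two_form_functional_eq_0[of ?T p, OF _ _ \<eta>])
    fix g h \<omega> \<eta> assume g: "smooth g" and h: "smooth h"
      and w: "form 2 \<omega>" "form 2 \<eta>"
    have b: "B (df f) (form0 u) = form0 (act ?F u)" if "smooth u" for u
      using koszul_one_form_function[OF B diff_form_ext_d0[OF f] that] F that by simp
    have e: "ev (B (df f) (\<lambda>q vs. g q * \<omega> q vs + h q * \<eta> q vs)) [X, Y] p =
        act ?F g p * ev \<omega> [X, Y] p + g p * ev (B (df f) \<omega>) [X, Y] p +
        (act ?F h p * ev \<eta> [X, Y] p + h p * ev (B (df f) \<eta>) [X, Y] p)"
      unfolding koszul_comb[OF B g h diff_form_ext_d0[OF f] w] b[OF g] b[OF h] wedge_form0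
      by (simp add: eval_form_def)
    show "?T (\<lambda>q vs. g q * \<omega> q vs + h q * \<eta> q vs) = g p * ?T \<omega> + h p * ?T \<eta>"
      unfolding e using g h w F X Y by (simp add: algebra_simps)
  next
    fix u v assume u: "smooth u" and v: "smooth v"
    have b: "form 1 (B (df f) (df w))"
      "vfield Z \<Longrightarrow> ev (B (df f) (df w)) [Z] = act Z (act ?F w)"
      if w: "smooth w" for w Z
      using koszul_one_forms[OF B diff_form_ext_d0[OF f] diff_form_ext_d0[OF w]] f w
        eval_df_sharp[OF f diff_form_ext_d0[OF w]]
      by (simp_all add: eval_bracket1 act_lie_bracket)
    have e: "ev (B (df f) (wedge (df u) (df v))) [X, Y] p =
        ev (wedge (B (df f) (df u)) (df v)) [X, Y] p + ev (wedge (df u) (B (df f) (df v))) [X, Y] p"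
      using koszul_wedge[OF B diff_form_ext_d0[OF f] diff_form_ext_d0[OF u] diff_form_ext_d0[OF v]]
      by (simp add: eval_form_def)
    show "?T (wedge (df u) (df v)) = 0"
      unfolding e using u v F X Y by (simp add: b act_lie_bracket algebra_simps)
  qed
  then show ?thesis by simp
qed

lemma act_P: "smooth f \<Longrightarrow> vfield X \<Longrightarrow> act (apply_endo P X) f = (\<lambda>p. ev \<Omega> [sh (df f), X] p)"
  using eval_P[of "df f" X] form2_swap[OF \<Omega>, of X "sh (df f)"] by simp

text \<open>The right side is (i_P d - d i_P) \<eta>. The brackets of \<Omega> with functions and
  with exact 1-forms follow by (K1) from \<open>koszul_fun_form2\<close> and
  \<open>koszul_exact_form2\<close>, taken at \<eta> = \<Omega>.\<close>

lemma koszul_closed_form2: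
  assumes B: "koszul_bracket A \<pi> B" and \<eta>: "form 2 \<eta>"
    and v: "vfield X" "vfield Y" "vfield Z"
  shows "ev (B \<Omega> \<eta>) [X, Y, Z] p = d2 \<eta> (apply_endo P X) Y Z p + d2 \<eta> X (apply_endo P Y) Z p +
    d2 \<eta> X Y (apply_endo P Z) p - d2 (ins_endo P \<eta>) X Y Z p"
proof -
  let ?x = "apply_endo P X" and ?y = "apply_endo P Y" and ?z = "apply_endo P Z"
  let ?R = "\<lambda>\<eta>. d2 \<eta> ?x Y Z p + d2 \<eta> X ?y Z p + d2 \<eta> X Y ?z p - d2 (ins_endo P \<eta>) X Y Z p"
  let ?T = "\<lambda>\<eta>. ev (B \<Omega> \<eta>) [X, Y, Z] p - ?R \<eta>"
  have v': "vfield ?x" "vfield ?y" "vfield ?z" using v by simp_all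
  have "?T \<eta> = 0"
  proof (rule two_form_functional_eq_0[of ?T p, OF _ _ \<eta>])
    fix g h \<omega> \<eta> assume g: "smooth g" and h: "smooth h"
      and w: "form 2 \<omega>" "form 2 \<eta>"
    have b: "form 1 (B \<Omega> (form0 u))"
      "\<And>U. vfield U \<Longrightarrow> ev (B \<Omega> (form0 u)) [U] = act (apply_endo P U) u"
      if u: "smooth u" for u
    proof -
      show "form 1 (B \<Omega> (form0 u))"
        using koszul_degree[OF B \<Omega> diff_form_form0[OF u]] by (simp add: One_nat_def)
      \<comment> \<open>For degrees 2 and 0 the exponent in (K1) is -1, so the total sign is +1; an
        exponent truncated at 0 would give the opposite sign.\<close>
      have "B \<Omega> (form0 u) = B (form0 u) \<Omega>"
        using koszul_swap[OF B \<Omega> diff_form_form0[OF u]] by simp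
      then show "ev (B \<Omega> (form0 u)) [U] = act (apply_endo P U) u" if "vfield U" for U
        using koszul_fun_form2[OF B u \<Omega> that] act_P[OF u that] by (intro ext) simp
    qed
    have e: "ev (B \<Omega> (\<lambda>q vs. g q * \<omega> q vs + h q * \<eta> q vs)) [X, Y, Z] p =
        ev (wedge (B \<Omega> (form0 g)) \<omega>) [X, Y, Z] p + g p * ev (B \<Omega> \<omega>) [X, Y, Z] p +
        (ev (wedge (B \<Omega> (form0 h)) \<eta>) [X, Y, Z] p + h p * ev (B \<Omega> \<eta>) [X, Y, Z] p)"
      unfolding koszul_comb[OF B g h \<Omega> w] by (simp add: eval_form_def)
    show "?T (\<lambda>q vs. g q * \<omega> q vs + h q * \<eta> q vs) = g p * ?T \<omega> + h p * ?T \<eta>"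
      unfolding e using g h w v v' by (simp add: b d2_def algebra_simps)
  next
    fix s t assume s: "smooth s" and t: "smooth t"
    have b: "form 2 (B \<Omega> (df u))"
      "\<And>U V q. vfield U \<Longrightarrow> vfield V \<Longrightarrow> ev (B \<Omega> (df u)) [U, V] q =
        act V (act (apply_endo P U) u) q - act U (act (apply_endo P V) u) q +
        act (apply_endo P (lie_bracket U V)) u q"
      if u: "smooth u" for u
    proof -
      show "form 2 (B \<Omega> (df u))"
        using koszul_degree[OF B \<Omega> diff_form_ext_d0[OF u]] by simp
      have sw: "B \<Omega> (df u) = (\<lambda>p vs. - B (df u) \<Omega> p vs)"
        using koszul_swap[OF B \<Omega> diff_form_ext_d0[OF u]] by simp
      fix U V q assume U: "vfield U" and V: "vfield V"
      have "ev (B \<Omega> (df u)) [U, V] q = - ev (B (df u) \<Omega>) [U, V] q"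
        unfolding sw by (simp add: eval_form_def)
      \<comment> \<open>By closedness the Lie derivative of \<Omega> along sharp du is the exterior
        derivative of the contraction i_{sharp du} \<Omega>, and that contraction is du \<circ> P by
        \<open>act_P\<close>.\<close>
      then show "ev (B \<Omega> (df u)) [U, V] q =
        act V (act (apply_endo P U) u) q - act U (act (apply_endo P V) u) q +
        act (apply_endo P (lie_bracket U V)) u q"
        using koszul_exact_form2[OF B u \<Omega> U V, of q] d2_closed[of "sh (df u)" U V q] u U V
          form2_swap[OF \<Omega>, of "sh (df u)" "lie_bracket U V"]
          form2_swap[OF \<Omega>, of "lie_bracket (sh (df u)) V" U]
        by (simp add: act_P d2_def)
    qed
    \<comment> \<open>The minus sign is the Leibniz sign (-1)^((2-1) 1): the bracket with a 2-form
      is an odd derivation.\<close>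
    have e: "ev (B \<Omega> (wedge (df s) (df t))) [X, Y, Z] p =
        ev (wedge (B \<Omega> (df s)) (df t)) [X, Y, Z] p - ev (wedge (df s) (B \<Omega> (df t))) [X, Y, Z] p"
      using koszul_wedge[OF B \<Omega> diff_form_ext_d0[OF s] diff_form_ext_d0[OF t]]
      by (simp add: eval_form_def)
    show "?T (wedge (df s) (df t)) = 0"
      unfolding e using s t v v' by (simp add: b d2_def act_lie_bracket algebra_simps)
  qed
  then show ?thesis by simp
qed

theorem koszul_bracket_closed:
  assumes B: "koszul_bracket A \<pi> B"
  shows "B \<Omega> \<Omega> = (\<lambda>p vs. - ext_d A 2 (ins_endo P \<Omega>) p vs)"
proof (rule form_eqI[of 3])
  have p: "form 2 (ins_endo P \<Omega>)" by simp
  show "form 3 (B \<Omega> \<Omega>)" using koszul_degree[OF B \<Omega> \<Omega>] by simp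
  show "form 3 (\<lambda>p vs. - ext_d A 2 (ins_endo P \<Omega>) p vs)"
    using diff_form_scale[OF smooth_fun_const[of "-1"] ext_d2(1)[OF p]] by simp
  fix Xs q assume "length Xs = 3" "\<forall>X\<in>set Xs. vfield X"
  then obtain X Y Z where "Xs = [X, Y, Z]" "vfield X" "vfield Y" "vfield Z"
    by (auto simp: length_numeral_cases)
  then show "ev (B \<Omega> \<Omega>) Xs q = ev (\<lambda>p vs. - ext_d A 2 (ins_endo P \<Omega>) p vs) Xs q"
    using koszul_closed_form2[OF B \<Omega>, of X Y Z q] ext_d2(2)[OF p, of X Y Z]
    by (simp add: d2_closed) (simp add: eval_form_def fun_eq_iff)
qed

end

section \<open>The deformed structure\<close>

context poisson_closed_form
begin

text \<open>If the torsion is the sharp of \<psi>, then \<Omega>(T(X, Y), Z) = \<psi>(X, Y, P Z),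
  because pairing with i_Z \<Omega> replaces sharp \<beta> by P Z. Hence i_T \<Omega> = i_P \<psi>,
  and the general identity for closed 2-forms applies.\<close>

lemma d3_ins_endo_torsion:
  assumes K: "endo_field A K" and \<psi>: "form 3 \<psi>"
    and torsion: "\<And>\<beta> X Y p. form 1 \<beta> \<Longrightarrow> vfield X \<Longrightarrow> vfield Y \<Longrightarrow>
      ev \<beta> [torsion K X Y] p = - ev \<psi> [X, Y, sh \<beta>] p"
    and v: "vfield X" "vfield Y" "vfield Z" "vfield W"
  shows "d3 (ins_endo K (ext_d A 2 (ins_endo K \<Omega>))) X Y Z W p = d3 (ins_endo P \<psi>) X Y Z W p"
proof (rule d3_ins_endo_ext_d2_ins_endo[OF \<Omega> closed K _ _ v])
  show "form 3 (ins_endo P \<psi>)" using \<psi> by simp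
  fix X Y Z assume v: "vfield X" "vfield Y" "vfield Z"
  have T: "vfield (torsion K X Y)" if "vfield X" "vfield Y" for X Y
    unfolding torsion_vcomb using K that by simp
  have e: "ev \<Omega> [torsion K X Y, Z] = ev \<psi> [X, Y, apply_endo P Z]"
    if v: "vfield X" "vfield Y" "vfield Z" for X Y Z
  proof
    fix p
    have "ev \<Omega> [torsion K X Y, Z] p = - ev (contr Z \<Omega>) [torsion K X Y] p"
      using form2_swap[OF \<Omega> v(3) T[OF v(1,2)]] by simp
    then show "ev \<Omega> [torsion K X Y, Z] p = ev \<psi> [X, Y, apply_endo P Z] p"
      using torsion[of "contr Z \<Omega>" X Y p] v by (simp flip: apply_P)
  qed
  show "ev (ins_endo P \<psi>) [X, Y, Z] = (\<lambda>p. ev \<Omega> [torsion K X Y, Z] p +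
      ev \<Omega> [torsion K Y Z, X] p - ev \<Omega> [torsion K X Z, Y] p)"
    using v \<psi> form3_swap(1)[OF \<psi>, of "apply_endo P X" Y Z] form3_swap(2)[OF \<psi>, of Y "apply_endo P X" Z]
      form3_swap(2)[OF \<psi>, of X "apply_endo P Y" Z] by (simp add: e algebra_simps)
qed

context
  fixes N :: "'m endo" and \<phi> :: "'m dform"
  assumes N: "endo_field A N" and \<phi>: "form 3 \<phi>" and compatible: "compatible A \<pi> N"
    and closed_\<phi>: "closed_form A 3 \<phi>" and closed_N\<phi>: "closed_form A 3 (ins_endo N \<phi>)"
    and torsion: "\<And>X Y. vfield X \<Longrightarrow> vfield Y \<Longrightarrow>
        torsion N X Y = sh (\<lambda>p ws. \<phi> p (X p # Y p # ws))"
begin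

text \<open>Free of \<open>B\<close>: the bracket enters only when the main theorem identifies this
  form with the stated one.\<close>

definition deformed_form :: "'m dform" where
  "deformed_form = (\<lambda>p vs. \<phi> p vs - ext_d A 2 (ins_endo N \<Omega>) p vs - 1/2 * ext_d A 2 (ins_endo P \<Omega>) p vs)"

lemma diff_form_exact [simp]:
  "form 3 (ext_d A 2 (ins_endo N \<Omega>))" "form 3 (ext_d A 2 (ins_endo P \<Omega>))"
  using N by (simp_all add: ext_d2(1))

lemma diff_form_deformed: "form 3 deformed_form"
  unfolding deformed_form_def using \<phi>
  by (intro diff_form_diff diff_form_scale) auto

lemma endo_deformed: "endo_field A (deformed_endo A \<pi> N \<Omega>)"
  by (rule endo_field_deformed[OF \<pi> N \<Omega>])

lemma eval_deformed_form:
  "ev deformed_form Xs = (\<lambda>p. ev \<phi> Xs p - ev (ext_d A 2 (ins_endo N \<Omega>)) Xs p -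
    1/2 * ev (ext_d A 2 (ins_endo P \<Omega>)) Xs p)"
  by (simp add: deformed_form_def eval_form_def)

text \<open>The sign comes from <\<beta>, sharp \<alpha>> = \<pi>(\<alpha>, \<beta>) and skew
  symmetry. It also turns the plus signs of \<open>eval_torsion_deformed\<close> into the minus
  signs of \<open>deformed_form\<close>.\<close>

lemma torsion_pairing:
  assumes "form 3 \<psi>" "form 1 \<beta>" "vfield X" "vfield Y"
  shows "ev \<beta> [sh (\<lambda>p ws. \<psi> p (X p # Y p # ws))] p = - ev \<psi> [X, Y, sh \<beta>] p"
proof -
  have "form 1 (contr Y (contr X \<psi>))" using assms by simp
  from eval_sharp_swap[OF \<pi> this assms(2)] show ?thesis
    by (simp add: contr_def[of Y] contr_def[of X]) (simp add: eval_form_def)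
qed

lemma torsion_deformed_pairing:
  assumes "form 1 \<beta>" "vfield X" "vfield Y"
  shows "ev \<beta> [Defs.torsion (deformed_endo A \<pi> N \<Omega>) X Y] p = - ev deformed_form [X, Y, sh \<beta>] p"
  using eval_torsion_deformed[OF N compatible assms, of p] torsion_pairing[OF \<phi> assms, of p] N assms
  by (simp add: torsion eval_deformed_form ext_d2(2))

lemma torsion_deformed:
  assumes X: "vfield X" and Y: "vfield Y"
  shows "Defs.torsion (deformed_endo A \<pi> N \<Omega>) X Y = sh (\<lambda>p ws. deformed_form p (X p # Y p # ws))"
proof (rule vector_field_eqI_eval)
  show "vfield (Defs.torsion (deformed_endo A \<pi> N \<Omega>) X Y)"
    unfolding torsion_vcomb using endo_deformed X Y by simp
  have "form 1 (contr Y (contr X deformed_form))" using diff_form_deformed X Y by simp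
  then show "vfield (sh (\<lambda>p ws. deformed_form p (X p # Y p # ws)))"
    using vector_field_sharp[OF \<pi>] by (simp add: contr_def)
  fix \<beta> p assume "form 1 \<beta>"
  then show "ev \<beta> [Defs.torsion (deformed_endo A \<pi> N \<Omega>) X Y] p =
      ev \<beta> [sh (\<lambda>p ws. deformed_form p (X p # Y p # ws))] p"
    using torsion_deformed_pairing torsion_pairing[OF diff_form_deformed] X Y by simp
qed

lemma d3_ins_endo_comb:
  assumes "endo_field A K" "vfield X" "vfield Y" "vfield Z" "vfield W"
  shows "d3 (ins_endo K deformed_form) X Y Z W p = d3 (ins_endo K \<phi>) X Y Z W p -
    d3 (ins_endo K (ext_d A 2 (ins_endo N \<Omega>))) X Y Z W p -
    1/2 * d3 (ins_endo K (ext_d A 2 (ins_endo P \<Omega>))) X Y Z W p"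
  using assms \<phi> by (simp add: d3_def eval_deformed_form algebra_simps)

lemma closed_deformed_form: "closed_form A 3 deformed_form"
  unfolding closed_form3_iff[OF diff_form_deformed]
proof (intro allI impI ext)
  fix X Y Z W p assume v: "vfield X" "vfield Y" "vfield Z" "vfield W"
  have "d3 deformed_form X Y Z W p = d3 \<phi> X Y Z W p - d3 (ext_d A 2 (ins_endo N \<Omega>)) X Y Z W p -
      1/2 * d3 (ext_d A 2 (ins_endo P \<Omega>)) X Y Z W p"
    using v \<phi> by (simp add: d3_def eval_deformed_form algebra_simps)
  then show "d3 deformed_form X Y Z W p = 0"
    using closed_\<phi> closed_form3_iff[OF \<phi>] v N by (simp add: d3_ext_d2)
qed

lemma d3_ins_endo_deformed:
  assumes \<psi>: "form 3 \<psi>"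
    and v: "vfield X" "vfield Y" "vfield Z" "vfield W"
  shows "d3 (ins_endo (deformed_endo A \<pi> N \<Omega>) \<psi>) X Y Z W p =
    d3 (ins_endo N \<psi>) X Y Z W p + d3 (ins_endo P \<psi>) X Y Z W p"
proof -
  have "d3 (ins_endo (deformed_endo A \<pi> N \<Omega>) \<psi>) X Y Z W =
      d3 (\<lambda>p vs. ins_endo N \<psi> p vs + ins_endo P \<psi> p vs) X Y Z W"
    using N \<psi> by (intro d3_cong[OF _ v] ext) (simp add: eval_form_add apply_deformed)
  then show ?thesis using d3_add[OF _ _ v] N \<psi> by simp
qed

lemma ext_d_ins_endo_deformed:
  "ext_d A 2 (ins_endo (deformed_endo A \<pi> N \<Omega>) \<Omega>) =
    (\<lambda>p vs. ext_d A 2 (ins_endo N \<Omega>) p vs + ext_d A 2 (ins_endo P \<Omega>) p vs)"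
proof (rule form_eqI[of 3])
  have M: "form 2 (ins_endo (deformed_endo A \<pi> N \<Omega>) \<Omega>)"
    using endo_deformed by simp
  then show "form 3 (ext_d A 2 (ins_endo (deformed_endo A \<pi> N \<Omega>) \<Omega>))" by (rule ext_d2(1))
  show "form 3 (\<lambda>p vs. ext_d A 2 (ins_endo N \<Omega>) p vs + ext_d A 2 (ins_endo P \<Omega>) p vs)"
    by (intro diff_form_add) auto
  fix Xs q assume "length Xs = 3" "\<forall>X\<in>set Xs. vfield X"
  then obtain X Y Z where v: "Xs = [X, Y, Z]" "vfield X" "vfield Y" "vfield Z"
    by (auto simp: length_numeral_cases)
  show "ev (ext_d A 2 (ins_endo (deformed_endo A \<pi> N \<Omega>) \<Omega>)) Xs q =
      ev (\<lambda>p vs. ext_d A 2 (ins_endo N \<Omega>) p vs + ext_d A 2 (ins_endo P \<Omega>) p vs) Xs q"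
    using v N M by (simp add: eval_form_add ext_d2(2)) (simp add: d2_def apply_deformed)
qed

text \<open>Write \<open>a(K, L)\<close> for the exterior derivative of \<open>i\<^sub>K d i\<^sub>L \<Omega>\<close>. Applying \<open>d3_ins_endo_torsion\<close> to \<open>N\<close>, \<open>P\<close> and
  \<open>N + P\<close> gives \<open>a(N, N) = d i\<^sub>P \<phi>\<close>, \<open>a(P, P) = - a(P, P) / 2\<close> and \<open>a(N, P) + 2 a(P, N) = 0\<close>,
  and these are the terms of the expansion.\<close>

lemma closed_ins_endo_deformed_form:
  "closed_form A 3 (ins_endo (deformed_endo A \<pi> N \<Omega>) deformed_form)"
  unfolding closed_form3_iff[OF diff_form_ins_endo3[OF endo_deformed diff_form_deformed]]
proof (intro allI impI ext)
  fix X Y Z W p assume v: "vfield X" "vfield Y" "vfield Z" "vfield W"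
  let ?u = "ext_d A 2 (ins_endo N \<Omega>)" and ?w = "ext_d A 2 (ins_endo P \<Omega>)"
  let ?D = "\<lambda>\<psi>. d3 \<psi> X Y Z W p"
  have NN: "?D (ins_endo N ?u) = ?D (ins_endo P \<phi>)"
    by (rule d3_ins_endo_torsion[OF N \<phi> _ v]) (simp add: torsion torsion_pairing[OF \<phi>])
  have "?D (ins_endo P ?w) = ?D (ins_endo P (\<lambda>p vs. (- 1/2) * ?w p vs))"
  proof (rule d3_ins_endo_torsion[OF endo_P _ _ v])
    show "form 3 (\<lambda>p vs. (- 1/2) * ?w p vs)" by (intro diff_form_scale) auto
    fix \<beta> X Y p assume "form 1 \<beta>" "vfield X" "vfield Y"
    then show "ev \<beta> [Defs.torsion P X Y] p = - ev (\<lambda>p vs. (- 1/2) * ?w p vs) [X, Y, sh \<beta>] p"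
      using eval_torsion_P[of \<beta> X Y p] unfolding eval_form_scale by (simp add: ext_d2(2))
  qed
  moreover have "?D (ins_endo P (\<lambda>p vs. (- 1/2) * ?w p vs)) = (- 1/2) * ?D (ins_endo P ?w)"
    using v unfolding d3_def eval_ins_endo3 eval_form_scale by (simp add: algebra_simps)
  ultimately have PP: "?D (ins_endo P ?w) = 0" by simp
  have "?D (ins_endo (deformed_endo A \<pi> N \<Omega>) (\<lambda>p vs. ?u p vs + ?w p vs)) = ?D (ins_endo P deformed_form)"
    using d3_ins_endo_torsion[OF endo_deformed diff_form_deformed torsion_deformed_pairing v]
    unfolding ext_d_ins_endo_deformed .
  moreover have "?D (ins_endo K (\<lambda>p vs. ?u p vs + ?w p vs)) = ?D (ins_endo K ?u) + ?D (ins_endo K ?w)"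
    if "endo_field A K" for K
    using v that unfolding d3_def eval_ins_endo3 eval_form_add by (simp add: algebra_simps)
  \<comment> \<open>The right side expands to d i_P \<phi> - a(P, N) - a(P, P) / 2; comparison with
    the left side by means of \<open>NN\<close> and \<open>PP\<close> leaves a(N, P) + 2 a(P, N) =
    0.\<close>
  ultimately have "?D (ins_endo N ?u) + ?D (ins_endo N ?w) + (?D (ins_endo P ?u) + ?D (ins_endo P ?w)) =
      ?D (ins_endo P deformed_form)"
    using d3_ins_endo_deformed[OF diff_form_add[OF diff_form_exact] v, of p] N by simp
  moreover have "?D (ins_endo N \<phi>) = 0"
    using closed_N\<phi> closed_form3_iff[OF diff_form_ins_endo3[OF N \<phi>]] v by simp
  \<comment> \<open>The total is d i_N \<phi> + (d i_P \<phi> - a(N, N)) - (a(N, P) + 2 a(P, N)) / 2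
    - a(P, P) / 2, and each group vanishes.\<close>
  ultimately show "?D (ins_endo (deformed_endo A \<pi> N \<Omega>) deformed_form) = 0"
    using NN PP d3_ins_endo_deformed[OF diff_form_deformed v, of p]
      d3_ins_endo_comb[OF N v, of p] d3_ins_endo_comb[OF endo_P v, of p] by simp
qed

end

end

theorem theorem3:
  fixes A :: "('m::{t2_space,second_countable_topology}, 'e::euclidean_space) atlas"
    and \<pi> :: "'m bivec" and N :: "'m endo" and \<phi> \<Omega> :: "'m dform"
    and B :: "'m dform \<Rightarrow> 'm dform \<Rightarrow> 'm dform"
  assumes "PqN_manifold A \<pi> N \<phi>"
    and "diff_form A 2 \<Omega>" and "closed_form A 2 \<Omega>"
    and "koszul_bracket A \<pi> B"
  shows "PqN_manifold A \<pi> (deformed_endo A \<pi> N \<Omega>)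
           (\<lambda>p vs. \<phi> p vs + d_endo A 2 N \<Omega> p vs + 1/2 * B \<Omega> \<Omega> p vs) \<and>
         ((\<lambda>p vs. d_endo A 2 N \<Omega> p vs + 1/2 * B \<Omega> \<Omega> p vs) = (\<lambda>p vs. - \<phi> p vs) \<longrightarrow>
           PN_manifold A \<pi> (deformed_endo A \<pi> N \<Omega>))"
proof -
  have A: "smooth_atlas A" and poisson: "poisson_bivector A \<pi>" and N: "endo_field A N"
    and \<phi>: "diff_form A 3 \<phi>" and c: "compatible A \<pi> N"
    and cl: "closed_form A 3 \<phi>" "closed_form A 3 (ins_endo N \<phi>)"
    and t: "\<And>X Y. vector_field A X \<Longrightarrow> vector_field A Y \<Longrightarrow>
      torsion N X Y = sharp_field A \<pi> (\<lambda>p ws. \<phi> p (X p # Y p # ws))"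
    using assms(1) by (auto simp: PqN_manifold_def)
  interpret poisson_closed_form A \<pi> \<Omega>
    by unfold_locales (use A poisson assms(2,3) in auto)
  note F = N \<phi> c cl t
  let ?M = "deformed_endo A \<pi> N \<Omega>"
  let ?\<psi> = "\<lambda>p vs. \<phi> p vs + d_endo A 2 N \<Omega> p vs + 1/2 * B \<Omega> \<Omega> p vs"
  \<comment> \<open>This removes i_N d\<Omega> from \<open>d_endo\<close>, so that d_N \<Omega>
    becomes - d i_N \<Omega>.\<close>
  have "ext_d A 2 \<Omega> = (\<lambda>p vs. 0)" using assms(3) by (simp add: closed_form_def)
  then have \<psi>: "deformed_form N \<phi> = ?\<psi>"
    by (simp add: deformed_form_def[OF F] koszul_bracket_closed[OF assms(4)] d_endo_def ins_endo_def fun_eq_iff)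
  have M: "endo_field A ?M" by (rule endo_field_deformed[OF \<pi> N \<Omega>])
  have cM: "compatible A \<pi> ?M" by (rule compatible_deformed[OF N c])
  have tM: "torsion ?M X Y = sharp_field A \<pi> (\<lambda>p ws. ?\<psi> p (X p # Y p # ws))"
    if "vector_field A X" "vector_field A Y" for X Y
    using torsion_deformed[OF F that] unfolding \<psi> .
  have "PqN_manifold A \<pi> ?M ?\<psi>"
    unfolding PqN_manifold_def
    using A poisson M cM tM diff_form_deformed[OF F] closed_deformed_form[OF F]
      closed_ins_endo_deformed_form[OF F] unfolding \<psi> by blast
  moreover have "PN_manifold A \<pi> ?M"
    if "(\<lambda>p vs. d_endo A 2 N \<Omega> p vs + 1/2 * B \<Omega> \<Omega> p vs) = (\<lambda>p vs. - \<phi> p vs)"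
  proof -
    have "?\<psi> p vs = 0" for p vs
      using fun_cong[OF fun_cong[OF that], of p vs] by simp
    then have "torsion ?M X Y = (\<lambda>p f. 0)" if "vector_field A X" "vector_field A Y" for X Y
      using tM[OF that] sharp_zero[OF \<pi>] by (simp add: sharp_field_def)
    then show ?thesis unfolding PN_manifold_def using A poisson M cM by blast
  qed
  ultimately show ?thesis by blast
qed

end
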